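(* Let $f\in\mathbb{R}[x,y,z]$ be homogeneous of degree $d\ge 1$ and hyperbolic with respect to a point $e=(e_1,e_2,e_3)\in\mathbb{R}^3$ with $f(e)>0$. Let $$g \;=\; e_1\frac{\partial f}{\partial x}+e_2\frac{\partial f}{\partial y}+e_3\frac{\partial f}{\partial z}.$$ Suppose that the projective plane curve $\mathcal{V}_{\mathbb{C}}(f)\subset\mathbb{P}^2(\mathbb{C})$ is smooth and that all the intersection points of $\mathcal{V}_{\mathbb{C}}(f)$ and $\mathcal{V}_{\mathbb{C}}(g)$ are transverse, i.e. the two curves intersect in $d(d-1)$ distinct points of $\mathbb{P}^2(\mathbb{C})$. Let $\mathcal{V}_{\mathbb{C}}(f)\cap\mathcal{V}_{\mathbb{C}}(g)=S\cup\overline{S}$ be any splitting of the intersection points into two disjoint sets that are complex conjugates of each other. Let $a=(a_{11},a_{12},\dots,a_{1d})$ be any basis, with $a_{11}=g$, of the ($d$-dimensional) complex vector space of those polynomials in $\mathbb{C}[x,y,z]_{d-1}$ that vanish at all points of $S$. Then the system of affine linear equations in the $3d^2$ unknown entries of $d\times d$ complex matrices $M_1,M_2,M_3$ obtained by comparing coefficients in the polynomial vector equations $$a\,(xM_1+yM_2+zM_3)=(f,0,\dots,0),\qquad (xM_1+yM_2+zM_3)\,\overline{a}^{T}=(f,0,\dots,0)^T$$ has a unique solution $(M_1,M_2,M_3)$. Moreover, the matrices $M_1,M_2,M_3$ of this solution are Hermitian and satisfy $$f \;=\; c\cdot\det(xM_1+yM_2+zM_3)\qquad\text{and}\qquad e_1M_1+e_2M_2+e_3M_3\succ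 0$$ for some $c\in\mathbb{R}_{>0}$.
   Context: A homogeneous polynomial $f\in\mathbb{R}[x,y,z]$ of degree $d$ is called hyperbolic with respect to $e\in\mathbb{R}^3$ if $f(e)\neq 0$ and every real line through $e$ meets the curve $\mathcal{V}_{\mathbb{C}}(f)$ in only real points; equivalently, for every $p\in\mathbb{R}^3$ the univariate polynomial $f(te+p)\in\mathbb{R}[t]$ has only real roots. For a homogeneous polynomial $h$, $\mathcal{V}_{\mathbb{C}}(h)\subset\mathbb{P}^2(\mathbb{C})$ denotes its set of complex projective zeros. The curve $\mathcal{V}_{\mathbb{C}}(f)$ is smooth if the gradient of $f$ does not vanish at any of its points. $\mathbb{C}[x,y,z]_{d-1}$ denotes the space of homogeneous polynomials of degree $d-1$ (including $0$). $\overline{S}$ denotes the set of coordinatewise complex conjugates of the points in $S$. For a row vector $a$ of polynomials, $\overline{a}$ is obtained by conjugating the coefficients (treating $x,y,z$ as real variables), and $\overline{a}^T$ is the corresponding column vector. $A\succ 0$ means that the Hermitian matrix $A$ is positive definite. Known facts from the literature, making the set-up meaningful under the stated hypotheses: none of the points of $\mathcal{V}_{\mathbb{C}}(f)\cap\mathcal{V}_{\mathbb{C}}(g)$ is real, so a splitting $S\cup\overline{S}$ exists; and the space of polynomials in $\mathbb{C}[x,y,z]_{d-1}$ vanishing on $S$ always has dimension $d$. *)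

theory Defs
  imports
    "HOL-Library.Poly_Mapping"
    "HOL-Analysis.Analysis"
    "Jordan_Normal_Form.Schur_Decomposition"
begin

no_notation Finite_Cartesian_Product.vec_nth (infixl "$" 90)
notation Finite_Cartesian_Product.vec_nth (infixl "$h" 90)

hide_const (open) Finite_Cartesian_Product.mat Determinants.det Finite_Cartesian_Product.vec

section \<open>Polynomials in three variables\<close>

text \<open>
  The variables are indexed by the three-element type \<^typ>\<open>3\<close>, whose elements are \<open>1\<close>, \<open>2\<close>
  and \<open>3\<close> (with \<open>3 = 0\<close>); they stand for \<open>x\<close>, \<open>y\<close>, \<open>z\<close>. A monomial is its exponent vector
  \<^typ>\<open>3 \<Rightarrow>\<^sub>0 nat\<close>.
\<close>

type_synonym 'a poly3 = "(3 \<Rightarrow>\<^sub>0 nat) \<Rightarrow>\<^sub>0 'a"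

definition Const :: "'a::zero \<Rightarrow> 'a poly3" where
  "Const c = Poly_Mapping.single 0 c"

definition Var :: "3 \<Rightarrow> 'a::zero_neq_one poly3" where
  "Var i = Poly_Mapping.single (Poly_Mapping.single i 1) 1"

definition peval :: "'a::comm_semiring_1 poly3 \<Rightarrow> 'a^3 \<Rightarrow> 'a" where
  "peval p v = (\<Sum>m\<in>Poly_Mapping.keys p. Poly_Mapping.lookup p m * (\<Prod>i\<in>UNIV. (v $h i) ^ Poly_Mapping.lookup m i))"

definition total_deg :: "(3 \<Rightarrow>\<^sub>0 nat) \<Rightarrow> nat" where
  "total_deg m = (\<Sum>i\<in>UNIV. Poly_Mapping.lookup m i)"

definition homogeneous :: "nat \<Rightarrow> 'a::zero poly3 \<Rightarrow> bool" where
  "homogeneous n p \<longleftrightarrow> (\<forall>m\<in>Poly_Mapping.keys p. total_deg m = n)"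

definition pdiff :: "3 \<Rightarrow> 'a::comm_semiring_1 poly3 \<Rightarrow> 'a poly3" where
  "pdiff i p = (\<Sum>m\<in>Poly_Mapping.keys p.
     Poly_Mapping.single (m - Poly_Mapping.single i 1) (of_nat (Poly_Mapping.lookup m i) * Poly_Mapping.lookup p m))"

definition cpoly :: "real poly3 \<Rightarrow> complex poly3" where
  "cpoly p = Poly_Mapping.map complex_of_real p"

definition pconj :: "complex poly3 \<Rightarrow> complex poly3" where
  "pconj p = Poly_Mapping.map cnj p"

definition pscale :: "complex \<Rightarrow> complex poly3 \<Rightarrow> complex poly3" where
  "pscale c p = Const c * p"

interpretation cpoly_space: vector_space pscale
proof
qed (simp_all add: pscale_def Const_def algebra_simps single_add mult_single flip: mult.assoc)

definition list_basis :: "complex poly3 list \<Rightarrow> complex poly3 set \<Rightarrow> bool" where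
  "list_basis ps W \<longleftrightarrow>
     distinct ps \<and> cpoly_space.independent (set ps) \<and> cpoly_space.span (set ps) = W"

section \<open>The complex projective plane\<close>

text \<open>A point of the projective plane is a punctured line, that is, an equivalence class of
  nonzero vectors up to nonzero complex multiples.\<close>

definition proj_rel :: "((complex^3) \<times> (complex^3)) set" where
  "proj_rel = {(u, v). u \<noteq> 0 \<and> v \<noteq> 0 \<and> (\<exists>c. c \<noteq> 0 \<and> v = c *s u)}"

definition proj_plane :: "(complex^3) set set" where
  "proj_plane = (UNIV - {0}) // proj_rel"

definition cvec :: "real^3 \<Rightarrow> complex^3" where
  "cvec v = (\<chi> i. complex_of_real (v $h i))"

definition conj_point :: "(complex^3) set \<Rightarrow> (complex^3) set" where
  "conj_point P = (\<lambda>v. \<chi> i. cnj (v $h i)) ` P"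

definition real_points :: "(complex^3) set set" where
  "real_points = {P \<in> proj_plane. \<exists>w. cvec w \<in> P}"

definition real_line :: "real^3 \<Rightarrow> real^3 \<Rightarrow> (complex^3) set set" where
  "real_line u w = {P \<in> proj_plane. \<exists>\<alpha> \<beta>. \<alpha> *s cvec u + \<beta> *s cvec w \<in> P}"

definition zeros :: "complex poly3 \<Rightarrow> (complex^3) set set" where
  "zeros h = {P \<in> proj_plane. \<forall>v\<in>P. peval h v = 0}"

definition smooth_curve :: "complex poly3 \<Rightarrow> bool" where
  "smooth_curve h \<longleftrightarrow> (\<forall>P\<in>zeros h. \<forall>v\<in>P. \<exists>i. peval (pdiff i h) v \<noteq> 0)"

definition hyperbolic :: "real poly3 \<Rightarrow> real^3 \<Rightarrow> bool" where
  "hyperbolic f e \<longleftrightarrow> peval f e \<noteq> 0 \<and>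
     (\<forall>p. p \<notin> span {e} \<longrightarrow> real_line e p \<inter> zeros (cpoly f) \<subseteq> real_points)"

definition forms_vanishing_on :: "nat \<Rightarrow> (complex^3) set set \<Rightarrow> complex poly3 set" where
  "forms_vanishing_on n S = {h. homogeneous n h \<and> S \<subseteq> zeros h}"

lemma cvec_nth: "cvec v $h i = complex_of_real (v $h i)"
  by (simp add: cvec_def)

lemma equiv_proj_rel: "equiv (UNIV - {0}) proj_rel"
proof (rule equivI)
  show "proj_rel \<subseteq> (UNIV - {0}) \<times> (UNIV - {0})"
    by (auto simp: proj_rel_def)
  show "refl_on (UNIV - {0}) proj_rel"
    by (auto simp: refl_on_def proj_rel_def intro!: exI[of _ 1])
  show "sym proj_rel"
  proof (rule symI)
    fix u v assume "(u, v) \<in> proj_rel"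
    then obtain c where "u \<noteq> 0" "v \<noteq> 0" "c \<noteq> 0" "v = c *s u"
      by (auto simp: proj_rel_def)
    then show "(v, u) \<in> proj_rel"
      by (auto simp: proj_rel_def vector_smult_assoc intro!: exI[of _ "inverse c"])
  qed
  show "trans proj_rel"
  proof (rule transI)
    fix u v w assume "(u, v) \<in> proj_rel" "(v, w) \<in> proj_rel"
    then obtain c c' where "u \<noteq> 0" "w \<noteq> 0" "c \<noteq> 0" "v = c *s u" "c' \<noteq> 0" "w = c' *s v"
      by (auto simp: proj_rel_def)
    then show "(u, w) \<in> proj_rel"
      by (auto simp: proj_rel_def vector_smult_assoc intro!: exI[of _ "c' * c"])
  qed
qed

lemma proj_plane_mem:
  assumes "P \<in> proj_plane" "v \<in> P"
  shows "v \<noteq> 0" and "u \<in> P \<longleftrightarrow> (\<exists>c. c \<noteq> 0 \<and> u = c *s v)"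
proof -
  obtain x where x: "x \<noteq> 0" "P = proj_rel `` {x}"
    using assms(1) by (auto simp: proj_plane_def quotient_def)
  then have xv: "(x, v) \<in> proj_rel" using assms(2) by auto
  then show v: "v \<noteq> 0" by (auto simp: proj_rel_def)
  have "P = proj_rel `` {v}"
    using equiv_class_eq[OF equiv_proj_rel xv] x by simp
  then show "u \<in> P \<longleftrightarrow> (\<exists>c. c \<noteq> 0 \<and> u = c *s v)"
    using v by (auto simp: proj_rel_def)
qed

lemma proj_plane_ex:
  assumes "v \<noteq> 0" obtains P where "P \<in> proj_plane" "v \<in> P"
proof
  show "proj_rel `` {v} \<in> proj_plane"
    using assms by (auto simp: proj_plane_def quotient_def)
  show "v \<in> proj_rel `` {v}"
    using equiv_class_self[OF equiv_proj_rel] assms by auto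
qed

lemma peval_scale:
  assumes "homogeneous n p"
  shows "peval p (c *s v) = c ^ n * peval p v"
proof -
  have "(\<Prod>i\<in>UNIV. ((c *s v) $h i) ^ Poly_Mapping.lookup m i)
      = c ^ n * (\<Prod>i\<in>UNIV. (v $h i) ^ Poly_Mapping.lookup m i)" if "m \<in> Poly_Mapping.keys p" for m
  proof -
    have "n = (\<Sum>i\<in>UNIV. Poly_Mapping.lookup m i)"
      using assms that by (auto simp: homogeneous_def total_deg_def)
    then show ?thesis
      by (simp add: power_mult_distrib prod.distrib power_sum)
  qed
  then show ?thesis
    unfolding peval_def by (auto simp: sum_distrib_left mult.left_commute intro!: sum.cong)
qed

lemma lookup_cpoly: "Poly_Mapping.lookup (cpoly p) m = complex_of_real (Poly_Mapping.lookup p m)"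
  by (auto simp: cpoly_def Poly_Mapping.map.rep_eq when_def)

lemma keys_cpoly: "Poly_Mapping.keys (cpoly p) = Poly_Mapping.keys p"
  by (auto simp: in_keys_iff lookup_cpoly)

lemma homogeneous_cpoly: "homogeneous n (cpoly p) \<longleftrightarrow> homogeneous n p"
  by (simp add: homogeneous_def keys_cpoly)

lemma peval_cpoly: "peval (cpoly p) (cvec v) = complex_of_real (peval p v)"
  by (simp add: peval_def keys_cpoly lookup_cpoly cvec_nth)

lemma zeros_mem_iff:
  assumes "homogeneous n h" "P \<in> proj_plane" "v \<in> P"
  shows "P \<in> zeros h \<longleftrightarrow> peval h v = 0"
  using assms proj_plane_mem[OF assms(2,3)] peval_scale[OF assms(1)]
  by (auto simp: zeros_def)

text \<open>The geometric definition of hyperbolicity agrees with real-rootedness of all the univariate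
  restrictions \<open>f(te + p)\<close>.\<close>

lemma hyperbolic_iff_real_rooted:
  assumes hom: "homogeneous d f" and d: "d \<ge> 1"
  shows "hyperbolic f e \<longleftrightarrow> peval f e \<noteq> 0 \<and>
    (\<forall>p t. peval (cpoly f) (t *s cvec e + cvec p) = 0 \<longrightarrow> t \<in> \<real>)"
proof (cases "peval f e = 0")
  case True
  then show ?thesis by (simp add: hyperbolic_def)
next
  case fe: False
  have homc: "homogeneous d (cpoly f)" using hom by (simp add: homogeneous_cpoly)
  have cz: "c = 0" if "peval (cpoly f) (c *s cvec e) = 0" for c
    using that fe d by (simp add: peval_scale[OF homc] peval_cpoly)
  have e0: "e \<noteq> 0"
    using peval_scale[OF hom, of 0 e] fe d by (auto simp: power_0_left)
  show ?thesis
  proof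
    assume L: "hyperbolic f e"
    have "t \<in> \<real>" if z: "peval (cpoly f) (t *s cvec e + cvec p) = 0" for p t
    proof (cases "p \<in> span {e}")
      case True
      then obtain s where "p = s *\<^sub>R e" by (auto simp: span_singleton)
      then have "cvec p = complex_of_real s *s cvec e"
        by (simp add: Finite_Cartesian_Product.vec_eq_iff cvec_nth)
      then have "t *s cvec e + cvec p = (t + complex_of_real s) *s cvec e"
        by (simp add: vector_sadd_rdistrib)
      then have "t = - complex_of_real s" using z cz by (metis add_eq_0_iff2)
      then show ?thesis by simp
    next
      case False
      define v where "v = t *s cvec e + cvec p"
      have "\<exists>c w. cvec w = c *s v \<and> c \<noteq> 0"
      proof (cases "v = 0")
        case True
        then have "cvec 0 = 1 *s v"
          by (simp add: Finite_Cartesian_Product.vec_eq_iff cvec_nth)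
        then show ?thesis by (metis zero_neq_one)
      next
        case v: False
        obtain P where P: "P \<in> proj_plane" "v \<in> P" using proj_plane_ex[OF v] .
        have "P \<in> zeros (cpoly f)" using z zeros_mem_iff[OF homc P] by (simp add: v_def)
        moreover have "t *s cvec e + 1 *s cvec p \<in> P" using P(2) by (simp add: v_def)
        then have "P \<in> real_line e p" using P(1) unfolding real_line_def by blast
        ultimately have "P \<in> real_points" using L False by (auto simp: hyperbolic_def)
        then show ?thesis using proj_plane_mem(2)[OF P] by (auto simp: real_points_def)
      qed
      then obtain c w where c: "c \<noteq> 0" and w: "cvec w = c *s v" by blast
      have *: "Im (c * t) * e $h i + Im c * p $h i = 0" for i
      proof -
        have "complex_of_real (w $h i) = c * v $h i"
          using arg_cong[OF w, of "\<lambda>x. x $h i"] by (simp add: cvec_nth)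
        also have "\<dots> = (c * t) * complex_of_real (e $h i) + c * complex_of_real (p $h i)"
          by (simp add: v_def cvec_nth distrib_left mult.assoc)
        finally have "Im (complex_of_real (w $h i))
            = Im ((c * t) * complex_of_real (e $h i) + c * complex_of_real (p $h i))"
          by (rule arg_cong)
        then show ?thesis by (simp add: algebra_simps)
      qed
      have ic: "Im c = 0"
      proof (rule ccontr)
        assume "Im c \<noteq> 0"
        then have "p = (- Im (c * t) / Im c) *\<^sub>R e"
          using *[THEN add_eq_0_iff[THEN iffD1]]
          by (auto simp: Finite_Cartesian_Product.vec_eq_iff field_simps simp del: times_complex.sel)
        then show False using False by (auto simp: span_singleton)
      qed
      obtain i where "e $h i \<noteq> 0" using e0 by (auto simp: Finite_Cartesian_Product.vec_eq_iff)
      then have "Im (c * t) = 0" using *[of i] ic by simp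
      then have "Im t = 0" using ic c by (auto simp: complex_eq_iff)
      then show ?thesis by (simp add: complex_is_Real_iff)
    qed
    then show "peval f e \<noteq> 0 \<and>
      (\<forall>p t. peval (cpoly f) (t *s cvec e + cvec p) = 0 \<longrightarrow> t \<in> \<real>)" using fe by blast
  next
    assume R: "peval f e \<noteq> 0 \<and>
      (\<forall>p t. peval (cpoly f) (t *s cvec e + cvec p) = 0 \<longrightarrow> t \<in> \<real>)"
    have "P \<in> real_points" if ln: "P \<in> real_line e p" and zr: "P \<in> zeros (cpoly f)" for p P
    proof -
      obtain \<alpha> \<beta> where P: "P \<in> proj_plane" and v: "\<alpha> *s cvec e + \<beta> *s cvec p \<in> P"
        using ln by (auto simp: real_line_def)
      have z: "peval (cpoly f) (\<alpha> *s cvec e + \<beta> *s cvec p) = 0"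
        using zeros_mem_iff[OF homc P v] zr by simp
      have b: "\<beta> \<noteq> 0"
      proof
        assume "\<beta> = 0"
        then show False using z cz proj_plane_mem(1)[OF P v] by auto
      qed
      have eq: "(\<alpha> / \<beta>) *s cvec e + cvec p = (1 / \<beta>) *s (\<alpha> *s cvec e + \<beta> *s cvec p)"
        using b by (simp add: Finite_Cartesian_Product.vec_eq_iff field_simps)
      have "peval (cpoly f) ((\<alpha> / \<beta>) *s cvec e + cvec p) = 0"
        unfolding eq peval_scale[OF homc] z by simp
      then have "\<alpha> / \<beta> \<in> \<real>" using R by blast
      then obtain r where r: "\<alpha> / \<beta> = complex_of_real r" by (auto elim: Reals_cases)
      have "(1 / \<beta>) *s (\<alpha> *s cvec e + \<beta> *s cvec p) \<in> P"
        unfolding proj_plane_mem(2)[OF P v] using b by (intro exI[of _ "1 / \<beta>"]) auto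
      moreover have "cvec (r *\<^sub>R e + p) = (\<alpha> / \<beta>) *s cvec e + cvec p"
        unfolding r by (simp add: Finite_Cartesian_Product.vec_eq_iff cvec_nth)
      ultimately have "cvec (r *\<^sub>R e + p) \<in> P"
        by (simp add: eq)
      then show ?thesis using P by (auto simp: real_points_def)
    qed
    then show "hyperbolic f e" using fe by (auto simp: hyperbolic_def)
  qed
qed

section \<open>Linear matrix pencils\<close>

definition pencil :: "(3 \<Rightarrow> complex mat) \<Rightarrow> complex poly3 mat" where
  "pencil M = Var 1 \<cdot>\<^sub>m map_mat Const (M 1) + Var 2 \<cdot>\<^sub>m map_mat Const (M 2)
     + Var 3 \<cdot>\<^sub>m map_mat Const (M 3)"

definition pencil_at :: "(3 \<Rightarrow> complex mat) \<Rightarrow> real^3 \<Rightarrow> complex mat" where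
  "pencil_at M e = complex_of_real (e $h 1) \<cdot>\<^sub>m M 1 + complex_of_real (e $h 2) \<cdot>\<^sub>m M 2
     + complex_of_real (e $h 3) \<cdot>\<^sub>m M 3"

definition solves_system ::
    "complex poly3 \<Rightarrow> complex poly3 Matrix.vec \<Rightarrow> (3 \<Rightarrow> complex mat) \<Rightarrow> bool" where
  "solves_system f a M \<longleftrightarrow>
     (\<forall>i. M i \<in> carrier_mat (dim_vec a) (dim_vec a)) \<and>
     mat_of_row a * pencil M = mat_of_row (f \<cdot>\<^sub>v unit_vec (dim_vec a) 0) \<and>
     pencil M *\<^sub>v map_vec pconj a = f \<cdot>\<^sub>v unit_vec (dim_vec a) 0"

definition hermitian :: "complex mat \<Rightarrow> bool" where
  "hermitian A \<longleftrightarrow> mat_adjoint A = A"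

definition pos_def :: "complex mat \<Rightarrow> bool" where
  "pos_def A \<longleftrightarrow> hermitian A \<and>
     (\<forall>v\<in>carrier_vec (dim_row A). v \<noteq> 0\<^sub>v (dim_row A) \<longrightarrow> Re ((A *\<^sub>v v) \<bullet>c v) > 0)"

end

theory Submission
  imports Defs "HOL-Computational_Algebra.Fundamental_Theorem_Algebra"
begin

text \<open>Choose coordinates in which a point is \<open>t e + s p + q\<close>. For every real \<open>s\<close> the line
  \<open>t \<mapsto> t e + s p + q\<close> meets the curve in \<open>d\<close> distinct real points, because a multiple point
  would be a real common zero of \<open>f\<close> and \<open>g\<close>, and real points cannot be split between \<open>S\<close> and
  its conjugate. If a form \<open>h\<close> of degree \<open>2 d - 2\<close> vanishes at the common zeros of \<open>f\<close> and \<open>g\<close>,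
  then \<open>h = A f + B g\<close> (Noether), and Euler's formula shows that the sum of \<open>h / g\<^sup>2\<close> over these
  \<open>d\<close> points does not depend on \<open>s\<close>, while the sum of \<open>t h / g\<^sup>2\<close> is affine in \<open>s\<close>. Apply this to
  the products of \<open>a\<^sub>k\<close> with the conjugate of \<open>a\<^sub>j\<close>. With the matrix \<open>W\<close> of the values
  of the conjugates of the \<open>a\<^sub>j\<close> divided by \<open>g\<close>, its adjoint \<open>V\<close> and the diagonal
  matrix \<open>R\<close> of the roots \<open>t\<^sub>i\<close>, it says that \<open>P = W V\<close> is constant and \<open>W R V = s H1 + H2\<close>. Then
  \<open>t P\<^sup>-\<^sup>1 - P\<^sup>-\<^sup>1 (s H1 + H2) P\<^sup>-\<^sup>1 = V\<^sup>-\<^sup>1 (t - R) W\<^sup>-\<^sup>1\<close> is the required pencil: the linear equations follow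
  from Lagrange interpolation at the \<open>d\<close> points, its value at \<open>e\<close> is \<open>P\<^sup>-\<^sup>1\<close>, and its determinant is
  the product of the \<open>t - t\<^sub>i\<close> divided by \<open>det P\<close>.\<close>

section \<open>Common zeros of two bivariate polynomials\<close>

text \<open>A polynomial in \<open>t\<close> and \<open>s\<close> is a polynomial in \<open>t\<close> whose coefficients are polynomials in \<open>s\<close>.\<close>


hide_const (open) module.smult Coset.order

text \<open>The line at infinity of the chart passes through \<open>e\<close>. It is real, so
  hyperbolicity leaves only real zeros of \<open>f\<close> on it, while no intersection point is
  real: all \<open>d * (d - 1)\<close> of them are visible in the chart. Linear independence of the
  \<open>a_k\<close> concerns all lines together and does not directly make \<open>V\<close>
  invertible on a given line. The constancy of \<open>P\<close> supplies this:
  \<open>P u = 0\<close> gives \<open>V u = 0\<close> on every line, since \<open>W\<close> is the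
  adjoint of \<open>V\<close>, and interpolation makes the combination of the \<open>a_k\<close>
  with coefficients \<open>u\<close> vanish identically. So \<open>P\<close> is a positive definite
  Gram matrix, which is the source of both the definiteness at \<open>e\<close> and the sign of
  \<open>c\<close>. The denominator is the square of \<open>g\<close> because \<open>g\<close>
  restricts to the t-derivative of \<open>f\<close>: at a zero of \<open>f\<close>,
  \<open>h = B g\<close>, and \<open>B / g\<close> is the summand in Euler's formula. Uniqueness
  does not come from counting equations. The difference of two solutions solves the homogeneous
  system; row and column equations together kill its value at \<open>e\<close>, and then the whole
  pencil.\<close>

definition total_degree_le :: "nat \<Rightarrow> 'a::zero poly poly \<Rightarrow> bool" where
  "total_degree_le n Q \<longleftrightarrow> (\<forall>k. coeff Q k \<noteq> 0 \<longrightarrow> k + degree (coeff Q k) \<le> n)"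

lemma total_degree_leD: "total_degree_le n Q \<Longrightarrow> coeff Q k \<noteq> 0 \<Longrightarrow> k + degree (coeff Q k) \<le> n"
  by (simp add: total_degree_le_def)

lemma total_degree_le_imp_degree: "total_degree_le n Q \<Longrightarrow> degree Q \<le> n"
  by (rule degree_le) (use total_degree_leD in fastforce)

lemma total_degree_le_add:
  assumes "total_degree_le n P" "total_degree_le n Q"
  shows "total_degree_le n (P + Q)"
  unfolding total_degree_le_def
proof (intro allI impI)
  fix k assume k: "coeff (P + Q) k \<noteq> 0"
  have "degree (coeff (P + Q) k) \<le> max (degree (coeff P k)) (degree (coeff Q k))"
    by (simp add: degree_add_le_max)
  moreover have "coeff P k \<noteq> 0 \<or> coeff Q k \<noteq> 0" using k by auto
  moreover have "coeff P k \<noteq> 0 \<Longrightarrow> k + degree (coeff P k) \<le> n"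
    "coeff Q k \<noteq> 0 \<Longrightarrow> k + degree (coeff Q k) \<le> n" using assms total_degree_leD by blast+
  ultimately show "k + degree (coeff (P + Q) k) \<le> n"
    by (cases "coeff P k = 0"; cases "coeff Q k = 0") auto
qed

lemma total_degree_le_0 [simp]: "total_degree_le n 0"
  by (simp add: total_degree_le_def)

lemma total_degree_le_sum:
  "(\<And>x. x \<in> A \<Longrightarrow> total_degree_le n (f x)) \<Longrightarrow> total_degree_le n (\<Sum>x\<in>A. f x)"
  by (induction A rule: infinite_finite_induct) (auto intro: total_degree_le_add)

lemma total_degree_le_monom: 
  "(c \<noteq> 0 \<Longrightarrow> k + degree c \<le> n) \<Longrightarrow> total_degree_le n (monom c k)"
  by (auto simp: total_degree_le_def)

lemma total_degree_le_mult:
  fixes P Q :: "'a::comm_semiring_0 poly poly"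
  assumes "total_degree_le m P" "total_degree_le n Q"
  shows "total_degree_le (m + n) (P * Q)"
  unfolding total_degree_le_def
proof (intro allI impI)
  fix k assume "coeff (P * Q) k \<noteq> 0"
  define N where "N = degree (coeff (P * Q) k)"
  have "coeff (coeff (P * Q) k) N \<noteq> 0"
    using \<open>coeff (P * Q) k \<noteq> 0\<close> unfolding N_def by simp
  then have "(\<Sum>i\<le>k. coeff (coeff P i * coeff Q (k - i)) N) \<noteq> 0"
    by (simp add: coeff_mult coeff_sum)
  then obtain i where i: "i \<le> k" "coeff (coeff P i * coeff Q (k - i)) N \<noteq> 0"
    by (meson atMost_iff sum.not_neutral_contains_not_neutral)
  then have "N \<le> degree (coeff P i * coeff Q (k - i))" by (simp add: le_degree)
  also have "\<dots> \<le> degree (coeff P i) + degree (coeff Q (k - i))" by (rule degree_mult_le)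
  finally have "N \<le> degree (coeff P i) + degree (coeff Q (k - i))" .
  moreover have "coeff P i \<noteq> 0" "coeff Q (k - i) \<noteq> 0" using i(2) by auto
  ultimately show "k + degree (coeff (P * Q) k) \<le> m + n"
    using total_degree_leD[OF assms(1), of i] total_degree_leD[OF assms(2), of "k - i"] i(1)
    unfolding N_def[symmetric] by linarith
qed

section \<open>Evaluation in both variables and restriction to a line \<open>s\<close> =
  const\<close>

abbreviation bpoly :: "'a::comm_semiring_0 poly poly \<Rightarrow> 'a \<Rightarrow> 'a \<Rightarrow> 'a" where
  "bpoly Q t s \<equiv> poly (poly Q [:t:]) s"

definition section_at :: "'a::comm_semiring_0 \<Rightarrow> 'a poly poly \<Rightarrow> 'a poly" where
  "section_at s Q = map_poly (\<lambda>q. poly q s) Q"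

lemma coeff_section_at [simp]: "coeff (section_at s Q) k = poly (coeff Q k) s"
  by (simp add: section_at_def coeff_map_poly)

lemma poly_section_at: "poly (section_at s Q) t = bpoly Q t s"
  by (induction Q) (simp_all add: section_at_def map_poly_pCons)

lemma degree_section_at_le: "degree (section_at s Q) \<le> degree Q"
  by (rule degree_le) (simp add: coeff_eq_0)

lemma bpoly_eq_sum:
  assumes "degree Q < n"
  shows "bpoly Q t s = (\<Sum>i<n. t ^ i * poly (coeff Q i) (s::'a::comm_semiring_1))"
proof -
  have "bpoly Q t s = poly (section_at s Q) t" by (simp add: poly_section_at)
  also have "\<dots> = (\<Sum>i\<le>degree (section_at s Q). coeff (section_at s Q) i * t ^ i)"
    by (rule poly_altdef)
  also have "\<dots> = (\<Sum>i<n. coeff (section_at s Q) i * t ^ i)"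
    by (rule sum.mono_neutral_left)
       (use assms degree_section_at_le[of s Q] in \<open>auto simp: coeff_eq_0 simp del: coeff_section_at\<close>)
  finally show ?thesis by (simp add: mult.commute)
qed

text \<open>In the Leibniz expansion a nonzero product over a permutation \<open>p\<close> has
  degree at most the sum of the \<alpha> (p i) - \<beta> i, and permuting does not change the sum of
  the \<alpha>. With suitable weights this becomes Bezout's bound for the resultant.\<close>

lemma det_poly_degree_le:
  fixes A :: "'a::comm_ring_1 poly mat"
  assumes A: "A \<in> carrier_mat n n"
    and w: "\<And>i j. i < n \<Longrightarrow> j < n \<Longrightarrow> A $$ (i, j) \<noteq> 0 \<Longrightarrow> \<beta> i + degree (A $$ (i, j)) \<le> \<alpha> j"
    and nz: "Determinant.det A \<noteq> 0"
  shows "(\<Sum>i<n. \<beta> i) + degree (Determinant.det A) \<le> (\<Sum>j<n. \<alpha> j)"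
proof -
  define N where "N = degree (Determinant.det A)"
  have "coeff (Determinant.det A) N \<noteq> 0" using nz by (simp add: N_def)
  then have "(\<Sum>p | p permutes {0..<n}. coeff (signof p * (\<Prod>i=0..<n. A $$ (i, p i))) N) \<noteq> 0"
    by (simp add: det_def'[OF A] coeff_sum)
  then obtain p where p: "p permutes {0..<n}"
    and c: "coeff (signof p * (\<Prod>i=0..<n. A $$ (i, p i))) N \<noteq> 0"
    by (metis (mono_tags, lifting) mem_Collect_eq sum.neutral)
  let ?Q = "\<Prod>i=0..<n. A $$ (i, p i)"
  have c': "coeff ?Q N \<noteq> 0" using c by (auto simp: sign_def split: if_splits)
  have nz': "A $$ (i, p i) \<noteq> 0" if "i < n" for i
  proof
    assume "A $$ (i, p i) = 0"
    then have "?Q = 0" using that by (intro prod_zero) auto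
    then show False using c' by simp
  qed
  have pn: "p i < n" if "i < n" for i using permutes_in_image[OF p, of i] that by auto
  have "N \<le> degree ?Q" using c' by (rule le_degree)
  also have "\<dots> \<le> (\<Sum>i=0..<n. degree (A $$ (i, p i)))"
    using degree_prod_sum_le[of "{0..<n}" "\<lambda>i. A $$ (i, p i)"] by (simp add: o_def)
  finally have "(\<Sum>i<n. \<beta> i) + N \<le> (\<Sum>i<n. \<beta> i + degree (A $$ (i, p i)))"
    by (simp add: sum.distrib lessThan_atLeast0)
  also have "\<dots> \<le> (\<Sum>i<n. \<alpha> (p i))" using w nz' pn by (intro sum_mono) auto
  also have "\<dots> = (\<Sum>i<n. \<alpha> i)"
    using sum.permute[OF p, of \<alpha>] by (simp add: o_def lessThan_atLeast0)
  finally show ?thesis by (simp add: N_def)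
qed

lemma dvd_det_rows:
  fixes A :: "'a::comm_ring_1 mat"
  assumes A: "A \<in> carrier_mat n n" and I: "I \<subseteq> {..<n}"
    and dvd: "\<And>i j. i \<in> I \<Longrightarrow> j < n \<Longrightarrow> c dvd A $$ (i, j)"
  shows "c ^ card I dvd Determinant.det A"
proof -
  have "c ^ card I dvd (\<Prod>i=0..<n. A $$ (i, p i))" if p: "p permutes {0..<n}" for p
  proof -
    have "p i < n" if "i \<in> I" for i using permutes_in_image[OF p, of i] I that by auto
    then have "(\<Prod>i\<in>I. c) dvd (\<Prod>i\<in>I. A $$ (i, p i))"
      by (intro prod_dvd_prod dvd) auto
    also have "\<dots> dvd (\<Prod>i=0..<n. A $$ (i, p i))"
      using I by (intro prod_dvd_prod_subset) auto
    finally show ?thesis by simp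
  qed
  then show ?thesis
    unfolding det_def'[OF A] by (intro dvd_sum dvd_mult) auto
qed

text \<open>A kernel vector would be the coefficient list of a nonzero polynomial of degree below
  \<open>n\<close> with \<open>n\<close> distinct roots.\<close>

lemma det_vandermonde_nonzero:
  fixes x :: "nat \<Rightarrow> 'a::field"
  assumes inj: "inj_on x {..<n}"
  shows "Determinant.det (Matrix.mat n n (\<lambda>(k, i). x k ^ i)) \<noteq> 0"
proof
  let ?V = "Matrix.mat n n (\<lambda>(k, i). x k ^ i)"
  assume "Determinant.det ?V = 0"
  then obtain v where v: "v \<in> carrier_vec n" "v \<noteq> 0\<^sub>v n" "?V *\<^sub>v v = 0\<^sub>v n"
    using det_0_iff_vec_prod_zero[of ?V n] by auto
  define q where "q = (\<Sum>i<n. monom (v $ i) i)"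
  have cq: "coeff q i = (if i < n then v $ i else 0)" for i
    by (simp add: q_def coeff_sum)
  have "poly q (x k) = 0" if "k < n" for k
  proof -
    have "0 = (?V *\<^sub>v v) $ k" using v(3) that by simp
    also have "\<dots> = (\<Sum>i<n. x k ^ i * v $ i)"
      using that v(1) by (simp add: scalar_prod_def lessThan_atLeast0)
    finally show ?thesis by (simp add: q_def poly_sum poly_monom mult.commute)
  qed
  then have sub: "x ` {..<n} \<subseteq> {t. poly q t = 0}" by auto
  have "q = 0"
  proof (rule ccontr)
    assume "q \<noteq> 0"
    then have "degree q < n" using cq by (metis leading_coeff_0_iff)
    moreover have "n \<le> card {t. poly q t = 0}"
      using card_mono[OF poly_roots_finite[OF \<open>q \<noteq> 0\<close>] sub] card_image[OF inj] by simp
    ultimately show False using card_poly_roots_bound[OF \<open>q \<noteq> 0\<close>] by simp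
  qed
  then have "v $ i = 0" if "i < n" for i using cq[of i] that by simp
  then show False using v(1,2) by (auto simp: Matrix.vec_eq_iff)
qed

text \<open>Multiplying by an invertible Vandermonde matrix whose first nodes are the points of \<open>T\<close>
  makes \<open>card T\<close> rows vanish at \<open>s0\<close>.\<close>

lemma linear_power_dvd_det:
  fixes A :: "'a::field_char_0 poly mat"
  assumes A: "A \<in> carrier_mat n n" and T: "finite T" "card T \<le> n"
    and ann: "\<And>\<tau> j. \<tau> \<in> T \<Longrightarrow> j < n \<Longrightarrow> (\<Sum>i<n. \<tau> ^ i * poly (A $$ (i, j)) s0) = 0"
  shows "[:-s0, 1:] ^ card T dvd Determinant.det A"
proof -
  \<comment> \<open>The \<open>n - card T\<close> further nodes are arbitrary; they only make the
    Vandermonde matrix square and invertible.\<close>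
  obtain T' where T': "T' \<subseteq> UNIV - T" "finite T'" "card T' = n - card T"
    using infinite_arbitrarily_large[OF Diff_infinite_finite[OF T(1) infinite_UNIV_char_0], of "n - card T"]
    by blast
  have "card (T \<union> T') = n" using T T' by (subst card_Un_disjoint) auto
  then obtain x where x: "bij_betw x {0..<n} (T \<union> T')"
    using ex_bij_betw_nat_finite[of "T \<union> T'"] T T' by auto
  define I where "I = {i. i < n \<and> x i \<in> T}"
  have xI: "x ` I = T"
  proof
    show "T \<subseteq> x ` I"
    proof
      fix t assume "t \<in> T"
      then have "t \<in> x ` {0..<n}" using x by (simp add: bij_betw_def)
      then show "t \<in> x ` I" using \<open>t \<in> T\<close> by (auto simp: I_def)
    qed
  qed (auto simp: I_def)
  have inj: "inj_on x {..<n}" using x by (simp add: bij_betw_def lessThan_atLeast0)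
  have cI: "card I = card T"
    using card_image[OF inj_on_subset[OF inj]] xI by (metis (lifting) I_def lessThan_iff mem_Collect_eq subsetI)
  let ?W = "Matrix.mat n n (\<lambda>(k, i). x k ^ i)"
  let ?V = "map_mat (\<lambda>c. [:c:]) ?W"
  have V: "?V \<in> carrier_mat n n" by simp
  have "[:-s0, 1:] dvd (?V * A) $$ (k, j)" if "k \<in> I" "j < n" for k j
  proof -
    have k: "k < n" "x k \<in> T" using that by (auto simp: I_def)
    have "(?V * A) $$ (k, j) = (\<Sum>i<n. [:x k ^ i:] * A $$ (i, j))"
      using k that A by (simp add: scalar_prod_def lessThan_atLeast0)
    then have "poly ((?V * A) $$ (k, j)) s0 = 0" using ann[OF k(2) that(2)] by (simp add: poly_sum)
    then show ?thesis by (simp add: poly_eq_0_iff_dvd)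
  qed
  then have "[:-s0, 1:] ^ card I dvd Determinant.det (?V * A)"
    by (intro dvd_det_rows[of _ n]) (use A in \<open>auto simp: I_def\<close>)
  also have "Determinant.det (?V * A) = Determinant.det ?V * Determinant.det A"
    by (rule det_mult[OF V A])
  also have "Determinant.det ?V = [:Determinant.det ?W:]"
  proof -
    interpret comm_ring_hom "\<lambda>c::'a. [:c:]" by unfold_locales (auto simp: one_pCons)
    show ?thesis by (rule hom_det)
  qed
  finally show ?thesis
    using det_vandermonde_nonzero[OF inj] by (simp add: cI dvd_smult_iff)
qed


text \<open>The factors belonging to the other points do not vanish at \<open>y\<close>, so the
  whole order of \<open>p\<close> at \<open>y\<close> sits in the remaining cofactor.\<close>

lemma prod_linear_powers_dvd:
  fixes p :: "'a::idom poly"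
  assumes "finite Y" "\<And>y. y \<in> Y \<Longrightarrow> [:-y, 1:] ^ k y dvd p"
  shows "(\<Prod>y\<in>Y. [:-y, 1:] ^ k y) dvd p"
  using assms
proof (induction Y)
  case (insert y Y)
  let ?Q = "\<Prod>y\<in>Y. [:-y, 1:] ^ k y"
  show ?case
  proof (cases "p = 0")
    case False
    obtain r where r: "p = ?Q * r" using insert by (auto elim: dvdE)
    have "poly ?Q y \<noteq> 0" using insert by (auto simp: poly_prod poly_power)
    then have "order y ?Q = 0" by (rule order_0I)
    moreover have "[:-y, 1:] ^ k y dvd p" using insert by simp
    ultimately have "k y \<le> order y r"
      using False r by (simp add: order_divides order_mult)
    then have "[:-y, 1:] ^ k y dvd r" by (simp add: order_divides)
    then show ?thesis using insert(1,2) r by (simp add: mult_dvd_mono mult.commute)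
  qed simp
qed simp

section \<open>Coefficient matrices of bivariate polynomials, Bezout bound and Cramer's rule\<close>

definition coeff_mat :: "nat \<Rightarrow> (nat \<Rightarrow> 'a::zero poly poly) \<Rightarrow> 'a poly mat" where
  "coeff_mat n fs = Matrix.mat n n (\<lambda>(i, j). coeff (fs j) i)"

lemma coeff_mat_carrier [simp]: "coeff_mat n fs \<in> carrier_mat n n"
  by (simp add: coeff_mat_def)

lemma coeff_mat_index [simp]: "i < n \<Longrightarrow> j < n \<Longrightarrow> coeff_mat n fs $$ (i, j) = coeff (fs j) i"
  by (simp add: coeff_mat_def)

text \<open>A common zero (\<tau>, s0) of all columns makes the row of powers of \<tau> a left null
  vector of the matrix at \<open>s0\<close>; distinct \<tau> give independent ones.\<close>

lemma linear_power_dvd_det_coeff_mat: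
  fixes fs :: "nat \<Rightarrow> 'a::field_char_0 poly poly"
  assumes "finite T" "card T \<le> n" "\<And>j. j < n \<Longrightarrow> degree (fs j) < n"
    and "\<And>\<tau> j. \<tau> \<in> T \<Longrightarrow> j < n \<Longrightarrow> bpoly (fs j) \<tau> s0 = 0"
  shows "[:-s0, 1:] ^ card T dvd Determinant.det (coeff_mat n fs)"
  by (rule linear_power_dvd_det[OF coeff_mat_carrier assms(1,2)])
     (use assms(3,4) in \<open>simp flip: bpoly_eq_sum\<close>)

text \<open>Row \<open>i\<close> holds the coefficients of the \<open>i\<close>-th power of
  \<open>t\<close>, so its entries lose \<open>i\<close> from the total degree: the row weight is
  \<open>i\<close> itself.\<close>

lemma degree_det_coeff_mat_le:
  fixes fs :: "nat \<Rightarrow> 'a::comm_ring_1 poly poly"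
  assumes "\<And>j. j < n \<Longrightarrow> total_degree_le (\<alpha> j) (fs j)" "Determinant.det (coeff_mat n fs) \<noteq> 0"
  shows "(\<Sum>i<n. i) + degree (Determinant.det (coeff_mat n fs)) \<le> (\<Sum>j<n. \<alpha> j)"
  by (rule det_poly_degree_le[OF coeff_mat_carrier _ assms(2)])
     (use assms(1) in \<open>auto dest: total_degree_leD\<close>)

lemma coeff_mat_mult_vec:
  assumes "b \<in> carrier_vec n" "i < n"
  shows "(coeff_mat n fs *\<^sub>v b) $ i = coeff (\<Sum>j<n. smult (b $ j) (fs j)) i"
  using assms by (simp add: coeff_mat_def scalar_prod_def coeff_sum lessThan_atLeast0 mult.commute)

text \<open>Cramer's rule expresses the determinant times \<open>H\<close> through the columns over
  the ring of polynomials in \<open>s\<close>. Divisibility of each numerator by the determinant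
  keeps the coefficients \<open>b\<close> polynomial once it is cancelled.\<close>

lemma cramer_coeff_mat:
  fixes fs :: "nat \<Rightarrow> 'a::idom poly poly"
  assumes deg: "degree H < n" and fs: "\<And>j. j < n \<Longrightarrow> degree (fs j) < n"
    and D: "Determinant.det (coeff_mat n fs) \<noteq> 0"
    and b: "\<And>k. k < n \<Longrightarrow> Determinant.det (coeff_mat n (fs(k := H))) = Determinant.det (coeff_mat n fs) * b k"
  shows "H = (\<Sum>j<n. smult (b j) (fs j))"
proof -
  let ?C = "coeff_mat n fs"
  let ?D = "Determinant.det ?C"
  define h where "h = Matrix.vec n (coeff H)"
  have h: "h \<in> carrier_vec n" by (simp add: h_def)
  define x where "x = adj_mat ?C *\<^sub>v h"
  note adj = adj_mat[OF coeff_mat_carrier[of n fs]]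
  have x: "x \<in> carrier_vec n" using adj(1) h by (simp add: x_def)
  have "?C *\<^sub>v x = (?C * adj_mat ?C) *\<^sub>v h"
    unfolding x_def by (rule assoc_mult_mat_vec[symmetric, OF coeff_mat_carrier adj(1) h])
  also have "\<dots> = ?D \<cdot>\<^sub>v (1\<^sub>m n *\<^sub>v h)" unfolding adj(2) using h by auto
  also have "\<dots> = ?D \<cdot>\<^sub>v h" using h by simp
  finally have Cx: "?C *\<^sub>v x = ?D \<cdot>\<^sub>v h" .
  have xk: "x $ k = ?D * b k" if k: "k < n" for k
  proof -
    let ?R = "coeff_mat n (fs(k := H))"
    have R: "?R\<^sup>T \<in> carrier_mat n n" by simp
    \<comment> \<open>The replaced column is a multiple of \<open>h\<close>; transposing turns this
      into the scaling of a row, which pulls the factor out of the determinant.\<close>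
    have "replace_col ?C (?D \<cdot>\<^sub>v h) k = (multrow k ?D (?R\<^sup>T))\<^sup>T"
      by (rule eq_matI) (use k in \<open>auto simp: replace_col_def h_def coeff_mat_def\<close>)
    then have "Determinant.det (replace_col ?C (?D \<cdot>\<^sub>v h) k) = ?D * Determinant.det ?R"
      using det_transpose[of "multrow k ?D (?R\<^sup>T)" n] det_multrow[OF k R] det_transpose[of ?R n] by simp
    then have "x $ k * ?D = ?D * Determinant.det ?R"
      using cramer_lemma_mat[OF coeff_mat_carrier x k, of fs] Cx by auto
    then show ?thesis using D b[OF k] by simp
  qed
  show ?thesis
  proof (rule poly_eqI)
    fix i
    show "coeff H i = coeff (\<Sum>j<n. smult (b j) (fs j)) i"
    proof (cases "i < n")
      case True
      have "?D * coeff H i = (?C *\<^sub>v x) $ i" using True by (simp add: Cx h_def)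
      also have "\<dots> = ?D * coeff (\<Sum>j<n. smult (b j) (fs j)) i"
        unfolding coeff_mat_mult_vec[OF x True] by (simp add: coeff_sum xk sum_distrib_left mult.assoc)
      finally show ?thesis using D by simp
    next
      case False
      have "coeff (fs j) i = 0" if "j < n" for j
        using fs[OF that] False by (intro coeff_eq_0) simp
      moreover have "coeff H i = 0" using deg False by (intro coeff_eq_0) simp
      ultimately show ?thesis by (simp add: coeff_sum)
    qed
  qed
qed


lemma sum_lessThan_add:
  fixes f :: "nat \<Rightarrow> 'a::comm_monoid_add"
  shows "(\<Sum>j<m + n. f j) = (\<Sum>j<m. f j) + (\<Sum>j<n. f (m + j))"
  by (induction n) (simp_all add: add.assoc)

lemma sylvester_combination:
  fixes P Q :: "'a::comm_ring_1 poly"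
  shows "(\<Sum>j<m + k. smult (w j) (if j < m then monom 1 j * P else monom 1 (j - m) * Q))
    = (\<Sum>j<m. monom (w j) j) * P + (\<Sum>j<k. monom (w (m + j)) j) * Q"
  by (simp add: sum_lessThan_add sum_distrib_right smult_monom flip: mult_smult_left)

text \<open>Noether's theorem on intersections without multiplicities: the determinant of the Sylvester
  matrix has degree at most \<open>d (d - 1)\<close>, and every common zero of \<open>F\<close> and \<open>G\<close> contributes a
  linear factor to it as well as to the numerators in Cramer's rule.\<close>

lemma vanishing_on_intersection_imp_combination:
  fixes F G H :: "complex poly poly"
  assumes d: "d \<ge> 1" and F: "total_degree_le d F" and G: "total_degree_le (d - 1) G"
    and H: "total_degree_le (2 * d - 2) H"
    and lc: "coeff F d = [:c:]" "c \<noteq> 0"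
    and X: "X = {(t, s). bpoly F t s = 0 \<and> bpoly G t s = 0}" "finite X" "card X = d * (d - 1)"
    and HX: "\<And>t s. (t, s) \<in> X \<Longrightarrow> bpoly H t s = 0"
    and T: "finite T" "card T = d" "\<And>t. t \<in> T \<Longrightarrow> bpoly F t s1 = 0" "\<And>t. t \<in> T \<Longrightarrow> bpoly G t s1 \<noteq> 0"
  shows "\<exists>A B. H = A * F + B * G \<and> total_degree_le (d - 1) B"
proof -
  \<comment> \<open>There are \<open>d - 1\<close> shifts of \<open>F\<close> and \<open>d\<close>
    shifts of \<open>G\<close>, hence \<open>2 * d - 1\<close> columns, as many as there are powers
    of \<open>t\<close> up to \<open>2 * d - 2\<close>.\<close>
  define n where "n = (d - 1) + d"
  define fs where "fs = (\<lambda>j. if j < d - 1 then monom 1 j * F else monom 1 (j - (d - 1)) * G)"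
  \<comment> \<open>Total degree bounds of the columns; for a shift of \<open>G\<close> the sum
    \<open>(d - 1) + (j - (d - 1))\<close> collapses to \<open>j\<close>.\<close>
  define \<alpha> where "\<alpha> = (\<lambda>j. if j < d - 1 then d + j else j)"
  define Y where "Y = snd ` X"
  define ts where "ts = (\<lambda>s. {t. (t, s) \<in> X})"
  define D where "D = Determinant.det (coeff_mat n fs)"
  define E where "E = (\<lambda>k. Determinant.det (coeff_mat n (fs(k := H))))"
  define Q where "Q = (\<Prod>s\<in>Y. [:-s, 1:] ^ card (ts s))"

  have tdeg: "total_degree_le (\<alpha> j) (fs j)" if "j < n" for j
  proof -
    have m: "total_degree_le k (monom 1 k)" for k by (rule total_degree_le_monom) simp
    show ?thesis
      using total_degree_le_mult[OF m[of j] F] total_degree_le_mult[OF m[of "j - (d - 1)"] G]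
      by (auto simp: fs_def \<alpha>_def add.commute)
  qed
  have deg: "degree (fs j) < n" if "j < n" for j
    using total_degree_le_imp_degree[OF tdeg[OF that]] that d by (auto simp: \<alpha>_def n_def split: if_splits)
  have degH: "degree H < n" using total_degree_le_imp_degree[OF H] d by (simp add: n_def)
  have fs0: "bpoly (fs j) t s = 0" if "(t, s) \<in> X" for j t s
    using that by (simp add: fs_def X)

  \<comment> \<open>The excess over the row weights is \<open>d * (d - 1)\<close>, exactly the
    number of points in \<open>X\<close>.\<close>
  have sum\<alpha>: "(\<Sum>j<n. \<alpha> j) = (\<Sum>j<n. j) + d * (d - 1)"
  proof -
    have "(\<Sum>j<d - 1. \<alpha> j) = (\<Sum>j<d - 1. j + d)" by (intro sum.cong) (auto simp: \<alpha>_def)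
    moreover have "(\<Sum>j<d. \<alpha> (d - 1 + j)) = (\<Sum>j<d. d - 1 + j)" by (intro sum.cong) (auto simp: \<alpha>_def)
    ultimately show ?thesis
      unfolding n_def sum_lessThan_add by (simp add: sum.distrib)
  qed

  have fin_ts: "finite (ts s)" for s
    by (rule finite_subset[of _ "fst ` X"]) (use X(2) in \<open>force simp: ts_def\<close>)+
  have card_ts: "card (ts s) \<le> n" for s
  proof -
    have nz: "section_at s F \<noteq> 0" using lc by (metis coeff_0 coeff_section_at poly_pCons poly_0 mult_zero_right add.right_neutral)
    have "ts s \<subseteq> {t. poly (section_at s F) t = 0}" by (auto simp: ts_def X poly_section_at)
    then have "card (ts s) \<le> card {t. poly (section_at s F) t = 0}"
      by (rule card_mono[OF poly_roots_finite[OF nz]])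
    also have "\<dots> \<le> degree (section_at s F)" by (rule card_poly_roots_bound[OF nz])
    also have "\<dots> \<le> d"
      using degree_section_at_le[of s F] total_degree_le_imp_degree[OF F] by simp
    finally show ?thesis using d by (simp add: n_def)
  qed
  have card_sum: "(\<Sum>s\<in>Y. card (ts s)) = d * (d - 1)"
  proof -
    have "card X = card (Sigma Y ts)"
      by (rule bij_betw_same_card[of "\<lambda>(t, s). (s, t)"])
         (force simp: bij_betw_def inj_on_def Y_def ts_def)
    then show ?thesis using X fin_ts by (simp add: Y_def)
  qed
  have degQ: "degree Q = d * (d - 1)"
    unfolding Q_def card_sum[symmetric] by (subst degree_prod_eq_sum_degree) (auto simp: degree_power_eq)
  have Q_dvd: "Q dvd Determinant.det (coeff_mat n gs)"
    if "\<And>j. j < n \<Longrightarrow> degree (gs j) < n" "\<And>j t s. j < n \<Longrightarrow> (t, s) \<in> X \<Longrightarrow> bpoly (gs j) t s = 0" for gs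
    unfolding Q_def
    by (rule prod_linear_powers_dvd)
       (use X(2) that fin_ts card_ts in \<open>auto simp: Y_def ts_def intro!: linear_power_dvd_det_coeff_mat\<close>)

  \<comment> \<open>On the line \<open>s1\<close> a null vector yields \<open>A F + B G = 0\<close>
    with \<open>B\<close> of degree below \<open>d\<close>. As \<open>G\<close> has no zero on
    \<open>T\<close>, \<open>B\<close> vanishes at the \<open>d\<close> points of \<open>T\<close>,
    so \<open>B = 0\<close> and then \<open>A = 0\<close>.\<close>
  have D0: "D \<noteq> 0"
  proof
    assume "D = 0"
    then have "Determinant.det (map_mat (\<lambda>p. poly p s1) (coeff_mat n fs)) = 0"
    proof -
      have "comm_ring_hom (\<lambda>p::complex poly. poly p s1)" by unfold_locales auto
      from comm_ring_hom.hom_det[OF this, of "coeff_mat n fs"] show ?thesis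
        using \<open>D = 0\<close> by (simp add: D_def)
    qed
    then obtain v where v: "v \<in> carrier_vec n" "v \<noteq> 0\<^sub>v n"
      "map_mat (\<lambda>p. poly p s1) (coeff_mat n fs) *\<^sub>v v = 0\<^sub>v n"
      using det_0_iff_vec_prod_zero[of "map_mat (\<lambda>p. poly p s1) (coeff_mat n fs)" n] by auto
    define A where "A = (\<Sum>j<d - 1. monom (v $ j) j)"
    define B where "B = (\<Sum>j<d. monom (v $ (d - 1 + j)) j)"
    define F1 where "F1 = section_at s1 F"
    define G1 where "G1 = section_at s1 G"
    have "A * F1 + B * G1 = 0"
    proof (rule poly_eqI)
      fix i
      let ?fs = "\<lambda>j. if j < d - 1 then monom 1 j * F1 else monom 1 (j - (d - 1)) * G1"
      have cfs: "coeff (?fs j) i = poly (coeff (fs j) i) s1" for j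
        by (simp add: fs_def F1_def G1_def coeff_monom_mult)
      have "coeff (A * F1 + B * G1) i = coeff (\<Sum>j<n. smult (v $ j) (?fs j)) i"
        unfolding n_def sylvester_combination A_def B_def ..
      also have "\<dots> = (\<Sum>j<n. v $ j * poly (coeff (fs j) i) s1)"
        by (simp only: coeff_sum coeff_smult cfs)
      also have "\<dots> = 0"
      proof (cases "i < n")
        case True
        have "0 = (map_mat (\<lambda>p. poly p s1) (coeff_mat n fs) *\<^sub>v v) $ i" using v True by simp
        also have "\<dots> = (\<Sum>j<n. poly (coeff (fs j) i) s1 * v $ j)"
          using True v(1) by (simp add: scalar_prod_def coeff_mat_def lessThan_atLeast0)
        finally show ?thesis by (simp add: mult.commute)
      next
        case False
        have "coeff (fs j) i = 0" if "j < n" for j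
          using deg[OF that] False by (intro coeff_eq_0) simp
        then show ?thesis by simp
      qed
      finally show "coeff (A * F1 + B * G1) i = coeff 0 i" by simp
    qed
    moreover have "B = 0"
    proof (rule ccontr)
      assume B: "B \<noteq> 0"
      have "poly B t = 0" if t: "t \<in> T" for t
      proof -
        have "poly (A * F1 + B * G1) t = 0" using calculation by simp
        then show ?thesis using T(3,4)[OF t] by (simp add: F1_def G1_def poly_section_at)
      qed
      then have "card T \<le> card {t. poly B t = 0}" by (intro card_mono poly_roots_finite[OF B]) auto
      also have "\<dots> \<le> degree B" by (rule card_poly_roots_bound[OF B])
      also have "\<dots> < d"
        unfolding B_def by (rule degree_lessI) (use d in \<open>auto simp: coeff_sum\<close>)
      finally show False using T(2) by simp
    qed
    moreover have "F1 \<noteq> 0"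
    proof
      assume "F1 = 0"
      then have "coeff F1 d = 0" by simp
      then show False using lc by (simp add: F1_def)
    qed
    ultimately have "A = 0" by simp
    have "v $ i = 0" if "i < n" for i
    proof (cases "i < d - 1")
      case True
      have "coeff A i = v $ i" using True by (simp add: A_def coeff_sum)
      then show ?thesis using \<open>A = 0\<close> by simp
    next
      case False
      have "coeff B (i - (d - 1)) = v $ i" using False that by (auto simp: B_def coeff_sum n_def)
      then show ?thesis using \<open>B = 0\<close> by simp
    qed
    then show False using v(1,2) by (auto simp: Matrix.vec_eq_iff)
  qed

  have "degree D \<le> d * (d - 1)"
    using degree_det_coeff_mat_le[of n \<alpha> fs] tdeg D0 by (simp add: D_def sum\<alpha>)
  moreover have "Q dvd D" unfolding D_def by (rule Q_dvd) (use deg fs0 in auto)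
  \<comment> \<open>The divisor \<open>Q\<close> already has the largest degree allowed for
    \<open>D\<close>, so the two agree up to a constant and every numerator divisible by
    \<open>Q\<close> is divisible by \<open>D\<close>.\<close>
  ultimately obtain r where r: "D = Q * r" "degree r = 0" "degree D = d * (d - 1)"
    using D0 degQ by (auto elim!: dvdE simp: degree_mult_eq)
  have E: "E k = D * (E k div D)" if "k < n" for k
  proof -
    have "Q dvd E k" unfolding E_def by (rule Q_dvd) (use deg fs0 degH HX in auto)
    moreover have "D dvd Q"
    proof -
      obtain r0 where "r = [:r0:]" using r(2) by (auto elim: degree_eq_zeroE)
      then have "Q = D * [:inverse r0:]" using r(1) D0 by auto
      then show ?thesis by (metis dvd_triv_left)
    qed
    ultimately show ?thesis by (metis dvd_mult_div_cancel dvd_trans)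
  qed
  define b where "b = (\<lambda>k. E k div D)"
  \<comment> \<open>The degree bound is applied to the Cramer numerator, whose column
    \<open>k\<close> has weight \<open>2 * d - 2\<close> in place of \<alpha> k. Comparison with the
    exact degree of \<open>D\<close> bounds the quotient.\<close>
  have degb: "degree (b k) + \<alpha> k \<le> 2 * d - 2" if k: "k < n" and nz: "b k \<noteq> 0" for k
  proof -
    have Ek: "E k = D * b k" using E[OF k] by (simp add: b_def)
    have "(\<Sum>i<n. i) + degree (E k) \<le> (\<Sum>j<n. (\<alpha>(k := 2 * d - 2)) j)"
      unfolding E_def
      by (rule degree_det_coeff_mat_le) (use tdeg H Ek nz D0 in \<open>auto simp: E_def\<close>)
    moreover have "(\<Sum>j<n. (\<alpha>(k := 2 * d - 2)) j) + \<alpha> k = (\<Sum>j<n. \<alpha> j) + (2 * d - 2)"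
      using k by (simp add: sum.remove[of "{..<n}" k])
    moreover have "degree (E k) = d * (d - 1) + degree (b k)"
      using Ek nz D0 r(3) by (simp add: degree_mult_eq)
    ultimately show ?thesis using sum\<alpha> by linarith
  qed
  define A where "A = (\<Sum>j<d - 1. monom (b j) j)"
  define B where "B = (\<Sum>j<d. monom (b (d - 1 + j)) j)"
  have "H = (\<Sum>j<n. smult (b j) (fs j))"
    by (rule cramer_coeff_mat) (use degH deg D0 E in \<open>simp_all add: D_def E_def b_def\<close>)
  then have "H = A * F + B * G"
    unfolding fs_def n_def sylvester_combination A_def B_def .
  moreover have "total_degree_le (d - 1) B"
    unfolding B_def
  proof (intro total_degree_le_sum total_degree_le_monom)
    fix j assume j: "j \<in> {..<d}" "b (d - 1 + j) \<noteq> 0"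
    \<comment> \<open>The shift of \<open>G\<close> by \<open>j\<close> has weight
      \<open>d - 1 + j\<close>, which leaves \<open>d - 1 - j\<close> for the degree of its
      coefficient in \<open>s\<close>.\<close>
    have "\<alpha> (d - 1 + j) = d - 1 + j" by (auto simp: \<alpha>_def)
    moreover have "d - 1 + j < n" using j by (simp add: n_def)
    ultimately show "j + degree (b (d - 1 + j)) \<le> d - 1"
      using degb[of "d - 1 + j"] j(2) by linarith
  qed
  ultimately show ?thesis by blast
qed


section \<open>Evaluation of polynomials in three variables\<close>

definition monom_at :: "'a::comm_semiring_1^3 \<Rightarrow> (3 \<Rightarrow>\<^sub>0 nat) \<Rightarrow> 'a" where
  "monom_at v m = (\<Prod>i\<in>UNIV. (v $h i) ^ Poly_Mapping.lookup m i)"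

lemma monom_at_0 [simp]: "monom_at v 0 = 1"
  by (simp add: monom_at_def)

lemma monom_at_add: "monom_at v (m + m') = monom_at v m * monom_at v m'"
  by (simp add: monom_at_def lookup_add power_add prod.distrib)

lemma peval_superset:
  assumes "finite A" "Poly_Mapping.keys p \<subseteq> A"
  shows "peval p v = (\<Sum>m\<in>A. Poly_Mapping.lookup p m * monom_at v m)"
  unfolding peval_def monom_at_def
  by (rule sum.mono_neutral_left) (use assms in \<open>auto simp: in_keys_iff\<close>)

lemma peval_0 [simp]: "peval 0 v = 0"
  by (simp add: peval_def)

lemma peval_add: "peval (p + q) v = peval p v + peval q v"
proof -
  let ?A = "Poly_Mapping.keys p \<union> Poly_Mapping.keys q"
  have "Poly_Mapping.keys (p + q) \<subseteq> ?A" by (rule Poly_Mapping.keys_add)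
  then show ?thesis
    using peval_superset[of ?A "p + q" v] peval_superset[of ?A p v] peval_superset[of ?A q v]
    by (simp add: lookup_add algebra_simps sum.distrib)
qed

lemma peval_sum: "peval (\<Sum>x\<in>A. f x) v = (\<Sum>x\<in>A. peval (f x) v)"
  by (induction A rule: infinite_finite_induct) (simp_all add: peval_add)

lemma peval_single: "peval (Poly_Mapping.single m c) v = c * monom_at v m"
  by (simp add: peval_def monom_at_def)

lemma poly3_eq_sum_single:
  "p = (\<Sum>m\<in>Poly_Mapping.keys p. Poly_Mapping.single m (Poly_Mapping.lookup p m))"
  by (rule poly_mapping_eqI) (auto simp: lookup_sum lookup_single when_def in_keys_iff)

lemma peval_mult: "peval (p * q) v = peval p v * peval q v"
proof -
  let ?s = "\<lambda>p m. Poly_Mapping.single m (Poly_Mapping.lookup p m)"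
  have "p * q = (\<Sum>m\<in>Poly_Mapping.keys p. \<Sum>m'\<in>Poly_Mapping.keys q. ?s p m * ?s q m')"
    using sum_product[of "?s p" "Poly_Mapping.keys p" "?s q" "Poly_Mapping.keys q"]
      poly3_eq_sum_single[of p] poly3_eq_sum_single[of q] by argo
  also have "peval \<dots> v = (\<Sum>m\<in>Poly_Mapping.keys p. \<Sum>m'\<in>Poly_Mapping.keys q.
      (Poly_Mapping.lookup p m * monom_at v m) * (Poly_Mapping.lookup q m' * monom_at v m'))"
    by (simp add: peval_sum mult_single peval_single monom_at_add mult_ac)
  also have "\<dots> = peval p v * peval q v"
    by (simp only: peval_def monom_at_def sum_product)
  finally show ?thesis .
qed

lemma peval_Const [simp]: "peval (Const c) v = c"
  by (simp add: Const_def peval_single)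

lemma peval_1 [simp]: "peval 1 v = 1"
  using peval_single[of 0 1 v] by simp

lemma peval_Var [simp]: "peval (Var i) v = v $h i"
proof -
  have "monom_at v (Poly_Mapping.single i 1) = (\<Prod>j\<in>UNIV. if j = i then v $h j else 1)"
    unfolding monom_at_def by (rule prod.cong) (auto simp: lookup_single when_def)
  then show ?thesis by (simp add: Var_def peval_single)
qed

lemma prod_3: "(\<Prod>i\<in>(UNIV::3 set). f i) = f 1 * f 2 * f 3"
  unfolding UNIV_3 by (simp add: mult.assoc)

lemma comm_ring_hom_peval: "comm_ring_hom (\<lambda>p. peval p (v :: 'a::comm_ring_1^3))"
  by unfold_locales (simp_all add: peval_add peval_mult)

lemma peval_diff: "peval (p - q) v = peval p v - peval q (v :: 'a::comm_ring_1^3)"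
  using peval_add[of "p - q" q v] by simp

lemma lookup_pconj: "Poly_Mapping.lookup (pconj p) m = cnj (Poly_Mapping.lookup p m)"
  by (auto simp: pconj_def Poly_Mapping.map.rep_eq when_def)

lemma keys_pconj: "Poly_Mapping.keys (pconj p) = Poly_Mapping.keys p"
  by (auto simp: in_keys_iff lookup_pconj)

definition vconj :: "complex^3 \<Rightarrow> complex^3" where
  "vconj v = (\<chi> i. cnj (v $h i))"

lemma vconj_cvec [simp]: "vconj (cvec v) = cvec v"
  by (simp add: vconj_def cvec_def)

lemma peval_pconj_vconj: "peval (pconj p) (vconj v) = cnj (peval p v)"
  by (simp add: peval_def keys_pconj lookup_pconj vconj_def)

lemma peval_pconj: "peval (pconj p) (cvec v) = cnj (peval p (cvec v))"
  using peval_pconj_vconj[of p "cvec v"] by simp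

lemma peval_pdiff:
  "peval (pdiff i p) v = (\<Sum>m\<in>Poly_Mapping.keys p.
     of_nat (Poly_Mapping.lookup m i) * Poly_Mapping.lookup p m * monom_at v (m - Poly_Mapping.single i 1))"
  by (simp add: pdiff_def peval_sum peval_single)

text \<open>Kronecker's substitution \<open>x = u\<close>, \<open>y = u ^ K\<close>, \<open>z = u ^ (K * K)\<close> with \<open>K\<close> above all
  exponents sends distinct monomials to distinct powers of \<open>u\<close>.\<close>

lemma poly3_eq_0I:
  fixes p :: "complex poly3"
  assumes z: "\<And>v. peval p (cvec v) = 0"
  shows "p = 0"
proof -
  define K where "K = Suc (\<Sum>m\<in>Poly_Mapping.keys p. \<Sum>i\<in>UNIV. Poly_Mapping.lookup m i)"
  have K: "Poly_Mapping.lookup m i < K" if "m \<in> Poly_Mapping.keys p" for m i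
  proof -
    have "Poly_Mapping.lookup m i \<le> (\<Sum>i\<in>UNIV. Poly_Mapping.lookup m i)" by (rule member_le_sum) auto
    also have "\<dots> \<le> (\<Sum>m\<in>Poly_Mapping.keys p. \<Sum>i\<in>UNIV. Poly_Mapping.lookup m i)"
      by (rule member_le_sum) (use that in auto)
    finally show ?thesis by (simp add: K_def)
  qed
  define \<phi> where "\<phi> = (\<lambda>m. Poly_Mapping.lookup m (1::3) + K * (Poly_Mapping.lookup m 2 + K * Poly_Mapping.lookup m 3))"
  have inj: "inj_on \<phi> (Poly_Mapping.keys p)"
  proof (rule inj_onI)
    fix m m' assume m: "m \<in> Poly_Mapping.keys p" "m' \<in> Poly_Mapping.keys p" and eq: "\<phi> m = \<phi> m'"
    have digits: "a = a' \<and> b = b'" if "a + K * b = a' + K * b'" "a < K" "a' < K" for a b a' b' :: nat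
    proof -
      have "a = (a + K * b) mod K" using that(2) by simp
      also have "\<dots> = (a' + K * b') mod K" by (simp only: that(1))
      also have "\<dots> = a'" using that(3) by simp
      finally have "a = a'" .
      then show ?thesis using that by simp
    qed
    have 1: "Poly_Mapping.lookup m 1 = Poly_Mapping.lookup m' 1"
      and 2: "Poly_Mapping.lookup m 2 + K * Poly_Mapping.lookup m 3 = Poly_Mapping.lookup m' 2 + K * Poly_Mapping.lookup m' 3"
      using digits[OF eq[unfolded \<phi>_def] K[OF m(1)] K[OF m(2)]] by blast+
    have "Poly_Mapping.lookup m i = Poly_Mapping.lookup m' i" for i
      using 1 digits[OF 2 K[OF m(1)] K[OF m(2)]] exhaust_3[of i] by auto
    then show "m = m'" by (simp add: poly_mapping_eqI)
  qed
  define q where "q = (\<Sum>m\<in>Poly_Mapping.keys p. monom (Poly_Mapping.lookup p m) (\<phi> m))"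
  have "poly q (complex_of_real u) = 0" for u
  proof -
    define v :: "real^3" where "v = (\<chi> i. if i = 1 then u else if i = 2 then u ^ K else u ^ (K * K))"
    have "monom_at (cvec v) m = complex_of_real u ^ \<phi> m" for m
    proof -
      let ?l = "Poly_Mapping.lookup m" and ?u = "complex_of_real u"
      have "monom_at (cvec v) m = ?u ^ ?l 1 * (?u ^ K) ^ ?l 2 * (?u ^ (K * K)) ^ ?l 3"
        by (simp add: monom_at_def prod_3 cvec_nth v_def)
      also have "\<dots> = ?u ^ \<phi> m"
        by (simp only: \<phi>_def power_add power_mult distrib_left mult.assoc)
      finally show ?thesis .
    qed
    then have "poly q (complex_of_real u) = peval p (cvec v)"
      by (simp add: q_def poly_sum poly_monom peval_superset[OF _ order_refl])
    then show ?thesis using z by simp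
  qed
  \<comment> \<open>Testing at real points is enough because they already give \<open>q\<close>
    infinitely many roots.\<close>
  then have "range complex_of_real \<subseteq> {x. poly q x = 0}" by auto
  moreover have "infinite (range complex_of_real)"
  proof
    assume "finite (range complex_of_real)"
    then have "finite (UNIV :: real set)" by (rule finite_imageD) (simp add: inj_on_def)
    with infinite_UNIV_char_0[where 'a = real] show False by contradiction
  qed
  ultimately have inf: "infinite {x. poly q x = 0}" by (rule infinite_super)
  have "q = 0"
  proof (rule ccontr)
    assume "q \<noteq> 0"
    from poly_roots_finite[OF this] inf show False by contradiction
  qed
  have "Poly_Mapping.lookup p m = 0" for m
  proof (rule ccontr)
    assume "Poly_Mapping.lookup p m \<noteq> 0"
    then have m: "m \<in> Poly_Mapping.keys p" by (simp add: in_keys_iff)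
    have "coeff q (\<phi> m) = (\<Sum>m'\<in>Poly_Mapping.keys p. if m' = m then Poly_Mapping.lookup p m' else 0)"
      unfolding q_def coeff_sum coeff_monom
      by (intro sum.cong refl) (use inj m in \<open>auto dest: inj_onD\<close>)
    also have "\<dots> = Poly_Mapping.lookup p m" using m by simp
    finally show False using \<open>q = 0\<close> \<open>Poly_Mapping.lookup p m \<noteq> 0\<close> by simp
  qed
  then show ?thesis by (simp add: poly_mapping_eqI)
qed

lemma poly3_eqI:
  fixes p q :: "complex poly3"
  assumes "\<And>v. peval p (cvec v) = peval q (cvec v)"
  shows "p = q"
  using poly3_eq_0I[of "p - q"] assms by (simp add: peval_diff)

section \<open>Restriction to an affine chart\<close>

definition chart_point :: "real^3 \<Rightarrow> real^3 \<Rightarrow> real^3 \<Rightarrow> complex \<Rightarrow> complex \<Rightarrow> complex^3" where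
  "chart_point e p q t s = t *s cvec e + s *s cvec p + cvec q"

definition chart_coord :: "real^3 \<Rightarrow> real^3 \<Rightarrow> real^3 \<Rightarrow> 3 \<Rightarrow> complex poly poly" where
  "chart_coord e p q i = [:[:complex_of_real (q $h i), complex_of_real (p $h i):], [:complex_of_real (e $h i):]:]"

definition chart_poly :: "real^3 \<Rightarrow> real^3 \<Rightarrow> real^3 \<Rightarrow> complex poly3 \<Rightarrow> complex poly poly" where
  "chart_poly e p q h = (\<Sum>m\<in>Poly_Mapping.keys h. [:[:Poly_Mapping.lookup h m:]:] *
     (\<Prod>i\<in>UNIV. chart_coord e p q i ^ Poly_Mapping.lookup m i))"

lemma bpoly_chart_coord: "bpoly (chart_coord e p q i) t s = chart_point e p q t s $h i"
  by (simp add: chart_coord_def chart_point_def cvec_nth algebra_simps)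

lemma bpoly_chart_poly: "bpoly (chart_poly e p q h) t s = peval h (chart_point e p q t s)"
  by (simp add: chart_poly_def peval_def poly_sum poly_prod poly_power bpoly_chart_coord)

section \<open>Degree, leading coefficient and derivative of a form in the chart\<close>

lemma total_degree_le_chart_coord: "total_degree_le 1 (chart_coord e p q i)"
  by (auto simp: total_degree_le_def chart_coord_def coeff_pCons split: nat.splits)

lemma total_degree_le_const: "total_degree_le 0 [:[:c:]:]"
  by (auto simp: total_degree_le_def coeff_pCons split: nat.splits)

lemma total_degree_le_power: "total_degree_le k P \<Longrightarrow> total_degree_le (n * k) (P ^ n)"
  for P :: "'a::comm_semiring_1 poly poly"
  by (induction n) (auto simp: one_pCons intro: total_degree_le_mult total_degree_le_const)

lemma total_degree_le_prod:
  fixes f :: "'b \<Rightarrow> 'a::comm_semiring_1 poly poly"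
  shows "(\<And>x. x \<in> A \<Longrightarrow> total_degree_le (n x) (f x)) \<Longrightarrow> total_degree_le (\<Sum>x\<in>A. n x) (\<Prod>x\<in>A. f x)"
  by (induction A rule: infinite_finite_induct)
     (auto simp: one_pCons intro: total_degree_le_mult total_degree_le_const)

lemma coeff_mult_top:
  assumes "total_degree_le m P" "total_degree_le n Q"
  shows "coeff (P * Q) (m + n) = coeff P m * coeff Q n"
proof -
  have "coeff (P * Q) (m + n) = (\<Sum>i\<le>m + n. if i = m then coeff P m * coeff Q n else 0)"
    unfolding coeff_mult
  proof (intro sum.cong refl)
    fix i assume "i \<in> {..m + n}"
    consider "i < m" | "i = m" | "i > m" by linarith
    then show "coeff P i * coeff Q (m + n - i) = (if i = m then coeff P m * coeff Q n else 0)"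
    proof cases
      case 1
      then have "coeff Q (m + n - i) = 0"
        using total_degree_le_imp_degree[OF assms(2)] by (intro coeff_eq_0) simp
      then show ?thesis using 1 by simp
    next
      case 3
      then have "coeff P i = 0"
        using total_degree_le_imp_degree[OF assms(1)] by (intro coeff_eq_0) simp
      then show ?thesis using 3 by simp
    qed simp
  qed
  then show ?thesis by simp
qed

lemma coeff_power_top:
  fixes P :: "'a::comm_semiring_1 poly poly"
  assumes "total_degree_le k P"
  shows "coeff (P ^ n) (n * k) = coeff P k ^ n"
  using coeff_mult_top[OF assms total_degree_le_power[OF assms]]
  by (induction n) simp_all

lemma coeff_prod_top:
  fixes f :: "'b \<Rightarrow> 'a::comm_semiring_1 poly poly"
  assumes "\<And>x. x \<in> A \<Longrightarrow> total_degree_le (n x) (f x)"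
  shows "coeff (\<Prod>x\<in>A. f x) (\<Sum>x\<in>A. n x) = (\<Prod>x\<in>A. coeff (f x) (n x))"
  using assms
proof (induction A rule: infinite_finite_induct)
  case (insert x A)
  then show ?case
    using coeff_mult_top[OF insert.prems[of x] total_degree_le_prod[of A n f]] by simp
qed simp_all

lemma homogeneous_sum_lookup:
  "homogeneous n h \<Longrightarrow> m \<in> Poly_Mapping.keys h \<Longrightarrow> (\<Sum>i\<in>UNIV. Poly_Mapping.lookup m i) = n"
  by (simp add: homogeneous_def total_deg_def)

lemma total_degree_le_chart_prod:
  "total_degree_le (\<Sum>i\<in>UNIV. k i) (\<Prod>i\<in>UNIV. chart_coord e p q i ^ k i)"
  using total_degree_le_power[OF total_degree_le_chart_coord] by (intro total_degree_le_prod) simp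

lemma total_degree_le_chart_poly:
  assumes "homogeneous n h"
  shows "total_degree_le n (chart_poly e p q h)"
  unfolding chart_poly_def
proof (rule total_degree_le_sum)
  fix m assume "m \<in> Poly_Mapping.keys h"
  then show "total_degree_le n ([:[:Poly_Mapping.lookup h m:]:] * (\<Prod>i\<in>UNIV. chart_coord e p q i ^ Poly_Mapping.lookup m i))"
    using total_degree_le_mult[OF total_degree_le_const total_degree_le_chart_prod[where k = "Poly_Mapping.lookup m"]]
      homogeneous_sum_lookup[OF assms] by simp
qed

text \<open>Only the direction \<open>e\<close> carries \<open>t\<close>, so the top coefficient
  does not depend on \<open>s\<close>. For \<open>f\<close> this makes every line restriction a
  polynomial of exact degree \<open>d\<close> with leading coefficient \<open>f(e)\<close>.\<close>

lemma coeff_chart_poly_top: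
  assumes "homogeneous n h"
  shows "coeff (chart_poly e p q h) n = [:peval h (cvec e):]"
proof -
  have "coeff ([:[:Poly_Mapping.lookup h m:]:] * (\<Prod>i\<in>UNIV. chart_coord e p q i ^ Poly_Mapping.lookup m i)) n
      = [:Poly_Mapping.lookup h m * monom_at (cvec e) m:]" if "m \<in> Poly_Mapping.keys h" for m
  proof -
    have "coeff (chart_coord e p q i ^ k) k = [:cvec e $h i ^ k:]" for i k
      using coeff_power_top[OF total_degree_le_chart_coord, of e p q i k]
      by (simp add: chart_coord_def cvec_nth poly_const_pow)
    moreover have "total_degree_le k (chart_coord e p q i ^ k)" for i k
      using total_degree_le_power[OF total_degree_le_chart_coord, of k e p q i] by simp
    ultimately have "coeff (\<Prod>i\<in>UNIV. chart_coord e p q i ^ Poly_Mapping.lookup m i) n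
        = (\<Prod>i\<in>UNIV. [:cvec e $h i ^ Poly_Mapping.lookup m i:])"
      using coeff_prod_top[of UNIV "Poly_Mapping.lookup m" "\<lambda>i. chart_coord e p q i ^ Poly_Mapping.lookup m i"]
        homogeneous_sum_lookup[OF assms that] by simp
    then show ?thesis by (simp add: prod_3 monom_at_def)
  qed
  then have "coeff (chart_poly e p q h) n
      = (\<Sum>m\<in>Poly_Mapping.keys h. [:Poly_Mapping.lookup h m * monom_at (cvec e) m:])"
    by (simp add: chart_poly_def coeff_sum)
  also have "\<dots> = [:peval h (cvec e):]"
    by (rule poly_eqI) (auto simp: coeff_sum coeff_pCons peval_def monom_at_def split: nat.splits)
  finally show ?thesis .
qed

text \<open>The subtraction truncates alike on both sides, so a variable that does not occur needs
  no case of its own; its term in the derivative carries the factor \<open>of_nat 0\<close>.\<close>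

lemma monom_at_pred:
  "monom_at v (m - Poly_Mapping.single i 1) = (v $h i) ^ (Poly_Mapping.lookup m i - 1)
      * (\<Prod>j\<in>UNIV - {i}. (v $h j) ^ Poly_Mapping.lookup m j)"
proof -
  let ?l = "Poly_Mapping.lookup (m - Poly_Mapping.single i 1)"
  have "monom_at v (m - Poly_Mapping.single i 1) = (v $h i) ^ ?l i * (\<Prod>j\<in>UNIV - {i}. (v $h j) ^ ?l j)"
    unfolding monom_at_def by (rule prod.remove) simp_all
  moreover have "?l i = Poly_Mapping.lookup m i - 1" by (simp add: lookup_minus)
  moreover have "?l j = Poly_Mapping.lookup m j" if "j \<noteq> i" for j
    using that by (simp add: lookup_minus lookup_single)
  ultimately show ?thesis by simp
qed

text \<open>Chain rule: moving \<open>t\<close> moves the point along \<open>e\<close>. For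
  \<open>h = f\<close> the right-hand side is the value of \<open>g\<close>, so \<open>g\<close>
  restricts to the derivative of \<open>f\<close> on each line.\<close>

lemma bpoly_pderiv_chart_poly:
  "bpoly (pderiv (chart_poly e p q h)) t s
    = (\<Sum>i\<in>UNIV. complex_of_real (e $h i) * peval (pdiff i h) (chart_point e p q t s))"
proof -
  let ?v = "chart_point e p q t s"
  have dc: "pderiv (chart_coord e p q i) = [:[:complex_of_real (e $h i):]:]" for i
    by (simp add: chart_coord_def pderiv_pCons)
  have "bpoly (pderiv ([:[:c:]:] * (\<Prod>i\<in>UNIV. chart_coord e p q i ^ Poly_Mapping.lookup m i))) t s
      = (\<Sum>i\<in>UNIV. complex_of_real (e $h i) * (of_nat (Poly_Mapping.lookup m i) * c * monom_at ?v (m - Poly_Mapping.single i 1)))"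
    for c m
  proof -
    have "bpoly (pderiv ([:[:c:]:] * (\<Prod>i\<in>UNIV. chart_coord e p q i ^ Poly_Mapping.lookup m i))) t s
      = c * (\<Sum>i\<in>UNIV. (\<Prod>j\<in>UNIV - {i}. (?v $h j) ^ Poly_Mapping.lookup m j) *
          (of_nat (Poly_Mapping.lookup m i) * (?v $h i) ^ (Poly_Mapping.lookup m i - 1) * complex_of_real (e $h i)))"
    proof -
      have "pderiv ([:[:c:]:] * (\<Prod>i\<in>UNIV. chart_coord e p q i ^ Poly_Mapping.lookup m i))
          = smult [:c:] (\<Sum>i\<in>UNIV. (\<Prod>j\<in>UNIV - {i}. chart_coord e p q j ^ Poly_Mapping.lookup m j) *
              pderiv (chart_coord e p q i ^ Poly_Mapping.lookup m i))"
        by (simp add: pderiv_smult pderiv_prod)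
      moreover have "bpoly (pderiv (chart_coord e p q i ^ k)) t s
          = of_nat k * (?v $h i) ^ (k - 1) * complex_of_real (e $h i)" for i k
        unfolding pderiv_power dc by (simp add: poly_power bpoly_chart_coord)
      ultimately show ?thesis
        by (simp only: poly_smult poly_mult poly_sum poly_prod poly_power bpoly_chart_coord
            poly_pCons poly_0 mult_zero_right add_0_right)
    qed
    also have "\<dots> = (\<Sum>i\<in>UNIV. complex_of_real (e $h i) * c * (of_nat (Poly_Mapping.lookup m i) * monom_at ?v (m - Poly_Mapping.single i 1)))"
      unfolding sum_distrib_left
    proof (rule sum.cong[OF refl])
      fix i
      show "c * ((\<Prod>j\<in>UNIV - {i}. (?v $h j) ^ Poly_Mapping.lookup m j) *
          (of_nat (Poly_Mapping.lookup m i) * (?v $h i) ^ (Poly_Mapping.lookup m i - 1) * complex_of_real (e $h i)))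
        = complex_of_real (e $h i) * c * (of_nat (Poly_Mapping.lookup m i) * monom_at ?v (m - Poly_Mapping.single i 1))"
        unfolding monom_at_pred by (simp only: mult_ac)
    qed
    finally show ?thesis by (simp only: mult_ac)
  qed
  note term_eq = this
  have "bpoly (pderiv (chart_poly e p q h)) t s = (\<Sum>m\<in>Poly_Mapping.keys h. \<Sum>i\<in>UNIV.
      complex_of_real (e $h i) * (of_nat (Poly_Mapping.lookup m i) * Poly_Mapping.lookup h m * monom_at ?v (m - Poly_Mapping.single i 1)))"
    by (simp only: chart_poly_def pderiv_sum poly_sum term_eq)
  also have "\<dots> = (\<Sum>i\<in>UNIV. \<Sum>m\<in>Poly_Mapping.keys h.
      complex_of_real (e $h i) * (of_nat (Poly_Mapping.lookup m i) * Poly_Mapping.lookup h m * monom_at ?v (m - Poly_Mapping.single i 1)))"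
    by (rule sum.swap)
  finally show ?thesis by (simp only: peval_pdiff sum_distrib_left)
qed


section \<open>Interpolation at the points of a line\<close>

lemma poly_pderiv_linear_prod:
  fixes T :: "'a::field set"
  assumes "finite T" "z \<in> T"
  shows "poly (pderiv (smult c (\<Prod>w\<in>T. [:-w, 1:]))) z = c * (\<Prod>w\<in>T - {z}. z - w)"
proof -
  have "poly (pderiv (\<Prod>w\<in>T. [:-w, 1:])) z = (\<Sum>a\<in>T. \<Prod>w\<in>T - {a}. z - w)"
    by (simp add: pderiv_prod poly_sum poly_prod pderiv_pCons)
  also have "\<dots> = (\<Sum>a\<in>T. if a = z then \<Prod>w\<in>T - {z}. z - w else 0)"
    by (rule sum.cong[OF refl]) (use assms in \<open>auto intro!: prod_zero\<close>)
  finally show ?thesis using assms by (simp add: pderiv_smult)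
qed

lemma poly_pderiv_linear_prod_nonzero:
  fixes T :: "'a::field set"
  assumes "finite T" "z \<in> T" "c \<noteq> 0"
  shows "poly (pderiv (smult c (\<Prod>w\<in>T. [:-w, 1:]))) z \<noteq> 0"
  using assms by (simp add: poly_pderiv_linear_prod)

text \<open>The basis polynomial of a node \<open>z\<close> is \<open>P\<close> without its factor
  at \<open>z\<close>, divided by the derivative of \<open>P\<close> at \<open>z\<close>; both sides
  have degree below \<open>card T\<close> and agree on \<open>T\<close>.\<close>

lemma lagrange_interpolation:
  fixes T :: "'a::field set"
  assumes T: "finite T" and c: "c \<noteq> 0" and deg: "degree U < card T"
  defines "P \<equiv> smult c (\<Prod>w\<in>T. [:-w, 1:])"
  shows "U = (\<Sum>z\<in>T. smult (poly U z / poly (pderiv P) z) (smult c (\<Prod>w\<in>T - {z}. [:-w, 1:])))"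
    (is "U = ?R")
proof (rule poly_eqI_degree[of T])
  fix x assume x: "x \<in> T"
  have "poly ?R x = (\<Sum>z\<in>T. if z = x then poly U x else 0)"
    unfolding poly_sum
  proof (rule sum.cong[OF refl])
    fix z assume z: "z \<in> T"
    show "poly (smult (poly U z / poly (pderiv P) z) (smult c (\<Prod>w\<in>T - {z}. [:-w, 1:]))) x
        = (if z = x then poly U x else 0)"
    proof (cases "z = x")
      case True
      then show ?thesis
        using poly_pderiv_linear_prod[OF T x, of c] poly_pderiv_linear_prod_nonzero[OF T x c]
        by (simp add: P_def poly_prod)
    next
      case False
      then have "(\<Prod>w\<in>T - {z}. x - w) = 0" using x T by (intro prod_zero) auto
      then show ?thesis using False by (simp add: poly_prod)
    qed
  qed
  also have "\<dots> = poly U x" using x T by simp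
  finally show "poly U x = poly ?R x" by simp
next
  show "degree U < card T" by (rule deg)
  show "degree ?R < card T"
  proof (rule degree_lessI)
    show "?R \<noteq> 0 \<or> 0 < card T" using deg by simp
    show "\<forall>k\<ge>card T. coeff ?R k = 0"
    proof (intro allI impI)
      fix k assume k: "card T \<le> k"
      have "coeff (\<Prod>w\<in>T - {z}. [:-w, 1:]) k = 0" if z: "z \<in> T" for z
      proof (rule coeff_eq_0)
        have "degree (\<Prod>w\<in>T - {z}. [:-w, 1:]) \<le> card (T - {z})"
          by (subst degree_prod_eq_sum_degree) auto
        also have "\<dots> < k" using z T k card_Diff1_less[OF T z] by linarith
        finally show "degree (\<Prod>w\<in>T - {z}. [:-w, 1:]) < k" .
      qed
      then show "coeff ?R k = 0" by (simp add: coeff_sum)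
    qed
  qed
qed

text \<open>Euler's formula, obtained by comparing the coefficients of degree
  \<open>card T - 1\<close> in Lagrange's formula, where each cofactor of \<open>P\<close> is
  \<open>c\<close> times a monic polynomial of that degree.\<close>

lemma sum_quotient_pderiv:
  fixes T :: "'a::field set"
  assumes T: "finite T" and c: "c \<noteq> 0" and deg: "degree U < card T"
  defines "P \<equiv> smult c (\<Prod>w\<in>T. [:-w, 1:])"
  shows "(\<Sum>z\<in>T. poly U z / poly (pderiv P) z) = coeff U (card T - 1) / c"
proof -
  have monic: "coeff (\<Prod>w\<in>T - {z}. [:-w, 1:]) (card T - 1) = 1" if z: "z \<in> T" for z
  proof -
    have "degree (\<Prod>w\<in>T - {z}. [:-w, 1:]) = card T - 1"
      using T z by (subst degree_prod_eq_sum_degree) auto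
    moreover have "lead_coeff (\<Prod>w\<in>T - {z}. [:-w, 1:]) = 1" by (simp add: lead_coeff_prod)
    ultimately show ?thesis by simp
  qed
  have "coeff U (card T - 1) = (\<Sum>z\<in>T. poly U z / poly (pderiv P) z * (c * coeff (\<Prod>w\<in>T - {z}. [:-w, 1:]) (card T - 1)))"
    by (subst lagrange_interpolation[OF T c deg]) (simp only: P_def coeff_sum coeff_smult)
  also have "\<dots> = (\<Sum>z\<in>T. poly U z / poly (pderiv P) z) * c"
    unfolding sum_distrib_right by (rule sum.cong[OF refl]) (use monic in simp)
  finally show ?thesis using c by simp
qed

text \<open>At a zero of \<open>F\<close> the summand is \<open>B\<close> divided by the derivative
  of \<open>F\<close>, so Euler's formula returns the coefficient of \<open>B\<close> in degree
  \<open>d - 1\<close>, constant in \<open>s\<close> by the total degree bound. The polynomial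
  \<open>t B\<close> may have degree \<open>d\<close> and is first reduced modulo \<open>F\<close>,
  which brings in the coefficient of \<open>F\<close> in degree \<open>d - 1\<close>, at most linear
  in \<open>s\<close>.\<close>

lemma trace_constant_and_affine:
  fixes A B F G :: "complex poly poly"
  assumes d: "d \<ge> 1" and F: "total_degree_le d F" and B: "total_degree_le (d - 1) B"
    and lc: "coeff F d = [:c:]" "c \<noteq> 0" and H: "H = A * F + B * G"
  shows "\<exists>\<kappa> r. degree r \<le> 1 \<and> (\<forall>s T. finite T \<longrightarrow> card T = d \<longrightarrow>
      section_at s F = smult c (\<Prod>w\<in>T. [:-w, 1:]) \<longrightarrow>
      (\<forall>z\<in>T. bpoly G z s = poly (pderiv (section_at s F)) z) \<longrightarrow>
      (\<Sum>z\<in>T. bpoly H z s / (bpoly G z s)\<^sup>2) = \<kappa> \<and>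
      (\<Sum>z\<in>T. z * bpoly H z s / (bpoly G z s)\<^sup>2) = poly r s)"
proof -
  define b where "b = coeff B (d - 1)"
  \<comment> \<open>This is the coefficient of degree \<open>d - 1\<close> of
    \<open>t B - (b / c) F\<close>, divided by \<open>c\<close>. Writing \<open>t B\<close> as
    \<open>pCons 0 B\<close> also covers \<open>d = 1\<close>, where its contribution is 0 and an
    index \<open>d - 2\<close> would be truncated.\<close>
  define r where "r = smult (1 / c) (coeff (pCons 0 B) (d - 1)) - smult (1 / c\<^sup>2) (b * coeff F (d - 1))"
  have degb: "degree b = 0"
    using total_degree_leD[OF B, of "d - 1"] by (cases "b = 0") (auto simp: b_def)
  have "degree (coeff (pCons 0 B) (d - 1)) \<le> 1"
  proof (cases "d - 1")
    case (Suc m)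
    then show ?thesis using total_degree_leD[OF B, of m] by (cases "coeff B m = 0") auto
  qed simp
  moreover have "degree (coeff F (d - 1)) \<le> 1"
    using total_degree_leD[OF F, of "d - 1"] d by (cases "coeff F (d - 1) = 0") auto
  then have "degree (b * coeff F (d - 1)) \<le> 1"
    using degree_mult_le[of b "coeff F (d - 1)"] degb by simp
  ultimately have degr: "degree r \<le> 1"
    unfolding r_def by (intro degree_diff_le) (meson degree_smult_le order_trans)+
  have "(\<Sum>z\<in>T. bpoly H z s / (bpoly G z s)\<^sup>2) = coeff b 0 / c \<and>
      (\<Sum>z\<in>T. z * bpoly H z s / (bpoly G z s)\<^sup>2) = poly r s"
    if T: "finite T" "card T = d" and Fs: "section_at s F = smult c (\<Prod>w\<in>T. [:-w, 1:])"
      and G: "\<forall>z\<in>T. bpoly G z s = poly (pderiv (section_at s F)) z" for s T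
  proof -
    define P where "P = smult c (\<Prod>w\<in>T. [:-w, 1:])"
    note Fs = Fs[folded P_def]
    let ?B = "section_at s B"
    have G': "bpoly G z s = poly (pderiv P) z" "bpoly G z s \<noteq> 0" if "z \<in> T" for z
      using G Fs that poly_pderiv_linear_prod_nonzero[OF T(1) that lc(2), folded P_def] by simp_all
    have F0: "poly P z = 0" if "z \<in> T" for z
      using that T by (simp add: P_def poly_prod)
    have HG: "bpoly H z s = poly ?B z * bpoly G z s" if "z \<in> T" for z
      using F0[OF that] Fs by (simp add: H poly_section_at flip: poly_section_at[of s F])
    have degB: "degree ?B < d"
      using total_degree_le_imp_degree[OF B] degree_section_at_le[of s B] d by linarith
    have "(\<Sum>z\<in>T. bpoly H z s / (bpoly G z s)\<^sup>2) = (\<Sum>z\<in>T. poly ?B z / poly (pderiv P) z)"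
      by (rule sum.cong[OF refl]) (use G' HG in \<open>simp add: power2_eq_square\<close>)
    also have "\<dots> = coeff ?B (d - 1) / c"
      using sum_quotient_pderiv[OF T(1) lc(2), of ?B, folded P_def] degB T(2) by simp
    also have "coeff ?B (d - 1) = coeff b 0"
    proof -
      obtain b0 where "b = [:b0:]" using degb by (auto elim: degree_eq_zeroE)
      then show ?thesis by (simp only: coeff_section_at b_def[symmetric]) simp
    qed
    finally have 1: "(\<Sum>z\<in>T. bpoly H z s / (bpoly G z s)\<^sup>2) = coeff b 0 / c" .
    \<comment> \<open>Subtracting this multiple of \<open>P\<close> cancels the term of degree
      \<open>d\<close> and leaves the values on \<open>T\<close> unchanged.\<close>
    define U where "U = pCons 0 ?B - smult (poly b s / c) P"
    have degU: "degree U < d"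
    proof (rule degree_lessI)
      show "U \<noteq> 0 \<or> 0 < d" using d by simp
      show "\<forall>k\<ge>d. coeff U k = 0"
      proof (intro allI impI)
        fix k assume "k \<ge> d"
        then consider "k = d" | "k > d" by linarith
        then show "coeff U k = 0"
        proof cases
          case 1
          have "coeff P d = c" using lc(1) Fs by (metis coeff_section_at poly_pCons poly_0 mult_zero_right add.right_neutral)
          then show ?thesis using 1 d lc(2) by (simp add: U_def b_def coeff_pCons split: nat.splits)
        next
          case 2
          have "coeff P k = 0"
            using 2 total_degree_le_imp_degree[OF F] by (simp add: coeff_eq_0 flip: Fs)
          moreover have "coeff (pCons 0 ?B) k = 0"
            using 2 degB degree_pCons_le[of 0 ?B] by (intro coeff_eq_0) linarith
          ultimately show ?thesis by (simp add: U_def)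
        qed
      qed
    qed
    have "(\<Sum>z\<in>T. z * bpoly H z s / (bpoly G z s)\<^sup>2) = (\<Sum>z\<in>T. poly U z / poly (pderiv P) z)"
    proof (rule sum.cong[OF refl])
      fix z assume z: "z \<in> T"
      have "poly U z = z * poly ?B z" using F0[OF z] by (simp add: U_def)
      then show "z * bpoly H z s / (bpoly G z s)\<^sup>2 = poly U z / poly (pderiv P) z"
        using G'[OF z] HG[OF z] by (simp add: power2_eq_square)
    qed
    also have "\<dots> = coeff U (d - 1) / c"
      using sum_quotient_pderiv[OF T(1) lc(2), of U, folded P_def] degU T(2) by simp
    also have "coeff U (d - 1) = poly (coeff (pCons 0 B) (d - 1)) s - poly b s / c * poly (coeff F (d - 1)) s"
      unfolding U_def coeff_diff coeff_smult[of "poly b s / c"] Fs[symmetric] coeff_section_at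
      by (simp add: coeff_pCons split: nat.splits)
    also have "\<dots> / c = poly r s"
      by (simp add: r_def power2_eq_square diff_divide_distrib)
    finally show ?thesis using 1 by simp
  qed
  then show ?thesis using degr by blast
qed


section \<open>The curve in an affine chart\<close>

text \<open>The first conjunct says that the matrix with rows \<open>\<kappa>, \<mu>, \<nu>\<close> and the matrix with columns \<open>e, p, q\<close>
  are inverse to each other in one order, the remaining conjuncts in the other.\<close>

definition dual_bases :: "real^3 \<Rightarrow> real^3 \<Rightarrow> real^3 \<Rightarrow> real^3 \<Rightarrow> real^3 \<Rightarrow> real^3 \<Rightarrow> bool" where
  "dual_bases e p q \<kappa> \<mu> \<nu> \<longleftrightarrow>
     (\<forall>i k. \<kappa> $h i * e $h k + \<mu> $h i * p $h k + \<nu> $h i * q $h k = (if i = k then 1 else 0)) \<and>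
     \<kappa> \<bullet> e = 1 \<and> \<kappa> \<bullet> p = 0 \<and> \<kappa> \<bullet> q = 0 \<and> \<mu> \<bullet> e = 0 \<and> \<mu> \<bullet> p = 1 \<and> \<mu> \<bullet> q = 0 \<and>
     \<nu> \<bullet> e = 0 \<and> \<nu> \<bullet> p = 0 \<and> \<nu> \<bullet> q = 1"

lemma dual_bases_exist:
  assumes "e \<noteq> (0 :: real^3)"
  shows "\<exists>p q \<kappa> \<mu> \<nu>. dual_bases e p q \<kappa> \<mu> \<nu>"
proof -
  obtain i where "e $h i \<noteq> 0" using assms by (auto simp: Finite_Cartesian_Product.vec_eq_iff)
  then consider "e $h 1 \<noteq> 0" | "e $h 2 \<noteq> 0" | "e $h 3 \<noteq> 0" using exhaust_3[of i] by metis
  then show ?thesis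
  proof cases
    case 1
    then have "dual_bases e (vector [0, 1, 0]) (vector [0, 0, 1]) (vector [1 / e $h 1, 0, 0])
        (vector [- e $h 2 / e $h 1, 1, 0]) (vector [- e $h 3 / e $h 1, 0, 1])"
      by (simp add: dual_bases_def inner_vec_def sum_3 forall_3 vector_3)
    then show ?thesis by blast
  next
    case 2
    then have "dual_bases e (vector [1, 0, 0]) (vector [0, 0, 1]) (vector [0, 1 / e $h 2, 0])
        (vector [1, - e $h 1 / e $h 2, 0]) (vector [0, - e $h 3 / e $h 2, 1])"
      by (simp add: dual_bases_def inner_vec_def sum_3 forall_3 vector_3)
    then show ?thesis by blast
  next
    case 3
    then have "dual_bases e (vector [1, 0, 0]) (vector [0, 1, 0]) (vector [0, 0, 1 / e $h 3])
        (vector [1, 0, - e $h 1 / e $h 3]) (vector [0, 1, - e $h 2 / e $h 3])"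
      by (simp add: dual_bases_def inner_vec_def sum_3 forall_3 vector_3)
    then show ?thesis by blast
  qed
qed

section \<open>Complex conjugation of projective points\<close>

lemma conj_point_eq: "conj_point P = vconj ` P"
  by (simp add: conj_point_def vconj_def[abs_def])

lemma vconj_vconj [simp]: "vconj (vconj v) = v"
  by (simp add: vconj_def Finite_Cartesian_Product.vec_eq_iff)

lemma conj_point_conj_point: "conj_point (conj_point P) = P"
  by (simp add: conj_point_eq image_image)

lemma vconj_smult: "vconj (c *s v) = cnj c *s vconj v"
  by (simp add: vconj_def Finite_Cartesian_Product.vec_eq_iff)

lemma conj_point_real:
  assumes "P \<in> real_points"
  shows "conj_point P = P"
proof -
  obtain w where w: "P \<in> proj_plane" "cvec w \<in> P" using assms by (auto simp: real_points_def)
  have sub: "vconj v \<in> P" if v: "v \<in> P" for v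
  proof -
    obtain c where "c \<noteq> 0" "v = c *s cvec w" using proj_plane_mem(2)[OF w] v by blast
    then show ?thesis
      unfolding proj_plane_mem(2)[OF w] by (intro exI[of _ "cnj c"]) (simp add: vconj_smult)
  qed
  show ?thesis
    unfolding conj_point_eq
  proof
    show "P \<subseteq> vconj ` P"
    proof
      fix v assume "v \<in> P"
      then have "vconj (vconj v) \<in> vconj ` P" using sub by blast
      then show "v \<in> vconj ` P" by simp
    qed
  qed (use sub in blast)
qed

lemma homogeneous_pconj: "homogeneous n (pconj h) \<longleftrightarrow> homogeneous n h"
  by (simp add: homogeneous_def keys_pconj)

lemma cvec_add: "cvec (v + w) = cvec v + cvec w"
  and cvec_scaleR: "cvec (r *\<^sub>R v) = complex_of_real r *s cvec v"
  by (simp_all add: Finite_Cartesian_Product.vec_eq_iff cvec_nth)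

lemma section_at_pderiv: "section_at s (pderiv Q) = pderiv (section_at s Q)"
  for Q :: "complex poly poly"
  by (rule poly_eqI) (simp add: coeff_pderiv flip: of_nat_Suc)

text \<open>Together with the data of the theorem a chart is fixed: \<kappa>, \<mu> and \<nu> read
  off the coordinates along \<open>e\<close>, \<open>p\<close> and \<open>q\<close>, and \<nu> = 0
  is the line at infinity.\<close>

locale conjugate_splitting =
  fixes d :: nat and f g :: "real poly3" and e :: "real^3"
    and S :: "(complex^3) set set" and a :: "complex poly3 Matrix.vec" and p q \<kappa> \<mu> \<nu> :: "real^3"
  assumes d: "d \<ge> 1"
    and hom: "homogeneous d f"
    and hyp: "hyperbolic f e"
    and fe: "peval f e > 0"
    and g: "g = Const (e $h 1) * pdiff 1 f + Const (e $h 2) * pdiff 2 f + Const (e $h 3) * pdiff 3 f"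
    and finZ: "finite (zeros (cpoly f) \<inter> zeros (cpoly g))"
    and cardZ: "card (zeros (cpoly f) \<inter> zeros (cpoly g)) = d * (d - 1)"
    and split: "zeros (cpoly f) \<inter> zeros (cpoly g) = S \<union> conj_point ` S"
    and disj: "S \<inter> conj_point ` S = {}"
    and dim: "dim_vec a = d"
    and basis: "list_basis (list_of_vec a) (forms_vanishing_on (d - 1) S)"
    and a0: "vec_index a 0 = cpoly g"
    and dual: "dual_bases e p q \<kappa> \<mu> \<nu>"
begin

definition rpt :: "real \<Rightarrow> real \<Rightarrow> real^3" where
  "rpt t s = t *\<^sub>R e + s *\<^sub>R p + q"

lemma chart_point_real: "chart_point e p q (complex_of_real t) (complex_of_real s) = cvec (rpt t s)"
  by (simp add: chart_point_def rpt_def cvec_add cvec_scaleR)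

lemma a_mem: assumes "j < d" shows "vec_index a j \<in> forms_vanishing_on (d - 1) S"
proof -
  have "vec_index a j \<in> set (list_of_vec a)"
    using assms dim by (metis in_set_conv_nth length_list_of_vec list_of_vec_index)
  moreover have "set (list_of_vec a) \<subseteq> cpoly_space.span (set (list_of_vec a))"
    by (rule cpoly_space.span_superset)
  ultimately show ?thesis using basis by (auto simp: list_basis_def)
qed

lemma hom_a: "j < d \<Longrightarrow> homogeneous (d - 1) (vec_index a j)"
  using a_mem by (auto simp: forms_vanishing_on_def)

lemma hom_g: "homogeneous (d - 1) (cpoly g)"
  using hom_a[of 0] d a0 by simp

lemma hom_f: "homogeneous d (cpoly f)"
  using hom by (simp add: homogeneous_cpoly)

lemma a_vanish: "j < d \<Longrightarrow> P \<in> S \<Longrightarrow> v \<in> P \<Longrightarrow> peval (vec_index a j) v = 0"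
  using a_mem by (fastforce simp: forms_vanishing_on_def zeros_def)

lemma no_real: "P \<in> zeros (cpoly f) \<Longrightarrow> P \<in> zeros (cpoly g) \<Longrightarrow> P \<notin> real_points"
proof
  assume P: "P \<in> zeros (cpoly f)" "P \<in> zeros (cpoly g)" "P \<in> real_points"
  then have c: "conj_point P = P" by (intro conj_point_real)
  have "P \<in> S \<or> P \<in> conj_point ` S" using P split by blast
  then have "P \<in> S \<and> P \<in> conj_point ` S"
    using c by (metis conj_point_conj_point image_iff)
  then show False using disj by blast
qed

lemma peval_cpoly_g:
  "peval (cpoly g) v = (\<Sum>i\<in>UNIV. complex_of_real (e $h i) * peval (pdiff i (cpoly f)) v)"
proof -
  \<comment> \<open>Values at real points determine the polynomial; the resulting identity can then
    be evaluated at complex points.\<close>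
  have "cpoly g = (\<Sum>i\<in>UNIV. Const (complex_of_real (e $h i)) * pdiff i (cpoly f))"
  proof (rule poly3_eqI)
    fix v
    have "monom_at (cvec v) m = complex_of_real (monom_at v m)" for m
      by (simp add: monom_at_def cvec_nth)
    then have "peval (pdiff i (cpoly f)) (cvec v) = complex_of_real (peval (pdiff i f) v)" for i
      by (simp add: peval_pdiff keys_cpoly lookup_cpoly)
    then show "peval (cpoly g) (cvec v) = peval (\<Sum>i\<in>UNIV. Const (complex_of_real (e $h i)) * pdiff i (cpoly f)) (cvec v)"
      by (simp add: peval_cpoly g peval_add peval_mult peval_sum sum_3)
  qed
  then show ?thesis by (simp add: peval_sum peval_mult)
qed

definition F where "F = chart_poly e p q (cpoly f)"
definition G where "G = chart_poly e p q (cpoly g)"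

lemma bpoly_F: "bpoly F t s = peval (cpoly f) (chart_point e p q t s)"
  by (simp add: F_def bpoly_chart_poly)

lemma bpoly_G: "bpoly G t s = peval (cpoly g) (chart_point e p q t s)"
  by (simp add: G_def bpoly_chart_poly)

lemma G_eq_pderiv: "bpoly G t s = poly (pderiv (section_at s F)) t"
proof -
  have "bpoly G t s = bpoly (pderiv F) t s"
    by (simp add: bpoly_G peval_cpoly_g F_def bpoly_pderiv_chart_poly)
  then show ?thesis by (simp add: poly_section_at flip: section_at_pderiv)
qed

lemma total_degree_F: "total_degree_le d F" and total_degree_G: "total_degree_le (d - 1) G"
  using total_degree_le_chart_poly hom_f hom_g by (auto simp: F_def G_def)

lemma coeff_F: "coeff F d = [:complex_of_real (peval f e):]"
  using coeff_chart_poly_top[OF hom_f] by (simp add: F_def peval_cpoly)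

text \<open>The complex linear extension of a real coordinate functional, hence bilinear and without
  conjugation.\<close>

definition cdot :: "real^3 \<Rightarrow> complex^3 \<Rightarrow> complex" where
  "cdot u v = (\<Sum>i\<in>UNIV. complex_of_real (u $h i) * v $h i)"

lemma cdot_simps:
  "cdot u (v + w) = cdot u v + cdot u w" "cdot u (c *s v) = c * cdot u v"
  "cdot u (cvec x) = complex_of_real (u \<bullet> x)"
  by (simp_all add: cdot_def sum.distrib distrib_left sum_distrib_left mult.left_commute cvec_nth inner_vec_def)

lemma decompose: "v = cdot \<kappa> v *s cvec e + cdot \<mu> v *s cvec p + cdot \<nu> v *s cvec q"
proof -
  have "(cdot \<kappa> v *s cvec e + cdot \<mu> v *s cvec p + cdot \<nu> v *s cvec q) $h k = v $h k" for k
  proof -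
    have "(cdot \<kappa> v *s cvec e + cdot \<mu> v *s cvec p + cdot \<nu> v *s cvec q) $h k
      = (\<Sum>i\<in>UNIV. complex_of_real (\<kappa> $h i * e $h k + \<mu> $h i * p $h k + \<nu> $h i * q $h k) * v $h i)"
      by (simp add: cdot_def cvec_nth sum_3 algebra_simps)
    also have "\<dots> = (\<Sum>i\<in>UNIV. if i = k then v $h k else 0)"
      using dual by (intro sum.cong refl) (simp add: dual_bases_def)
    finally show ?thesis by simp
  qed
  then show ?thesis by (simp add: Finite_Cartesian_Product.vec_eq_iff)
qed

lemma cdot_chart:
  "cdot \<kappa> (chart_point e p q t s) = t" "cdot \<mu> (chart_point e p q t s) = s" "cdot \<nu> (chart_point e p q t s) = 1"
  using dual by (simp_all add: chart_point_def cdot_simps dual_bases_def)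

definition X where "X = {(t, s). bpoly F t s = 0 \<and> bpoly G t s = 0}"

lemma chart_point_nonzero: "chart_point e p q t s \<noteq> 0"
  using cdot_chart(3)[of t s] by (auto simp: cdot_def)

lemma mem_Z_iff:
  assumes "P \<in> proj_plane" "v \<in> P"
  shows "P \<in> zeros (cpoly f) \<inter> zeros (cpoly g) \<longleftrightarrow> peval (cpoly f) v = 0 \<and> peval (cpoly g) v = 0"
  using zeros_mem_iff[OF hom_f assms] zeros_mem_iff[OF hom_g assms] by blast

text \<open>Surjectivity is the point. An intersection point with \<nu> = 0 lies on the real line
  through \<open>e\<close> and \<open>p\<close>, so hyperbolicity makes it real, which
  \<open>no_real\<close> excludes.\<close>

lemma bij_X: "bij_betw (\<lambda>(t, s). proj_rel `` {chart_point e p q t s}) X (zeros (cpoly f) \<inter> zeros (cpoly g))"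
proof -
  let ?pt = "\<lambda>t s. proj_rel `` {chart_point e p q t s}"
  have pt: "?pt t s \<in> proj_plane" "chart_point e p q t s \<in> ?pt t s" for t s
    using chart_point_nonzero[of t s] equiv_class_self[OF equiv_proj_rel]
    by (auto simp: proj_plane_def quotient_def)
  show ?thesis
  proof (rule bij_betwI')
    fix x y assume "x \<in> X" "y \<in> X"
    obtain t s t' s' where xy: "x = (t, s)" "y = (t', s')" by (cases x, cases y)
    show "((\<lambda>(t, s). ?pt t s) x = (\<lambda>(t, s). ?pt t s) y) = (x = y)"
    proof
      assume "(\<lambda>(t, s). ?pt t s) x = (\<lambda>(t, s). ?pt t s) y"
      then have "chart_point e p q t' s' \<in> ?pt t s" using pt(2)[of t' s'] xy by simp
      then obtain c where c: "chart_point e p q t' s' = c *s chart_point e p q t s"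
        using proj_plane_mem(2)[OF pt] by blast
      have "c = 1" using arg_cong[OF c, of "cdot \<nu>"] by (simp add: cdot_simps cdot_chart)
      then show "x = y"
        using arg_cong[OF c, of "cdot \<kappa>"] arg_cong[OF c, of "cdot \<mu>"] xy by (simp add: cdot_simps cdot_chart)
    qed simp
  next
    fix x assume x: "x \<in> X"
    obtain t s where ts: "x = (t, s)" by (cases x)
    show "(\<lambda>(t, s). ?pt t s) x \<in> zeros (cpoly f) \<inter> zeros (cpoly g)"
      using x ts mem_Z_iff[OF pt, of t s] by (simp add: X_def bpoly_F bpoly_G)
  next
    fix P assume P: "P \<in> zeros (cpoly f) \<inter> zeros (cpoly g)"
    then have plane: "P \<in> proj_plane" by (simp add: zeros_def)
    obtain v where v: "v \<in> P"
      using plane equiv_class_self[OF equiv_proj_rel] by (auto simp: proj_plane_def quotient_def)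
    have nz: "cdot \<nu> v \<noteq> 0"
    proof
      assume "cdot \<nu> v = 0"
      then have "v = cdot \<kappa> v *s cvec e + cdot \<mu> v *s cvec p" using decompose[of v] by simp
      then have "cdot \<kappa> v *s cvec e + cdot \<mu> v *s cvec p \<in> P" using v by metis
      then have "P \<in> real_line e p" using plane unfolding real_line_def by blast
      moreover have "p \<notin> span {e}"
        using dual by (auto simp: span_singleton dual_bases_def)
      ultimately have "P \<in> real_points" using hyp P by (auto simp: hyperbolic_def)
      then show False using no_real P by blast
    qed
    define t s where "t = cdot \<kappa> v / cdot \<nu> v" and "s = cdot \<mu> v / cdot \<nu> v"
    have eq: "v = cdot \<nu> v *s chart_point e p q t s"
      using decompose[of v] nz
      by (simp add: chart_point_def t_def s_def vector_add_ldistrib vector_smult_assoc)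
    then have v': "v \<in> ?pt t s" using proj_plane_mem(2)[OF pt] nz by blast
    then have "chart_point e p q t s \<in> P"
      using proj_plane_mem(2)[OF pt, of v t s] proj_plane_mem(2)[OF plane v, of "chart_point e p q t s"] eq nz
      by (metis divide_eq_0_iff nonzero_divide_eq_eq one_neq_zero vector_smult_assoc vector_smult_lid)
    then have "P = ?pt t s"
      using proj_plane_mem(2)[OF plane, of "chart_point e p q t s"] proj_plane_mem(2)[OF pt, of _ t s] by blast
    moreover have "(t, s) \<in> X"
      using P mem_Z_iff[OF plane \<open>chart_point e p q t s \<in> P\<close>] by (simp add: X_def bpoly_F bpoly_G)
    ultimately show "\<exists>x\<in>X. P = (\<lambda>(t, s). ?pt t s) x" by force
  qed
qed

lemma finite_X: "finite X" and card_X: "card X = d * (d - 1)"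
  using bij_betw_finite[OF bij_X] bij_betw_same_card[OF bij_X] finZ cardZ by auto

lemma F_real_root: "bpoly F t (complex_of_real s) = 0 \<Longrightarrow> t \<in> \<real>"
proof -
  assume "bpoly F t (complex_of_real s) = 0"
  then have "peval (cpoly f) (t *s cvec e + cvec (s *\<^sub>R p + q)) = 0"
    by (simp add: bpoly_F chart_point_def cvec_add cvec_scaleR add.assoc)
  then show "t \<in> \<real>" using hyp hyperbolic_iff_real_rooted[OF hom d, of e] by blast
qed

lemma F_simple_root:
  assumes "bpoly F t (complex_of_real s) = 0"
  shows "bpoly G t (complex_of_real s) \<noteq> 0"
proof
  assume G0: "bpoly G t (complex_of_real s) = 0"
  obtain r where r: "t = complex_of_real r" using F_real_root[OF assms] by (auto elim: Reals_cases)
  obtain P where P: "P \<in> proj_plane" "cvec (rpt r s) \<in> P"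
    using proj_plane_ex[of "cvec (rpt r s)"] chart_point_nonzero by (metis chart_point_real)
  have "P \<in> zeros (cpoly f) \<inter> zeros (cpoly g)"
    using mem_Z_iff[OF P] assms G0 by (simp add: r bpoly_F bpoly_G chart_point_real)
  moreover have "P \<in> real_points" using P by (auto simp: real_points_def)
  ultimately show False using no_real by blast
qed

lemma real_roots_exist:
  "\<exists>r :: nat \<Rightarrow> real. inj_on r {..<d} \<and>
     section_at (complex_of_real s) F = smult (complex_of_real (peval f e)) (\<Prod>w\<in>(\<lambda>i. complex_of_real (r i)) ` {..<d}. [:-w, 1:])"
proof -
  let ?P = "section_at (complex_of_real s) F"
  let ?T = "{z. poly ?P z = 0}"
  have cd: "coeff ?P d = complex_of_real (peval f e)" by (simp add: coeff_F)
  moreover have "degree ?P \<le> d"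
    using degree_section_at_le[of _ F] total_degree_le_imp_degree[OF total_degree_F] le_trans by blast
  ultimately have deg: "degree ?P = d" and lc: "lead_coeff ?P = complex_of_real (peval f e)"
    using fe le_degree[of ?P d] by auto
  have nz: "?P \<noteq> 0" using cd fe by (metis coeff_0 of_real_eq_0_iff order_less_irrefl)
  have "rsquarefree ?P"
    unfolding rsquarefree_roots
  proof (intro allI notI)
    fix t assume "poly ?P t = 0 \<and> poly (pderiv ?P) t = 0"
    then show False using F_simple_root[of t s] by (simp add: poly_section_at G_eq_pderiv)
  qed
  then have eq: "?P = smult (complex_of_real (peval f e)) (\<Prod>w\<in>?T. [:-w, 1:])"
    using complex_poly_decompose_rsquarefree[of ?P] lc by simp
  have finT: "finite ?T" by (rule poly_roots_finite[OF nz])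
  have "d = degree (\<Prod>w\<in>?T. [:-w, 1:])"
    using deg fe by (subst (asm) eq) simp
  also have "\<dots> = card ?T" by (subst degree_prod_eq_sum_degree) auto
  finally have "card ?T = d" ..
  then obtain h where h: "bij_betw h {0..<d} ?T" using ex_bij_betw_nat_finite[OF finT] by blast
  define r where "r = (\<lambda>i. Re (h i))"
  have rh: "complex_of_real (r i) = h i" if "i < d" for i
  proof -
    have "h i \<in> ?T" using h that by (auto simp: bij_betw_def)
    then have "h i \<in> \<real>" using F_real_root by (simp add: poly_section_at)
    then show ?thesis by (simp add: r_def)
  qed
  then have "(\<lambda>i. complex_of_real (r i)) ` {..<d} = h ` {..<d}" by (intro image_cong) auto
  also have "\<dots> = ?T" using h by (simp add: bij_betw_def lessThan_atLeast0)
  finally have "(\<lambda>i. complex_of_real (r i)) ` {..<d} = ?T" .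
  moreover have "inj_on r {..<d}"
    using h rh by (auto simp: inj_on_def bij_betw_def) (metis atLeastLessThan_iff le0 lessThan_iff)
  ultimately show ?thesis using eq by metis
qed

end


section \<open>Traces over the points of a real line\<close>

context conjugate_splitting
begin

text \<open>The enumeration is chosen separately for each \<open>s\<close>, with no continuity in
  \<open>s\<close>. This is harmless because comparisons between lines involve only sums over all
  roots.\<close>

definition lroot :: "real \<Rightarrow> nat \<Rightarrow> real" where
  "lroot s = (SOME r. inj_on r {..<d} \<and> section_at (complex_of_real s) F =
     smult (complex_of_real (peval f e)) (\<Prod>w\<in>(\<lambda>i. complex_of_real (r i)) ` {..<d}. [:-w, 1:]))"

lemma lroot_inj: "inj_on (lroot s) {..<d}"
  and section_F: "section_at (complex_of_real s) F =
     smult (complex_of_real (peval f e)) (\<Prod>w\<in>(\<lambda>i. complex_of_real (lroot s i)) ` {..<d}. [:-w, 1:])"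
  using someI_ex[OF real_roots_exist[of s], folded lroot_def] by (rule conjunct1, rule conjunct2)

abbreviation roots :: "real \<Rightarrow> complex set" where
  "roots s \<equiv> (\<lambda>i. complex_of_real (lroot s i)) ` {..<d}"

lemma inj_roots: "inj_on (\<lambda>i. complex_of_real (lroot s i)) {..<d}"
  using lroot_inj by (auto simp: inj_on_def)

lemma card_roots: "card (roots s) = d"
  using card_image[OF inj_roots] by simp

definition zero_pt :: "real \<Rightarrow> nat \<Rightarrow> real^3" where
  "zero_pt s i = rpt (lroot s i) s"

definition gval :: "real \<Rightarrow> nat \<Rightarrow> real" where
  "gval s i = peval g (zero_pt s i)"

text \<open>The restriction of \<open>f\<close> to the line, divided by its \<open>i\<close>-th linear factor.\<close>

definition cofactor_f :: "real \<Rightarrow> nat \<Rightarrow> real \<Rightarrow> real" where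
  "cofactor_f s i t = peval f e * (\<Prod>k\<in>{..<d} - {i}. t - lroot s k)"

lemma roots_diff: "i < d \<Longrightarrow> roots s - {complex_of_real (lroot s i)} = (\<lambda>i. complex_of_real (lroot s i)) ` ({..<d} - {i})"
  using inj_on_image_set_diff[OF inj_roots, of "{..<d}" "{i}" s] by simp

lemma prod_roots_diff:
  "i < d \<Longrightarrow> (\<Prod>w\<in>roots s - {complex_of_real (lroot s i)}. h w) = (\<Prod>k\<in>{..<d} - {i}. h (complex_of_real (lroot s k)))"
  unfolding roots_diff by (rule prod.reindex_cong[OF inj_on_subset[OF inj_roots]]) auto

lemma f_at: "peval f (rpt t s) = peval f e * (\<Prod>i<d. t - lroot s i)"
proof -
  have "complex_of_real (peval f (rpt t s)) = poly (section_at (complex_of_real s) F) (complex_of_real t)"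
    by (simp add: poly_section_at bpoly_F chart_point_real peval_cpoly)
  also have "\<dots> = complex_of_real (peval f e * (\<Prod>i<d. t - lroot s i))"
    unfolding section_F by (simp add: poly_prod prod.reindex[OF inj_roots])
  finally show ?thesis by (simp only: of_real_eq_iff)
qed

lemma cofactor_f_mult: "i < d \<Longrightarrow> cofactor_f s i t * (t - lroot s i) = peval f (rpt t s)"
  by (simp add: cofactor_f_def f_at prod.remove[of "{..<d}" i] mult_ac)

lemma bpoly_G_root: "bpoly G (complex_of_real (lroot s i)) (complex_of_real s) = complex_of_real (gval s i)"
  by (simp add: bpoly_G chart_point_real peval_cpoly gval_def zero_pt_def)

lemma gval_nonzero: "i < d \<Longrightarrow> gval s i \<noteq> 0"
proof -
  assume i: "i < d"
  have "bpoly F (complex_of_real (lroot s i)) (complex_of_real s) = 0"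
    using i by (simp add: bpoly_F chart_point_real peval_cpoly f_at) (auto intro!: prod_zero)
  then have "bpoly G (complex_of_real (lroot s i)) (complex_of_real s) \<noteq> 0" by (rule F_simple_root)
  then show ?thesis by (simp add: bpoly_G_root)
qed

text \<open>A form of degree \<open>d - 1\<close> restricts to a polynomial in \<open>t\<close> of
  degree below \<open>d\<close>, so its values at the \<open>d\<close> zeros of \<open>f\<close>
  determine it; the derivatives in Lagrange's formula are the values of \<open>g\<close>.\<close>

lemma interpolation:
  assumes h: "homogeneous (d - 1) h"
  shows "peval h (cvec (rpt t s)) =
    (\<Sum>i<d. peval h (cvec (zero_pt s i)) / complex_of_real (gval s i) * complex_of_real (cofactor_f s i t))"
proof -
  define U where "U = section_at (complex_of_real s) (chart_poly e p q h)"
  let ?P = "section_at (complex_of_real s) F"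
  let ?c = "complex_of_real (peval f e)"
  have Uval: "poly U (complex_of_real x) = peval h (cvec (rpt x s))" for x
    by (simp add: U_def poly_section_at bpoly_chart_poly chart_point_real)
  have deg: "degree U < card (roots s)"
    using degree_section_at_le[of "complex_of_real s" "chart_poly e p q h"]
      total_degree_le_imp_degree[OF total_degree_le_chart_poly[OF h, of e p q]] d
    by (simp add: card_roots U_def)
  have c: "?c \<noteq> 0" using fe by simp
  have "U = (\<Sum>z\<in>roots s. smult (poly U z / poly (pderiv ?P) z) (smult ?c (\<Prod>w\<in>roots s - {z}. [:-w, 1:])))"
    using lagrange_interpolation[OF _ c deg] unfolding section_F by simp
  from arg_cong[OF this, of "\<lambda>p. poly p (complex_of_real t)"]
  have "poly U (complex_of_real t)
      = (\<Sum>z\<in>roots s. poly U z / poly (pderiv ?P) z * (?c * (\<Prod>w\<in>roots s - {z}. complex_of_real t - w)))"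
    by (simp only: poly_sum poly_smult poly_prod poly_pCons poly_0 mult_zero_right add_0_right mult_1_right)
       (simp only: add.commute[of "- _"] add_uminus_conv_diff)
  also have "\<dots> = (\<Sum>i<d. poly U (complex_of_real (lroot s i)) / poly (pderiv ?P) (complex_of_real (lroot s i)) *
      (?c * (\<Prod>w\<in>roots s - {complex_of_real (lroot s i)}. complex_of_real t - w)))"
    by (simp add: sum.reindex[OF inj_roots])
  also have "\<dots> = (\<Sum>i<d. peval h (cvec (zero_pt s i)) / complex_of_real (gval s i) * complex_of_real (cofactor_f s i t))"
  proof (rule sum.cong[OF refl])
    fix i assume "i \<in> {..<d}"
    then have i: "i < d" by simp
    have "poly (pderiv ?P) (complex_of_real (lroot s i)) = complex_of_real (gval s i)"
      by (simp only: G_eq_pderiv[symmetric] bpoly_G_root)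
    moreover have "?c * (\<Prod>w\<in>roots s - {complex_of_real (lroot s i)}. complex_of_real t - w) = complex_of_real (cofactor_f s i t)"
      by (simp add: prod_roots_diff[OF i] cofactor_f_def)
    ultimately show "poly U (complex_of_real (lroot s i)) / poly (pderiv ?P) (complex_of_real (lroot s i)) *
        (?c * (\<Prod>w\<in>roots s - {complex_of_real (lroot s i)}. complex_of_real t - w))
      = peval h (cvec (zero_pt s i)) / complex_of_real (gval s i) * complex_of_real (cofactor_f s i t)"
      by (simp only: Uval zero_pt_def)
  qed
  finally show ?thesis by (simp only: Uval)
qed

definition aval :: "nat \<Rightarrow> real^3 \<Rightarrow> complex" where
  "aval j v = peval (vec_index a j) (cvec v)"

lemma trace_exists:
  assumes j: "j < d" and k: "k < d"
  shows "\<exists>P r. degree r \<le> 1 \<and> (\<forall>s.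
      (\<Sum>i<d. cnj (aval j (zero_pt s i)) * aval k (zero_pt s i) / (complex_of_real (gval s i))\<^sup>2) = P \<and>
      (\<Sum>i<d. complex_of_real (lroot s i) * (cnj (aval j (zero_pt s i)) * aval k (zero_pt s i)) / (complex_of_real (gval s i))\<^sup>2)
        = poly r (complex_of_real s))"
proof -
  define H where "H = chart_poly e p q (pconj (vec_index a j)) * chart_poly e p q (vec_index a k)"
  have tH: "total_degree_le (2 * d - 2) H"
  proof -
    have "total_degree_le ((d - 1) + (d - 1)) H"
      unfolding H_def using hom_a[OF j] hom_a[OF k]
      by (intro total_degree_le_mult total_degree_le_chart_poly) (simp_all add: homogeneous_pconj)
    moreover have "(d - 1) + (d - 1) = 2 * d - 2" by simp
    ultimately show ?thesis by metis
  qed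
  \<comment> \<open>A point of \<open>S\<close> is a zero of the factor from \<open>k\<close>; a
    point of the conjugate of \<open>S\<close> is a zero of the conjugated factor from
    \<open>j\<close>.\<close>
  have HX: "bpoly H t s = 0" if "(t, s) \<in> X" for t s
  proof -
    let ?v = "chart_point e p q t s"
    obtain P where P: "P \<in> proj_plane" "?v \<in> P" using proj_plane_ex[OF chart_point_nonzero] .
    have "P \<in> zeros (cpoly f) \<inter> zeros (cpoly g)"
      using mem_Z_iff[OF P] that by (simp add: X_def bpoly_F bpoly_G)
    then consider "P \<in> S" | P' where "P = conj_point P'" "P' \<in> S" using split by blast
    then have "peval (pconj (vec_index a j)) ?v = 0 \<or> peval (vec_index a k) ?v = 0"
    proof cases
      case 1
      then show ?thesis using a_vanish[OF k _ P(2)] by simp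
    next
      case 2
      then obtain w where "w \<in> P'" "?v = vconj w" using P(2) by (auto simp: conj_point_eq)
      then show ?thesis using a_vanish[OF j 2(2)] by (simp add: peval_pconj_vconj)
    qed
    then show ?thesis by (auto simp: H_def bpoly_chart_poly)
  qed
  let ?c = "complex_of_real (peval f e)"
  have c: "?c \<noteq> 0" using fe by simp
  \<comment> \<open>The real line \<open>s = 0\<close> supplies the \<open>d\<close> zeros of
    \<open>F\<close> off \<open>G\<close> on which the nonvanishing of the Sylvester determinant
    rests.\<close>
  have T: "bpoly F t 0 = 0" "bpoly G t 0 \<noteq> 0" if t: "t \<in> roots 0" for t
  proof -
    have "poly (section_at (complex_of_real 0) F) t = 0" unfolding section_F using t by (auto simp: poly_prod intro!: prod_zero)
    then show 1: "bpoly F t 0 = 0" by (simp add: poly_section_at)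
    show "bpoly G t 0 \<noteq> 0" using F_simple_root[of t 0] 1 by simp
  qed
  obtain A B where AB: "H = A * F + B * G" "total_degree_le (d - 1) B"
    using vanishing_on_intersection_imp_combination[OF d total_degree_F total_degree_G tH coeff_F c X_def finite_X card_X HX
        _ card_roots T, of 0] by auto
  obtain P r where Pr: "degree r \<le> 1" and tr: "\<forall>s T. finite T \<longrightarrow> card T = d \<longrightarrow>
      section_at s F = smult ?c (\<Prod>w\<in>T. [:-w, 1:]) \<longrightarrow>
      (\<forall>z\<in>T. bpoly G z s = poly (pderiv (section_at s F)) z) \<longrightarrow>
      (\<Sum>z\<in>T. bpoly H z s / (bpoly G z s)\<^sup>2) = P \<and>
      (\<Sum>z\<in>T. z * bpoly H z s / (bpoly G z s)\<^sup>2) = poly r s"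
    using trace_constant_and_affine[OF d total_degree_F AB(2) coeff_F c AB(1)]
    by (elim exE conjE) (rule that)
  have Hval: "bpoly H (complex_of_real (lroot s i)) (complex_of_real s) = cnj (aval j (zero_pt s i)) * aval k (zero_pt s i)" for s i
    by (simp add: H_def bpoly_chart_poly chart_point_real peval_pconj aval_def zero_pt_def)
  have "(\<Sum>i<d. cnj (aval j (zero_pt s i)) * aval k (zero_pt s i) / (complex_of_real (gval s i))\<^sup>2) = P \<and>
      (\<Sum>i<d. complex_of_real (lroot s i) * (cnj (aval j (zero_pt s i)) * aval k (zero_pt s i)) / (complex_of_real (gval s i))\<^sup>2)
        = poly r (complex_of_real s)" for s
  proof -
    have "\<forall>z\<in>roots s. bpoly G z (complex_of_real s) = poly (pderiv (section_at (complex_of_real s) F)) z"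
      using G_eq_pderiv by blast
    from tr[rule_format, OF _ card_roots section_F] this have
      "(\<Sum>z\<in>roots s. bpoly H z (complex_of_real s) / (bpoly G z (complex_of_real s))\<^sup>2) = P \<and>
       (\<Sum>z\<in>roots s. z * bpoly H z (complex_of_real s) / (bpoly G z (complex_of_real s))\<^sup>2) = poly r (complex_of_real s)"
      by blast
    then show ?thesis by (simp add: sum.reindex[OF inj_roots] Hval bpoly_G_root)
  qed
  then show ?thesis using Pr by blast
qed

end


section \<open>Matrix pencils and Gram matrices\<close>

text \<open>The chart misses the plane \<nu> = 0. A line in direction \<open>w\<close> meets this
  plane in a single point, so along each such line the difference has infinitely many zeros and
  vanishes.\<close>

lemma poly3_eqI_off_plane:
  fixes P Q :: "complex poly3" and \<nu> w :: "real^3"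
  assumes w: "\<nu> \<bullet> w \<noteq> 0" and eq: "\<And>v. \<nu> \<bullet> v \<noteq> 0 \<Longrightarrow> peval P (cvec v) = peval Q (cvec v)"
  shows "P = Q"
proof -
  have "peval (P - Q) (cvec v) = 0" for v
  proof -
    \<comment> \<open>A chart with second direction 0 serves to restrict to the line through
      \<open>v\<close> in direction \<open>w\<close> as a polynomial in one variable.\<close>
    define U where "U = section_at 0 (chart_poly w 0 v (P - Q))"
    define u0 where "u0 = - (\<nu> \<bullet> v) / (\<nu> \<bullet> w)"
    have U: "poly U (complex_of_real u) = peval (P - Q) (cvec (u *\<^sub>R w + v))" for u
      by (simp add: U_def poly_section_at bpoly_chart_poly chart_point_def cvec_add cvec_scaleR)
    have "poly U (complex_of_real u) = 0" if "u \<noteq> u0" for u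
    proof -
      have "\<nu> \<bullet> (u *\<^sub>R w + v) \<noteq> 0"
      proof
        assume "\<nu> \<bullet> (u *\<^sub>R w + v) = 0"
        then have "u * (\<nu> \<bullet> w) = - (\<nu> \<bullet> v)" by (simp add: inner_add_right)
        moreover have "u = u * (\<nu> \<bullet> w) / (\<nu> \<bullet> w)" using w by simp
        ultimately have "u = u0" by (simp only: u0_def)
        with that show False by contradiction
      qed
      then show ?thesis using eq unfolding U by (simp add: peval_diff)
    qed
    then have "complex_of_real ` (UNIV - {u0}) \<subseteq> {x. poly U x = 0}" by auto
    moreover have "infinite (complex_of_real ` (UNIV - {u0}))"
    proof
      assume "finite (complex_of_real ` (UNIV - {u0}))"
      then have "finite (UNIV - {u0})" by (rule finite_imageD) (simp add: inj_on_def)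
      then have "finite (UNIV :: real set)" by simp
      with infinite_UNIV_char_0[where 'a = real] show False by contradiction
    qed
    ultimately have inf: "infinite {x. poly U x = 0}" by (rule infinite_super)
    have "U = 0"
    proof (rule ccontr)
      assume "U \<noteq> 0"
      from poly_roots_finite[OF this] inf show False by contradiction
    qed
    then show ?thesis using U[of 0] by simp
  qed
  then have "P - Q = 0" by (rule poly3_eq_0I)
  then show ?thesis by simp
qed

lemma pencil_at_carrier: "(\<And>i. M i \<in> carrier_mat n n) \<Longrightarrow> pencil_at M v \<in> carrier_mat n n"
  by (simp add: pencil_at_def)

lemma pencil_at_index:
  assumes "\<And>i. M i \<in> carrier_mat n n" "j < n" "k < n"
  shows "pencil_at M v $$ (j, k) = (\<Sum>i\<in>UNIV. complex_of_real (v $h i) * M i $$ (j, k))"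
  using assms(2,3) assms(1)[of 1] assms(1)[of 2] assms(1)[of 3] by (simp add: pencil_at_def sum_3)

lemma pencil_carrier: "(\<And>i. M i \<in> carrier_mat n n) \<Longrightarrow> pencil M \<in> carrier_mat n n"
  by (simp add: pencil_def)

lemma map_mat_peval_pencil:
  assumes "\<And>i. M i \<in> carrier_mat n n"
  shows "map_mat (\<lambda>p. peval p (cvec v)) (pencil M) = pencil_at M v"
  using assms[of 1] assms[of 2] assms[of 3]
  by (intro eq_matI) (simp_all add: pencil_def pencil_at_def peval_add peval_mult cvec_nth)

lemma peval_pencil_index:
  assumes "\<And>i. M i \<in> carrier_mat n n" "j < n" "k < n"
  shows "peval (pencil M $$ (j, k)) (cvec v) = pencil_at M v $$ (j, k)"
  using pencil_carrier[of M n, OF assms(1)] assms(2,3) by (simp flip: map_mat_peval_pencil[of M n, OF assms(1)])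

lemma peval_det_pencil:
  assumes "\<And>i. M i \<in> carrier_mat n n"
  shows "peval (Determinant.det (pencil M)) (cvec v) = Determinant.det (pencil_at M v)"
  using comm_ring_hom.hom_det[OF comm_ring_hom_peval, of "cvec v" "pencil M"]
  by (simp add: map_mat_peval_pencil[of M n, OF assms])

lemma pencil_at_scaleR:
  assumes "\<And>i. M i \<in> carrier_mat n n"
  shows "pencil_at M (z *\<^sub>R v) = complex_of_real z \<cdot>\<^sub>m pencil_at M v"
  using assms[of 1] assms[of 2] assms[of 3]
  by (intro eq_matI) (simp_all add: pencil_at_def algebra_simps)

lemma mat_inverse_exists:
  fixes P :: "'a::field mat"
  assumes P: "P \<in> carrier_mat n n" and det: "Determinant.det P \<noteq> 0"
  shows "\<exists>Q\<in>carrier_mat n n. P * Q = 1\<^sub>m n \<and> Q * P = 1\<^sub>m n"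
proof
  let ?Q = "inverse (Determinant.det P) \<cdot>\<^sub>m adj_mat P"
  note adj = adj_mat[OF P]
  show "?Q \<in> carrier_mat n n" using adj(1) by simp
  have "P * ?Q = inverse (Determinant.det P) \<cdot>\<^sub>m (P * adj_mat P)"
    by (rule mult_smult_distrib[OF P adj(1)])
  also have "\<dots> = 1\<^sub>m n" unfolding adj(2) using det by (intro eq_matI) auto
  finally have 1: "P * ?Q = 1\<^sub>m n" .
  then show "P * ?Q = 1\<^sub>m n \<and> ?Q * P = 1\<^sub>m n"
    using mat_mult_left_right_inverse[OF P \<open>?Q \<in> carrier_mat n n\<close> 1] by simp
qed

section \<open>Adjoints and Hermitian matrices entrywise\<close>

lemma mat_adjoint_carrier: "A \<in> carrier_mat n m \<Longrightarrow> mat_adjoint A \<in> carrier_mat m n"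
  by (intro carrier_matI) (simp_all add: mat_adjoint_def)

lemma mat_adjoint_index:
  assumes "A \<in> carrier_mat n m" "i < m" "j < n"
  shows "mat_adjoint A $$ (i, j) = conjugate (A $$ (j, i))"
proof -
  have "mat_adjoint A $$ (i, j) = map conjugate (cols A) ! i $ j"
    unfolding mat_adjoint_def by (rule mat_of_rows_index) (use assms in auto)
  also have "\<dots> = conjugate (Matrix.col A i) $ j" using assms(1,2) by auto
  also have "\<dots> = conjugate (A $$ (j, i))" using assms by (subst vec_index_conjugate) auto
  finally show ?thesis .
qed

lemma hermitian_iff_index:
  assumes A: "A \<in> carrier_mat n n"
  shows "hermitian A \<longleftrightarrow> (\<forall>j<n. \<forall>k<n. A $$ (j, k) = cnj (A $$ (k, j)))"
proof
  assume h: "hermitian A"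
  show "\<forall>j<n. \<forall>k<n. A $$ (j, k) = cnj (A $$ (k, j))"
  proof (intro allI impI)
    fix j k assume "j < n" "k < n"
    then have *: "mat_adjoint A $$ (j, k) = cnj (A $$ (k, j))"
      by (simp add: mat_adjoint_index[OF A])
    have "mat_adjoint A = A" using h unfolding hermitian_def .
    from *[unfolded this] show "A $$ (j, k) = cnj (A $$ (k, j))" .
  qed
next
  assume h: "\<forall>j<n. \<forall>k<n. A $$ (j, k) = cnj (A $$ (k, j))"
  show "hermitian A"
    unfolding hermitian_def
  proof (rule eq_matI)
    fix j k assume "j < dim_row A" "k < dim_col A"
    then have jk: "j < n" "k < n" using A by auto
    have "mat_adjoint A $$ (j, k) = cnj (A $$ (k, j))" using jk by (simp add: mat_adjoint_index[OF A])
    also have "\<dots> = A $$ (j, k)" by (rule h[rule_format, OF jk, symmetric])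
    finally show "mat_adjoint A $$ (j, k) = A $$ (j, k)" .
  qed (use mat_adjoint_carrier[OF A] A in auto)
qed

section \<open>The linear system and the basis, evaluated at real points of the chart\<close>

context conjugate_splitting
begin

lemma rpt_scale:
  assumes "\<nu> \<bullet> v \<noteq> 0"
  shows "\<exists>z t s. v = z *\<^sub>R rpt t s"
proof -
  have "v = (\<kappa> \<bullet> v) *\<^sub>R e + (\<mu> \<bullet> v) *\<^sub>R p + (\<nu> \<bullet> v) *\<^sub>R q"
  proof -
    have "v $h k = ((\<kappa> \<bullet> v) *\<^sub>R e + (\<mu> \<bullet> v) *\<^sub>R p + (\<nu> \<bullet> v) *\<^sub>R q) $h k" for k
    proof -
      have "((\<kappa> \<bullet> v) *\<^sub>R e + (\<mu> \<bullet> v) *\<^sub>R p + (\<nu> \<bullet> v) *\<^sub>R q) $h k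
        = (\<Sum>i\<in>UNIV. (\<kappa> $h i * e $h k + \<mu> $h i * p $h k + \<nu> $h i * q $h k) * v $h i)"
        by (simp add: inner_vec_def sum_3 algebra_simps)
      also have "\<dots> = (\<Sum>i\<in>UNIV. if i = k then v $h k else 0)"
        using dual by (intro sum.cong refl) (simp add: dual_bases_def)
      finally show ?thesis by simp
    qed
    then show ?thesis by (simp add: Finite_Cartesian_Product.vec_eq_iff)
  qed
  then have "v = (\<nu> \<bullet> v) *\<^sub>R rpt ((\<kappa> \<bullet> v) / (\<nu> \<bullet> v)) ((\<mu> \<bullet> v) / (\<nu> \<bullet> v))"
    using assms by (simp add: rpt_def scaleR_add_right)
  then show ?thesis by blast
qed

lemma aval_scaleR: "j < d \<Longrightarrow> aval j (z *\<^sub>R v) = complex_of_real z ^ (d - 1) * aval j v"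
  by (simp add: aval_def cvec_scaleR peval_scale[OF hom_a])

lemma f_scaleR: "peval f (z *\<^sub>R v) = z ^ d * peval f v"
proof -
  have "complex_of_real (peval f (z *\<^sub>R v)) = complex_of_real (z ^ d * peval f v)"
    by (simp add: cvec_scaleR peval_scale[OF hom_f] flip: peval_cpoly)
  then show ?thesis by (simp only: of_real_eq_iff)
qed

lemma nu_q: "\<nu> \<bullet> q \<noteq> 0"
  using dual by (simp add: dual_bases_def)

lemma aval_independent:
  assumes z: "\<And>t s. (\<Sum>k<d. v k * aval k (rpt t s)) = 0" and k: "k < d"
  shows "v k = 0"
proof -
  have dist: "distinct (list_of_vec a)" and ind: "cpoly_space.independent (set (list_of_vec a))"
    using basis by (auto simp: list_basis_def)
  have inj: "inj_on (vec_index a) {..<d}"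
  proof (rule inj_onI)
    fix i j assume ij: "i \<in> {..<d}" "j \<in> {..<d}" "vec_index a i = vec_index a j"
    then have "list_of_vec a ! i = list_of_vec a ! j" by (simp add: list_of_vec_index dim)
    then show "i = j" using nth_eq_iff_index_eq[OF dist] ij dim by simp
  qed
  have set: "set (list_of_vec a) = vec_index a ` {..<d}"
    using dim by (auto simp: set_conv_nth list_of_vec_index)
  \<comment> \<open>Independence is stated for a set of polynomials; the coefficients are
    transported to it along the inverse of the injective indexing.\<close>
  define u where "u = (\<lambda>x. v (the_inv_into {..<d} (vec_index a) x))"
  have "(\<Sum>x\<in>set (list_of_vec a). pscale (u x) x) = (\<Sum>k<d. pscale (v k) (vec_index a k))"
    unfolding set sum.reindex[OF inj] by (simp add: u_def the_inv_into_f_f[OF inj])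
  also have "\<dots> = 0"
  proof (rule poly3_eqI_off_plane[OF nu_q])
    fix w assume "\<nu> \<bullet> w \<noteq> 0"
    then obtain z t s where w: "w = z *\<^sub>R rpt t s" using rpt_scale by blast
    have "peval (\<Sum>k<d. pscale (v k) (vec_index a k)) (cvec w) = (\<Sum>k<d. v k * aval k w)"
      by (simp add: peval_sum pscale_def peval_mult aval_def)
    also have "\<dots> = complex_of_real z ^ (d - 1) * (\<Sum>k<d. v k * aval k (rpt t s))"
      by (simp add: w aval_scaleR sum_distrib_left mult_ac)
    finally show "peval (\<Sum>k<d. pscale (v k) (vec_index a k)) (cvec w) = peval 0 (cvec w)" using z by simp
  qed
  finally have "u (vec_index a k) = 0"
    using cpoly_space.independentD[OF ind _ order_refl, of u "vec_index a k"] set k by auto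
  then show ?thesis using k by (simp add: u_def the_inv_into_f_f[OF inj])
qed

lemma solves_systemD:
  assumes sol: "solves_system (cpoly f) a M"
  shows "M i \<in> carrier_mat d d"
    and "k < d \<Longrightarrow> (\<Sum>j<d. aval j v * pencil_at M v $$ (j, k)) = (if k = 0 then complex_of_real (peval f v) else 0)"
    and "k < d \<Longrightarrow> (\<Sum>j<d. pencil_at M v $$ (k, j) * cnj (aval j v)) = (if k = 0 then complex_of_real (peval f v) else 0)"
proof -
  show M: "M i \<in> carrier_mat d d" for i using sol dim by (simp add: solves_system_def)
  note P = pencil_carrier[of M d, OF M]
  assume k: "k < d"
  have "(mat_of_row a * pencil M) $$ (0, k) = (if k = 0 then cpoly f else 0)"
    using sol k d dim by (simp add: solves_system_def mat_of_row_def)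
  moreover have "(mat_of_row a * pencil M) $$ (0, k) = (\<Sum>j<d. vec_index a j * pencil M $$ (j, k))"
    using P k dim by (simp add: scalar_prod_def lessThan_atLeast0)
  ultimately have "peval (\<Sum>j<d. vec_index a j * pencil M $$ (j, k)) (cvec v) = peval (if k = 0 then cpoly f else 0) (cvec v)"
    by simp
  then show "(\<Sum>j<d. aval j v * pencil_at M v $$ (j, k)) = (if k = 0 then complex_of_real (peval f v) else 0)"
    using k by (simp add: peval_sum peval_mult aval_def peval_pencil_index[of M d, OF M] peval_cpoly split: if_splits)
  have "(pencil M *\<^sub>v map_vec pconj a) $ k = (if k = 0 then cpoly f else 0)"
    using sol k d dim by (simp add: solves_system_def)
  moreover have "(pencil M *\<^sub>v map_vec pconj a) $ k = (\<Sum>j<d. pencil M $$ (k, j) * pconj (vec_index a j))"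
    using P k dim by (simp add: scalar_prod_def lessThan_atLeast0)
  ultimately have "peval (\<Sum>j<d. pencil M $$ (k, j) * pconj (vec_index a j)) (cvec v) = peval (if k = 0 then cpoly f else 0) (cvec v)"
    by simp
  then show "(\<Sum>j<d. pencil_at M v $$ (k, j) * cnj (aval j v)) = (if k = 0 then complex_of_real (peval f v) else 0)"
    using k by (simp add: peval_sum peval_mult peval_pconj aval_def peval_pencil_index[of M d, OF M] peval_cpoly split: if_splits)
qed

text \<open>Both sides are homogeneous of degree \<open>d\<close>, so the equations on the chart
  extend by scaling to all real points off \<nu> = 0, and these determine polynomials.\<close>

lemma solves_systemI:
  assumes M: "\<And>i. M i \<in> carrier_mat d d"
    and row: "\<And>k t s. k < d \<Longrightarrow> (\<Sum>j<d. aval j (rpt t s) * pencil_at M (rpt t s) $$ (j, k))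
      = (if k = 0 then complex_of_real (peval f (rpt t s)) else 0)"
    and col: "\<And>k t s. k < d \<Longrightarrow> (\<Sum>j<d. pencil_at M (rpt t s) $$ (k, j) * cnj (aval j (rpt t s)))
      = (if k = 0 then complex_of_real (peval f (rpt t s)) else 0)"
  shows "solves_system (cpoly f) a M"
proof -
  note P = pencil_carrier[of M d, OF M]
  have scale: "complex_of_real z ^ (d - 1) * (complex_of_real z * x) = complex_of_real z ^ d * x" for z x
    using d by (cases d) simp_all
  have R: "(\<Sum>j<d. vec_index a j * pencil M $$ (j, k)) = (if k = 0 then cpoly f else 0)" if k: "k < d" for k
  proof (rule poly3_eqI_off_plane[OF nu_q])
    fix w assume "\<nu> \<bullet> w \<noteq> 0"
    then obtain z t s where w: "w = z *\<^sub>R rpt t s" using rpt_scale by blast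
    have "peval (\<Sum>j<d. vec_index a j * pencil M $$ (j, k)) (cvec w) = (\<Sum>j<d. aval j w * pencil_at M w $$ (j, k))"
      using k by (simp add: peval_sum peval_mult aval_def peval_pencil_index[of M d, OF M])
    also have "\<dots> = complex_of_real z ^ d * (\<Sum>j<d. aval j (rpt t s) * pencil_at M (rpt t s) $$ (j, k))"
      unfolding sum_distrib_left
    proof (rule sum.cong[OF refl])
      fix j assume "j \<in> {..<d}"
      then have "aval j w * pencil_at M w $$ (j, k)
          = complex_of_real z ^ (d - 1) * (complex_of_real z * (aval j (rpt t s) * pencil_at M (rpt t s) $$ (j, k)))"
        using k pencil_at_carrier[of M d "rpt t s", OF M]
        by (simp add: w aval_scaleR pencil_at_scaleR[of M d, OF M] mult_ac)
      then show "aval j w * pencil_at M w $$ (j, k)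
          = complex_of_real z ^ d * (aval j (rpt t s) * pencil_at M (rpt t s) $$ (j, k))"
        by (simp only: scale)
    qed
    also have "\<dots> = (if k = 0 then complex_of_real (peval f w) else 0)"
      unfolding row[OF k] by (simp add: w f_scaleR)
    finally show "peval (\<Sum>j<d. vec_index a j * pencil M $$ (j, k)) (cvec w) = peval (if k = 0 then cpoly f else 0) (cvec w)"
      by (simp add: peval_cpoly)
  qed
  have C: "(\<Sum>j<d. pencil M $$ (k, j) * pconj (vec_index a j)) = (if k = 0 then cpoly f else 0)" if k: "k < d" for k
  proof (rule poly3_eqI_off_plane[OF nu_q])
    fix w assume "\<nu> \<bullet> w \<noteq> 0"
    then obtain z t s where w: "w = z *\<^sub>R rpt t s" using rpt_scale by blast
    have "peval (\<Sum>j<d. pencil M $$ (k, j) * pconj (vec_index a j)) (cvec w) = (\<Sum>j<d. pencil_at M w $$ (k, j) * cnj (aval j w))"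
      using k by (simp add: peval_sum peval_mult peval_pconj aval_def peval_pencil_index[of M d, OF M])
    also have "\<dots> = complex_of_real z ^ d * (\<Sum>j<d. pencil_at M (rpt t s) $$ (k, j) * cnj (aval j (rpt t s)))"
      unfolding sum_distrib_left
    proof (rule sum.cong[OF refl])
      fix j assume "j \<in> {..<d}"
      then have "pencil_at M w $$ (k, j) * cnj (aval j w)
          = complex_of_real z ^ (d - 1) * (complex_of_real z * (pencil_at M (rpt t s) $$ (k, j) * cnj (aval j (rpt t s))))"
        using k pencil_at_carrier[of M d "rpt t s", OF M]
        by (simp add: w aval_scaleR pencil_at_scaleR[of M d, OF M] mult_ac)
      then show "pencil_at M w $$ (k, j) * cnj (aval j w)
          = complex_of_real z ^ d * (pencil_at M (rpt t s) $$ (k, j) * cnj (aval j (rpt t s)))"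
        by (simp only: scale)
    qed
    also have "\<dots> = (if k = 0 then complex_of_real (peval f w) else 0)"
      unfolding col[OF k] by (simp add: w f_scaleR)
    finally show "peval (\<Sum>j<d. pencil M $$ (k, j) * pconj (vec_index a j)) (cvec w) = peval (if k = 0 then cpoly f else 0) (cvec w)"
      by (simp add: peval_cpoly)
  qed
  have "mat_of_row a * pencil M = mat_of_row (cpoly f \<cdot>\<^sub>v unit_vec d 0)"
    using P dim d by (intro eq_matI) (auto simp: scalar_prod_def lessThan_atLeast0 mat_of_row_def R[unfolded lessThan_atLeast0])
  moreover have "pencil M *\<^sub>v map_vec pconj a = cpoly f \<cdot>\<^sub>v unit_vec d 0"
    using P dim d by (intro eq_vecI) (auto simp: scalar_prod_def lessThan_atLeast0 C[unfolded lessThan_atLeast0])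
  ultimately show ?thesis using M dim by (simp add: solves_system_def)
qed

end


section \<open>Adjoints of products, inverses and congruences\<close>

lemma index_mult_mat_sum:
  assumes "A \<in> carrier_mat n m" "B \<in> carrier_mat m k" "i < n" "j < k"
  shows "(A * B) $$ (i, j) = (\<Sum>l<m. A $$ (i, l) * B $$ (l, j))"
  using assms by (simp add: scalar_prod_def lessThan_atLeast0)

lemma index_mult_mat_vec_sum:
  assumes "A \<in> carrier_mat n m" "v \<in> carrier_vec m" "i < n"
  shows "(A *\<^sub>v v) $ i = (\<Sum>l<m. A $$ (i, l) * v $ l)"
  using assms by (simp add: scalar_prod_def lessThan_atLeast0)

lemma mat_adjoint_mult:
  fixes A B :: "complex mat"
  assumes A: "A \<in> carrier_mat n m" and B: "B \<in> carrier_mat m k"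
  shows "mat_adjoint (A * B) = mat_adjoint B * mat_adjoint A"
proof (rule eq_matI)
  fix i j assume "i < dim_row (mat_adjoint B * mat_adjoint A)" "j < dim_col (mat_adjoint B * mat_adjoint A)"
  then have ij: "i < k" "j < n" using mat_adjoint_carrier[OF A] mat_adjoint_carrier[OF B] by auto
  have "mat_adjoint (A * B) $$ (i, j) = cnj ((A * B) $$ (j, i))"
    using mat_adjoint_index[OF mult_carrier_mat[OF A B] ij] by simp
  also have "\<dots> = (\<Sum>l<m. cnj (B $$ (l, i)) * cnj (A $$ (j, l)))"
    using index_mult_mat_sum[OF A B ij(2) ij(1)] by (simp add: mult.commute)
  also have "\<dots> = (\<Sum>l<m. mat_adjoint B $$ (i, l) * mat_adjoint A $$ (l, j))"
    using ij mat_adjoint_index[OF A] mat_adjoint_index[OF B] by simp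
  also have "\<dots> = (mat_adjoint B * mat_adjoint A) $$ (i, j)"
    using index_mult_mat_sum[OF mat_adjoint_carrier[OF B] mat_adjoint_carrier[OF A] ij] by simp
  finally show "mat_adjoint (A * B) $$ (i, j) = (mat_adjoint B * mat_adjoint A) $$ (i, j)" .
qed (use mat_adjoint_carrier[OF mult_carrier_mat[OF A B]] mat_adjoint_carrier[OF A] mat_adjoint_carrier[OF B] in auto)

lemma mat_adjoint_eqI:
  fixes A B :: "complex mat"
  assumes "A \<in> carrier_mat n n" "B \<in> carrier_mat n n"
    and "\<And>i j. i < n \<Longrightarrow> j < n \<Longrightarrow> cnj (A $$ (j, i)) = B $$ (i, j)"
  shows "mat_adjoint A = B"
  using assms mat_adjoint_carrier[OF assms(1)] by (intro eq_matI) (auto simp: mat_adjoint_index[OF assms(1)])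

lemma mat_adjoint_one: "mat_adjoint (1\<^sub>m n :: complex mat) = 1\<^sub>m n"
  using mat_adjoint_carrier[of "1\<^sub>m n :: complex mat" n n]
  by (intro eq_matI) (auto simp: mat_adjoint_index[of _ n n])

lemma hermitian_inverse:
  assumes P: "P \<in> carrier_mat n n" "hermitian P" and Q: "Q \<in> carrier_mat n n" "P * Q = 1\<^sub>m n"
  shows "hermitian Q"
proof -
  note Q' = mat_adjoint_carrier[OF Q(1)]
  have "mat_adjoint Q * P = 1\<^sub>m n"
    using mat_adjoint_mult[OF P(1) Q(1)] P(2) Q(2) by (simp add: hermitian_def mat_adjoint_one)
  then have "mat_adjoint Q * (P * Q) = Q" using assoc_mult_mat[OF Q' P(1) Q(1)] Q(1) by simp
  then show ?thesis using Q(2) Q' by (simp add: hermitian_def)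
qed

lemma hermitian_congruence:
  assumes "Q \<in> carrier_mat n n" "hermitian Q" "H \<in> carrier_mat n n" "hermitian H"
  shows "hermitian (Q * (H * Q))"
  using mat_adjoint_mult[OF assms(1) mult_carrier_mat[OF assms(3,1)]] mat_adjoint_mult[OF assms(3,1)]
    assms assoc_mult_mat[OF assms(1,3,1)] by (simp add: hermitian_def)

section \<open>Gram matrices of the values on a line\<close>

context conjugate_splitting
begin

definition Wm :: "real \<Rightarrow> complex mat" where
  "Wm s = Matrix.mat d d (\<lambda>(j, i). cnj (aval j (zero_pt s i)) / complex_of_real (gval s i))"

definition Vm :: "real \<Rightarrow> complex mat" where
  "Vm s = Matrix.mat d d (\<lambda>(i, k). aval k (zero_pt s i) / complex_of_real (gval s i))"

definition Rm :: "real \<Rightarrow> complex mat" where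
  "Rm s = Matrix.mat d d (\<lambda>(i, k). if i = k then complex_of_real (lroot s i) else 0)"

definition Dm :: "real \<Rightarrow> real \<Rightarrow> complex mat" where
  "Dm t s = Matrix.mat d d (\<lambda>(i, k). if i = k then complex_of_real (t - lroot s i) else 0)"

lemma carriers [simp]: "Wm s \<in> carrier_mat d d" "Vm s \<in> carrier_mat d d" "Rm s \<in> carrier_mat d d" "Dm t s \<in> carrier_mat d d"
  by (simp_all add: Wm_def Vm_def Rm_def Dm_def)

lemma Dm_eq: "Dm t s = complex_of_real t \<cdot>\<^sub>m 1\<^sub>m d - Rm s"
  by (rule eq_matI) (auto simp: Dm_def Rm_def)

lemma adjoint_Wm: "mat_adjoint (Wm s) = Vm s" and adjoint_Vm: "mat_adjoint (Vm s) = Wm s"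
  and adjoint_Rm: "mat_adjoint (Rm s) = Rm s"
  by (rule mat_adjoint_eqI[of _ d]; simp add: Wm_def Vm_def Rm_def)+

lemma gram_matrices_exist:
  "\<exists>P H1 H2. P \<in> carrier_mat d d \<and> H1 \<in> carrier_mat d d \<and> H2 \<in> carrier_mat d d \<and>
     (\<forall>s. Wm s * Vm s = P \<and> Wm s * (Rm s * Vm s) = complex_of_real s \<cdot>\<^sub>m H1 + H2)"
proof -
  have "\<forall>j k. \<exists>P r. j < d \<and> k < d \<longrightarrow> degree r \<le> 1 \<and> (\<forall>s.
      (\<Sum>i<d. cnj (aval j (zero_pt s i)) * aval k (zero_pt s i) / (complex_of_real (gval s i))\<^sup>2) = P \<and>
      (\<Sum>i<d. complex_of_real (lroot s i) * (cnj (aval j (zero_pt s i)) * aval k (zero_pt s i)) / (complex_of_real (gval s i))\<^sup>2)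
        = poly r (complex_of_real s))"
    using trace_exists by blast
  then obtain P r where Pr: "\<And>j k. j < d \<Longrightarrow> k < d \<Longrightarrow> degree (r j k) \<le> 1 \<and> (\<forall>s.
      (\<Sum>i<d. cnj (aval j (zero_pt s i)) * aval k (zero_pt s i) / (complex_of_real (gval s i))\<^sup>2) = P j k \<and>
      (\<Sum>i<d. complex_of_real (lroot s i) * (cnj (aval j (zero_pt s i)) * aval k (zero_pt s i)) / (complex_of_real (gval s i))\<^sup>2)
        = poly (r j k) (complex_of_real s))"
    unfolding choice_iff by blast
  have lin: "poly r x = x * coeff r 1 + coeff r 0" if "degree r \<le> 1" for r :: "complex poly" and x
  proof -
    have "poly r x = (\<Sum>i\<le>1. coeff r i * x ^ i)"
      unfolding poly_altdef using that by (intro sum.mono_neutral_left) (auto simp: coeff_eq_0)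
    then show ?thesis by (simp add: mult.commute)
  qed
  let ?P = "Matrix.mat d d (\<lambda>(j, k). P j k)"
  let ?H1 = "Matrix.mat d d (\<lambda>(j, k). coeff (r j k) 1)"
  let ?H2 = "Matrix.mat d d (\<lambda>(j, k). coeff (r j k) 0)"
  have "Wm s * Vm s = ?P" for s
  proof (rule eq_matI)
    fix j k assume "j < dim_row ?P" "k < dim_col ?P"
    then have jk: "j < d" "k < d" by auto
    have "(Wm s * Vm s) $$ (j, k) = (\<Sum>i<d. cnj (aval j (zero_pt s i)) * aval k (zero_pt s i) / (complex_of_real (gval s i))\<^sup>2)"
      using jk index_mult_mat_sum[of "Wm s" d d "Vm s" d j k] by (simp add: Wm_def Vm_def power2_eq_square)
    then show "(Wm s * Vm s) $$ (j, k) = ?P $$ (j, k)" using Pr[OF jk] jk by simp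
  qed (simp_all add: Wm_def Vm_def)
  moreover have "Wm s * (Rm s * Vm s) = complex_of_real s \<cdot>\<^sub>m ?H1 + ?H2" for s
  proof (rule eq_matI)
    fix j k assume "j < dim_row (complex_of_real s \<cdot>\<^sub>m ?H1 + ?H2)" "k < dim_col (complex_of_real s \<cdot>\<^sub>m ?H1 + ?H2)"
    then have jk: "j < d" "k < d" by auto
    have RV: "(Rm s * Vm s) $$ (i, k) = complex_of_real (lroot s i) * aval k (zero_pt s i) / complex_of_real (gval s i)" if "i < d" for i
    proof -
      have "(Rm s * Vm s) $$ (i, k) = (\<Sum>l<d. Rm s $$ (i, l) * Vm s $$ (l, k))"
        by (rule index_mult_mat_sum) (use that jk in simp_all)
      also have "\<dots> = (\<Sum>l<d. if l = i then complex_of_real (lroot s i) * Vm s $$ (i, k) else 0)"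
        by (rule sum.cong) (use that in \<open>auto simp: Rm_def\<close>)
      also have "\<dots> = complex_of_real (lroot s i) * Vm s $$ (i, k)" using that by simp
      finally show ?thesis using that jk by (simp add: Vm_def)
    qed
    have "(Wm s * (Rm s * Vm s)) $$ (j, k) = (\<Sum>i<d. complex_of_real (lroot s i) * (cnj (aval j (zero_pt s i)) * aval k (zero_pt s i)) / (complex_of_real (gval s i))\<^sup>2)"
      using jk index_mult_mat_sum[of "Wm s" d d "Rm s * Vm s" d j k, OF carriers(1) mult_carrier_mat[OF carriers(3,2)]]
      by (simp add: RV power2_eq_square mult_ac) (simp add: Wm_def mult_ac)
    then show "(Wm s * (Rm s * Vm s)) $$ (j, k) = (complex_of_real s \<cdot>\<^sub>m ?H1 + ?H2) $$ (j, k)"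
      using Pr[OF jk] jk lin[of "r j k"] by simp
  qed (simp_all add: Wm_def Vm_def)
  ultimately show ?thesis by (intro exI[of _ ?P] exI[of _ ?H1] exI[of _ ?H2]) simp
qed

text \<open>As \<open>W\<close> is the adjoint of \<open>V\<close>, the form of
  \<open>P = W V\<close> at \<open>u\<close> is the squared norm of \<open>V u\<close>. The
  conjugate sits on \<open>P u\<close> so that, for \<open>u\<close> the inverse of \<open>P\<close>
  applied to \<open>v\<close>, the left side becomes the form of the inverse at
  \<open>v\<close>.\<close>

lemma gram_quadratic_form:
  assumes u: "u \<in> carrier_vec d"
  shows "(\<Sum>j<d. u $ j * cnj (((Wm s * Vm s) *\<^sub>v u) $ j)) = complex_of_real (\<Sum>i<d. (cmod ((Vm s *\<^sub>v u) $ i))\<^sup>2)"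
proof -
  let ?w = "Vm s *\<^sub>v u"
  have w: "?w \<in> carrier_vec d" using mult_mat_vec_carrier[OF carriers(2) u] .
  have "((Wm s * Vm s) *\<^sub>v u) $ j = (\<Sum>i<d. Wm s $$ (j, i) * ?w $ i)" if "j < d" for j
    using index_mult_mat_vec_sum[OF carriers(1) w that] assoc_mult_mat_vec[OF carriers(1,2) u] by simp
  then have "(\<Sum>j<d. u $ j * cnj (((Wm s * Vm s) *\<^sub>v u) $ j)) = (\<Sum>j<d. \<Sum>i<d. u $ j * (cnj (Wm s $$ (j, i)) * cnj (?w $ i)))"
    by (simp add: sum_distrib_left)
  also have "\<dots> = (\<Sum>i<d. \<Sum>j<d. u $ j * (cnj (Wm s $$ (j, i)) * cnj (?w $ i)))"
    by (rule sum.swap)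
  also have "\<dots> = (\<Sum>i<d. ?w $ i * cnj (?w $ i))"
  proof (rule sum.cong[OF refl])
    fix i assume "i \<in> {..<d}"
    then have i: "i < d" by simp
    have "?w $ i = (\<Sum>j<d. cnj (Wm s $$ (j, i)) * u $ j)"
      using index_mult_mat_vec_sum[OF carriers(2) u i] i by (simp add: Wm_def Vm_def)
    then have "?w $ i * cnj (?w $ i) = (\<Sum>j<d. cnj (Wm s $$ (j, i)) * u $ j) * cnj (?w $ i)"
      by (rule arg_cong)
    also have "\<dots> = (\<Sum>j<d. u $ j * (cnj (Wm s $$ (j, i)) * cnj (?w $ i)))"
      unfolding sum_distrib_right by (rule sum.cong) (simp_all only: mult_ac)
    finally show "(\<Sum>j<d. u $ j * (cnj (Wm s $$ (j, i)) * cnj (?w $ i))) = ?w $ i * cnj (?w $ i)" ..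
  qed
  also have "\<dots> = complex_of_real (\<Sum>i<d. (cmod (?w $ i))\<^sup>2)"
    by (simp only: of_real_sum complex_norm_square)
  finally show ?thesis .
qed

text \<open>On one line, vanishing at the zeros of \<open>f\<close> propagates to the whole line by
  interpolation. All \<open>s\<close> are needed because independence of the \<open>a_k\<close>
  requires the combination to vanish on the whole chart.\<close>

lemma Vm_mult_vec_zero_imp:
  assumes v: "v \<in> carrier_vec d" and z: "\<And>s i. i < d \<Longrightarrow> (Vm s *\<^sub>v v) $ i = 0"
  shows "v = 0\<^sub>v d"
proof -
  have "(\<Sum>k<d. v $ k * aval k (rpt t s)) = 0" for t s
  proof -
    have "(\<Sum>k<d. v $ k * aval k (rpt t s))
        = (\<Sum>k<d. \<Sum>i<d. v $ k * (aval k (zero_pt s i) / complex_of_real (gval s i) * complex_of_real (cofactor_f s i t)))"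
      using interpolation[OF hom_a] by (simp add: aval_def sum_distrib_left)
    also have "\<dots> = (\<Sum>i<d. \<Sum>k<d. v $ k * (aval k (zero_pt s i) / complex_of_real (gval s i) * complex_of_real (cofactor_f s i t)))"
      by (rule sum.swap)
    also have "\<dots> = (\<Sum>i<d. (Vm s *\<^sub>v v) $ i * complex_of_real (cofactor_f s i t))"
    proof (rule sum.cong[OF refl])
      fix i assume "i \<in> {..<d}"
      then have i: "i < d" by simp
      have "(Vm s *\<^sub>v v) $ i = (\<Sum>k<d. aval k (zero_pt s i) / complex_of_real (gval s i) * v $ k)"
        using index_mult_mat_vec_sum[OF carriers(2) v i] i by (simp add: Vm_def)
      then have "(Vm s *\<^sub>v v) $ i * complex_of_real (cofactor_f s i t)
          = (\<Sum>k<d. aval k (zero_pt s i) / complex_of_real (gval s i) * v $ k) * complex_of_real (cofactor_f s i t)"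
        by (rule arg_cong)
      also have "\<dots> = (\<Sum>k<d. v $ k * (aval k (zero_pt s i) / complex_of_real (gval s i) * complex_of_real (cofactor_f s i t)))"
        unfolding sum_distrib_right by (rule sum.cong) (simp_all only: mult_ac)
      finally show "(\<Sum>k<d. v $ k * (aval k (zero_pt s i) / complex_of_real (gval s i) * complex_of_real (cofactor_f s i t)))
          = (Vm s *\<^sub>v v) $ i * complex_of_real (cofactor_f s i t)" ..
    qed
    finally show ?thesis using z by simp
  qed
  then have "v $ k = 0" if "k < d" for k using aval_independent[of "\<lambda>k. v $ k"] that by blast
  then show ?thesis using v by (auto simp: Matrix.vec_eq_iff)
qed

end

locale gram = conjugate_splitting +
  fixes P H1 H2 Q :: "complex mat"
  assumes P: "P \<in> carrier_mat d d" and H1: "H1 \<in> carrier_mat d d" and H2: "H2 \<in> carrier_mat d d"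
    and Q: "Q \<in> carrier_mat d d" and PQ: "P * Q = 1\<^sub>m d" and QP: "Q * P = 1\<^sub>m d"
    and WV: "Wm s * Vm s = P" and WRV: "Wm s * (Rm s * Vm s) = complex_of_real s \<cdot>\<^sub>m H1 + H2"

lemma (in conjugate_splitting) gram_exists:
  "\<exists>P H1 H2 Q. gram d f g e S a p q \<kappa> \<mu> \<nu> P H1 H2 Q"
proof -
  obtain P H1 H2 where PH: "P \<in> carrier_mat d d" "H1 \<in> carrier_mat d d" "H2 \<in> carrier_mat d d"
    and WV: "\<And>s. Wm s * Vm s = P" and WRV: "\<And>s. Wm s * (Rm s * Vm s) = complex_of_real s \<cdot>\<^sub>m H1 + H2"
    using gram_matrices_exist by (elim exE conjE) (rule that, auto)
  have "Determinant.det P \<noteq> 0"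
  proof
    assume "Determinant.det P = 0"
    then obtain v where v: "v \<in> carrier_vec d" "v \<noteq> 0\<^sub>v d" "P *\<^sub>v v = 0\<^sub>v d"
      using det_0_iff_vec_prod_zero[OF PH(1)] by auto
    \<comment> \<open>Here \<open>s\<close> is arbitrary although \<open>v\<close> is fixed:
      \<open>P\<close> is the same Gram matrix on every line.\<close>
    have "(Vm s *\<^sub>v v) $ i = 0" if i: "i < d" for s i
    proof -
      have "complex_of_real (\<Sum>i<d. (cmod ((Vm s *\<^sub>v v) $ i))\<^sup>2) = 0"
        using gram_quadratic_form[OF v(1), of s] v(3) by (simp add: WV)
      then have "(\<Sum>i<d. (cmod ((Vm s *\<^sub>v v) $ i))\<^sup>2) = 0" by (simp only: of_real_eq_0_iff)
      then have "(cmod ((Vm s *\<^sub>v v) $ i))\<^sup>2 = 0"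
        using i by (subst (asm) sum_nonneg_eq_0_iff) auto
      then show ?thesis by simp
    qed
    then show False using Vm_mult_vec_zero_imp[OF v(1)] v(2) by blast
  qed
  then obtain Q where "Q \<in> carrier_mat d d" "P * Q = 1\<^sub>m d" "Q * P = 1\<^sub>m d"
    using mat_inverse_exists[OF PH(1)] by blast
  then show ?thesis
    using PH WV WRV by (intro exI, unfold_locales) auto
qed


section \<open>Solution of the linear system\<close>

context gram
begin

text \<open>The inverses of \<open>V\<close> and \<open>W\<close>.\<close>

definition Xm :: "real \<Rightarrow> complex mat" where "Xm s = Q * Wm s"
definition Ym :: "real \<Rightarrow> complex mat" where "Ym s = Vm s * Q"

lemma XY_carriers [simp]: "Xm s \<in> carrier_mat d d" "Ym s \<in> carrier_mat d d"
  using Q by (simp_all add: Xm_def Ym_def mult_carrier_mat[of _ d d])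

lemmas assoc = assoc_mult_mat[of _ d d _ d _ d]
lemmas mult_one = left_mult_one_mat[of _ d d] right_mult_one_mat[of _ d d]

lemma XV: "Xm s * Vm s = 1\<^sub>m d"
  using Q by (simp add: Xm_def assoc WV QP)

lemma VX: "Vm s * Xm s = 1\<^sub>m d"
  by (rule mat_mult_left_right_inverse[OF XY_carriers(1) carriers(2) XV])

lemma WY: "Wm s * Ym s = 1\<^sub>m d"
proof -
  have "Wm s * Ym s = (Wm s * Vm s) * Q" using Q by (simp add: Ym_def assoc)
  then show ?thesis by (simp add: WV PQ)
qed

lemma XY: "Xm s * Ym s = Q"
proof -
  have "Xm s * Ym s = Q * (Wm s * Ym s)" using Q by (simp add: Xm_def assoc)
  then show ?thesis using Q by (simp add: WY)
qed

lemma XRY: "Xm s * (Rm s * Ym s) = complex_of_real s \<cdot>\<^sub>m (Q * (H1 * Q)) + Q * (H2 * Q)"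
proof -
  have "Xm s * (Rm s * Ym s) = Q * ((Wm s * (Rm s * Vm s)) * Q)"
    using Q by (simp add: Xm_def Ym_def assoc mult_carrier_mat[of _ d d])
  also have "\<dots> = Q * (complex_of_real s \<cdot>\<^sub>m (H1 * Q) + H2 * Q)"
    unfolding WRV using H1 H2 Q
    by (simp add: add_mult_distrib_mat[of _ d d _ _ d] mult_smult_assoc_mat[of _ d d _ d])
  also have "\<dots> = complex_of_real s \<cdot>\<^sub>m (Q * (H1 * Q)) + Q * (H2 * Q)"
    using H1 H2 Q
    by (simp add: mult_add_distrib_mat[of _ d d _ d] mult_smult_distrib[of _ d d _ d] mult_carrier_mat[of _ d d])
  finally show ?thesis .
qed

text \<open>The affine family \<open>t Q - s Q H1 Q - Q H2 Q\<close>, written as a pencil in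
  \<open>x, y, z\<close> by replacing \<open>t\<close>, \<open>s\<close> and 1 by the functionals
  \<kappa>, \<mu> and \<nu>.\<close>

definition Msol :: "3 \<Rightarrow> complex mat" where
  "Msol i = Matrix.mat d d (\<lambda>(j, k). complex_of_real (\<kappa> $h i) * Q $$ (j, k)
     - complex_of_real (\<mu> $h i) * (Q * (H1 * Q)) $$ (j, k) - complex_of_real (\<nu> $h i) * (Q * (H2 * Q)) $$ (j, k))"

lemma Msol_carrier: "Msol i \<in> carrier_mat d d"
  by (simp add: Msol_def)

lemma pencil_Msol_index:
  assumes "j < d" "k < d"
  shows "pencil_at Msol v $$ (j, k) = complex_of_real (\<kappa> \<bullet> v) * Q $$ (j, k)
     - complex_of_real (\<mu> \<bullet> v) * (Q * (H1 * Q)) $$ (j, k) - complex_of_real (\<nu> \<bullet> v) * (Q * (H2 * Q)) $$ (j, k)"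
  using assms pencil_at_index[of Msol d, OF Msol_carrier assms, of v]
  by (simp add: Msol_def inner_vec_def sum_3 algebra_simps del: index_mult_mat)

lemma inner_rpt: "\<kappa> \<bullet> rpt t s = t" "\<mu> \<bullet> rpt t s = s" "\<nu> \<bullet> rpt t s = 1"
  using dual by (simp_all add: rpt_def inner_add_right dual_bases_def)

lemma pencil_Msol_factor: "pencil_at Msol (rpt t s) = Xm s * (Dm t s * Ym s)"
proof -
  have "Dm t s * Ym s = complex_of_real t \<cdot>\<^sub>m Ym s - Rm s * Ym s"
    unfolding Dm_eq
    by (simp add: minus_mult_distrib_mat[of _ d d _ _ d] mult_smult_assoc_mat[of _ d d _ d] mult_one)
  then have "Xm s * (Dm t s * Ym s) = complex_of_real t \<cdot>\<^sub>m Q - Xm s * (Rm s * Ym s)"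
    by (simp add: mult_minus_distrib_mat[of _ d d _ d] mult_smult_distrib[of _ d d _ d] mult_carrier_mat[of _ d d] XY)
  also have "\<dots> = pencil_at Msol (rpt t s)"
    unfolding XRY
  proof (rule eq_matI)
    show "dim_row (complex_of_real t \<cdot>\<^sub>m Q - (complex_of_real s \<cdot>\<^sub>m (Q * (H1 * Q)) + Q * (H2 * Q))) = dim_row (pencil_at Msol (rpt t s))"
      "dim_col (complex_of_real t \<cdot>\<^sub>m Q - (complex_of_real s \<cdot>\<^sub>m (Q * (H1 * Q)) + Q * (H2 * Q))) = dim_col (pencil_at Msol (rpt t s))"
      using pencil_at_carrier[of Msol d "rpt t s", OF Msol_carrier] Q H2 by auto
    fix j k assume "j < dim_row (pencil_at Msol (rpt t s))" "k < dim_col (pencil_at Msol (rpt t s))"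
    then have jk: "j < d" "k < d" using pencil_at_carrier[of Msol d "rpt t s", OF Msol_carrier] by auto
    have dims: "dim_row Q = d" "dim_col Q = d" "dim_row H1 = d" "dim_row H2 = d" using Q H1 H2 by auto
    show "(complex_of_real t \<cdot>\<^sub>m Q - (complex_of_real s \<cdot>\<^sub>m (Q * (H1 * Q)) + Q * (H2 * Q))) $$ (j, k) = pencil_at Msol (rpt t s) $$ (j, k)"
      unfolding pencil_Msol_index[OF jk] inner_rpt
      using jk by (simp add: dims del: index_mult_mat(1))
  qed
  finally show ?thesis ..
qed

lemma cofactor_mult_root:
  "i < d \<Longrightarrow> complex_of_real (cofactor_f s i t) * complex_of_real (t - lroot s i) = complex_of_real (peval f (rpt t s))"
  by (simp only: of_real_mult[symmetric] cofactor_f_mult)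

lemma aval_0: "aval 0 (zero_pt s i) = complex_of_real (gval s i)"
  by (simp add: aval_def a0 peval_cpoly gval_def)

lemma aval_eq_sum: "j < d \<Longrightarrow> aval j (rpt t s) = (\<Sum>i<d. complex_of_real (cofactor_f s i t) * Vm s $$ (i, j))"
  using interpolation[OF hom_a, of j t s] by (simp add: aval_def Vm_def mult.commute)

text \<open>Interpolation says \<open>A = l V\<close>, where \<open>l\<close> lists the cofactors of
  \<open>f\<close>. Multiplying \<open>l\<close> by \<open>t - R\<close> restores the missing
  factors and gives \<open>f\<close> times the all-ones row. That row is the first row of
  \<open>W\<close>, because the first basis element is \<open>g\<close>; so the inverse of
  \<open>W\<close> sends it to the first unit vector.\<close>

lemma row_equation:
  assumes k: "k < d"
  shows "(\<Sum>j<d. aval j (rpt t s) * pencil_at Msol (rpt t s) $$ (j, k))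
      = (if k = 0 then complex_of_real (peval f (rpt t s)) else 0)"
proof -
  let ?f = "complex_of_real (peval f (rpt t s))"
  let ?L = "pencil_at Msol (rpt t s)"
  define l where "l = Matrix.mat (Suc 0) d (\<lambda>(_::nat, i). complex_of_real (cofactor_f s i t))"
  define o1 where "o1 = Matrix.mat (Suc 0) d (\<lambda>(_::nat, _::nat). 1 :: complex)"
  define e0 where "e0 = Matrix.mat (Suc 0) d (\<lambda>(_::nat, i). if i = 0 then 1 else 0 :: complex)"
  define A where "A = Matrix.mat (Suc 0) d (\<lambda>(_::nat, j). aval j (rpt t s))"
  have c [simp]: "l \<in> carrier_mat (Suc 0) d" "o1 \<in> carrier_mat (Suc 0) d" "e0 \<in> carrier_mat (Suc 0) d" "A \<in> carrier_mat (Suc 0) d"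
    by (simp_all add: l_def o1_def e0_def A_def)
  note assoc1 = assoc_mult_mat[of _ "Suc 0" d _ d _ d]
  have 1: "A = l * Vm s"
  proof (rule eq_matI)
    fix i j assume "i < dim_row (l * Vm s)" "j < dim_col (l * Vm s)"
    then have "i = 0" "j < d" using carrier_matD[OF carriers(2)] by (auto simp: l_def)
    then show "A $$ (i, j) = (l * Vm s) $$ (i, j)"
      using index_mult_mat_sum[OF c(1) carriers(2), of 0 j s] by (simp add: A_def l_def aval_eq_sum)
  qed (use carrier_matD[OF carriers(2)] in \<open>auto simp: A_def l_def\<close>)
  have 2: "l * Dm t s = ?f \<cdot>\<^sub>m o1"
  proof (rule eq_matI)
    fix i j assume "i < dim_row (?f \<cdot>\<^sub>m o1)" "j < dim_col (?f \<cdot>\<^sub>m o1)"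
    then have ij: "i = 0" "j < d" by (auto simp: o1_def)
    have "(l * Dm t s) $$ (0, j) = (\<Sum>m<d. l $$ (0, m) * Dm t s $$ (m, j))"
      by (rule index_mult_mat_sum[of _ "Suc 0" d _ d]) (use ij in simp_all)
    also have "\<dots> = (\<Sum>m<d. if m = j then ?f else 0)"
      by (rule sum.cong[OF refl]) (use ij in \<open>auto simp: l_def Dm_def cofactor_mult_root simp del: of_real_diff\<close>)
    finally show "(l * Dm t s) $$ (i, j) = (?f \<cdot>\<^sub>m o1) $$ (i, j)" using ij by (simp add: o1_def)
  qed (use carrier_matD[OF carriers(4)] in \<open>auto simp: l_def o1_def\<close>)
  have 3: "e0 * Wm s = o1"
  proof (rule eq_matI)
    fix i j assume "i < dim_row o1" "j < dim_col o1"
    then have ij: "i = 0" "j < d" by (auto simp: o1_def)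
    have "(e0 * Wm s) $$ (0, j) = (\<Sum>m<d. e0 $$ (0, m) * Wm s $$ (m, j))"
      by (rule index_mult_mat_sum[of _ "Suc 0" d _ d]) (use ij in simp_all)
    also have "\<dots> = (\<Sum>m<d. if m = 0 then Wm s $$ (0, j) else 0)"
      by (rule sum.cong[OF refl]) (use d in \<open>auto simp: e0_def\<close>)
    also have "\<dots> = 1" using d ij gval_nonzero[OF ij(2)] by (simp add: Wm_def aval_0)
    finally show "(e0 * Wm s) $$ (i, j) = o1 $$ (i, j)" using ij by (simp add: o1_def)
  qed (use carrier_matD[OF carriers(1)] in \<open>auto simp: e0_def o1_def\<close>)
  have "A * ?L = l * ((Vm s * Xm s) * (Dm t s * Ym s))"
    unfolding 1 pencil_Msol_factor by (simp add: assoc1 assoc mult_carrier_mat[of _ d d] mult_carrier_mat[of _ "Suc 0" d])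
  also have "\<dots> = (l * Dm t s) * Ym s"
    by (simp add: VX assoc1 mult_one mult_carrier_mat[of _ d d])
  also have "\<dots> = ?f \<cdot>\<^sub>m (e0 * (Wm s * Ym s))"
    unfolding 2 3[symmetric]
    by (simp add: mult_smult_assoc_mat[of _ "Suc 0" d _ d] mult_carrier_mat[of _ "Suc 0" d] assoc1)
  also have "\<dots> = ?f \<cdot>\<^sub>m e0" by (simp add: WY right_mult_one_mat[of _ "Suc 0" d])
  finally have AL: "A * ?L = ?f \<cdot>\<^sub>m e0" .
  have "(\<Sum>j<d. aval j (rpt t s) * ?L $$ (j, k)) = (A * ?L) $$ (0, k)"
    using index_mult_mat_sum[OF c(4) pencil_at_carrier[of Msol d, OF Msol_carrier], of 0 k "rpt t s"] k by (simp add: A_def)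
  then show ?thesis unfolding AL using k by (simp add: e0_def)
qed

section \<open>Hermitian symmetry and the column equations\<close>

lemma hermitian_P: "hermitian P"
  using mat_adjoint_mult[OF carriers(1,2), of 0 0] WV[of 0] by (simp add: hermitian_def adjoint_Wm adjoint_Vm)

lemma hermitian_Q: "hermitian Q"
  by (rule hermitian_inverse[OF P hermitian_P Q PQ])

lemma hermitian_WRV: "hermitian (complex_of_real s \<cdot>\<^sub>m H1 + H2)"
proof -
  have "mat_adjoint (Wm s * (Rm s * Vm s)) = (Wm s * Rm s) * Vm s"
    using mat_adjoint_mult[OF carriers(1) mult_carrier_mat[OF carriers(3,2)], of s s s] mat_adjoint_mult[OF carriers(3,2), of s s]
    by (simp add: adjoint_Wm adjoint_Vm adjoint_Rm)
  also have "\<dots> = Wm s * (Rm s * Vm s)" by (simp add: assoc)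
  finally show ?thesis unfolding WRV hermitian_def .
qed

lemma hermitian_H1: "hermitian H1" and hermitian_H2: "hermitian H2"
proof -
  have c: "complex_of_real s \<cdot>\<^sub>m H1 + H2 \<in> carrier_mat d d" for s using H1 H2 by simp
  have *: "complex_of_real s * H1 $$ (j, k) + H2 $$ (j, k) = cnj (complex_of_real s * H1 $$ (k, j) + H2 $$ (k, j))"
    if "j < d" "k < d" for j k s
  proof -
    have "(complex_of_real s \<cdot>\<^sub>m H1 + H2) $$ (j, k) = cnj ((complex_of_real s \<cdot>\<^sub>m H1 + H2) $$ (k, j))"
      by (rule hermitian_WRV[of s, unfolded hermitian_iff_index[OF c], rule_format, OF that])
    moreover have "(complex_of_real s \<cdot>\<^sub>m H1 + H2) $$ (j, k) = complex_of_real s * H1 $$ (j, k) + H2 $$ (j, k)"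
      if "j < d" "k < d" for j k using that carrier_matD[OF H1] carrier_matD[OF H2] by simp
    ultimately show ?thesis using that by metis
  qed
  \<comment> \<open>The affine family is Hermitian for every real \<open>s\<close>; its values at 0
    and 1 separate \<open>H2\<close> from \<open>H1\<close>.\<close>
  have h2: "H2 $$ (j, k) = cnj (H2 $$ (k, j))" if "j < d" "k < d" for j k
    using *[OF that, of 0] by simp
  have h1: "H1 $$ (j, k) = cnj (H1 $$ (k, j))" if "j < d" "k < d" for j k
  proof -
    have "H1 $$ (j, k) + H2 $$ (j, k) = cnj (H1 $$ (k, j)) + cnj (H2 $$ (k, j))"
      using *[OF that, of 1] by simp
    then show ?thesis unfolding h2[OF that] by simp
  qed
  show "hermitian H1" "hermitian H2"
    unfolding hermitian_iff_index[OF H1] hermitian_iff_index[OF H2]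
    by (intro allI impI, rule h1 h2, assumption+)+
qed

lemma hermitian_Msol: "hermitian (Msol i)"
  unfolding hermitian_iff_index[OF Msol_carrier]
proof (intro allI impI)
  fix j k assume jk: "j < d" "k < d"
  have c: "Q * (H1 * Q) \<in> carrier_mat d d" "Q * (H2 * Q) \<in> carrier_mat d d"
    using Q H1 H2 by (simp_all add: mult_carrier_mat[of _ d d])
  have "Q $$ (j, k) = cnj (Q $$ (k, j))"
    using hermitian_Q jk unfolding hermitian_iff_index[OF Q] by blast
  moreover have "(Q * (H1 * Q)) $$ (j, k) = cnj ((Q * (H1 * Q)) $$ (k, j))"
    using hermitian_congruence[OF Q hermitian_Q H1 hermitian_H1] jk unfolding hermitian_iff_index[OF c(1)] by blast
  moreover have "(Q * (H2 * Q)) $$ (j, k) = cnj ((Q * (H2 * Q)) $$ (k, j))"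
    using hermitian_congruence[OF Q hermitian_Q H2 hermitian_H2] jk unfolding hermitian_iff_index[OF c(2)] by blast
  moreover have "Msol i $$ (j, k) = complex_of_real (\<kappa> $h i) * Q $$ (j, k)
     - complex_of_real (\<mu> $h i) * (Q * (H1 * Q)) $$ (j, k) - complex_of_real (\<nu> $h i) * (Q * (H2 * Q)) $$ (j, k)" if "j < d" "k < d" for j k
    using that by (simp add: Msol_def)
  ultimately show "Msol i $$ (j, k) = cnj (Msol i $$ (k, j))" using jk
    by (simp only: complex_cnj_diff complex_cnj_mult complex_cnj_complex_of_real)
qed

lemma pencil_Msol_hermitian:
  assumes "j < d" "k < d"
  shows "pencil_at Msol v $$ (j, k) = cnj (pencil_at Msol v $$ (k, j))"
proof -
  have "Msol i $$ (j, k) = cnj (Msol i $$ (k, j))" for i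
    using hermitian_Msol[of i] assms unfolding hermitian_iff_index[OF Msol_carrier] by blast
  then show ?thesis
    unfolding pencil_at_index[of Msol d, OF Msol_carrier assms] pencil_at_index[of Msol d, OF Msol_carrier assms(2,1)]
    by (simp only: cnj_sum complex_cnj_mult complex_cnj_complex_of_real)
qed

text \<open>At real points the pencil is Hermitian and \<open>f\<close> is real, so the column
  equations are the conjugates of the row equations.\<close>

lemma solves_Msol: "solves_system (cpoly f) a Msol"
proof (rule solves_systemI[OF Msol_carrier row_equation])
  fix k t s assume k: "k < d"
  have "(\<Sum>j<d. pencil_at Msol (rpt t s) $$ (k, j) * cnj (aval j (rpt t s)))
      = cnj (\<Sum>j<d. aval j (rpt t s) * pencil_at Msol (rpt t s) $$ (j, k))"
    unfolding cnj_sum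
  proof (rule sum.cong[OF refl])
    fix j assume "j \<in> {..<d}"
    then have "pencil_at Msol (rpt t s) $$ (k, j) = cnj (pencil_at Msol (rpt t s) $$ (j, k))"
      using k by (intro pencil_Msol_hermitian) simp_all
    then show "pencil_at Msol (rpt t s) $$ (k, j) * cnj (aval j (rpt t s))
        = cnj (aval j (rpt t s) * pencil_at Msol (rpt t s) $$ (j, k))"
      by (simp only: complex_cnj_mult mult.commute)
  qed
  also have "\<dots> = (if k = 0 then complex_of_real (peval f (rpt t s)) else 0)"
    unfolding row_equation[OF k] by simp
  finally show "(\<Sum>j<d. pencil_at Msol (rpt t s) $$ (k, j) * cnj (aval j (rpt t s)))
      = (if k = 0 then complex_of_real (peval f (rpt t s)) else 0)" .
qed

section \<open>Determinant and positivity of the solution\<close>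

lemma det_P: "\<exists>r>0. Determinant.det P = complex_of_real r"
proof -
  let ?z = "Determinant.det (Wm 0)"
  have V: "Vm 0 = map_mat cnj ((Wm 0)\<^sup>T)"
    by (rule eq_matI) (auto simp: Wm_def Vm_def)
  have "comm_ring_hom cnj" by unfold_locales auto
  then have "Determinant.det (Vm 0) = cnj ?z"
    unfolding V using comm_ring_hom.hom_det[of cnj "(Wm 0)\<^sup>T"] det_transpose[OF carriers(1), of 0] by simp
  \<comment> \<open>Since \<open>V\<close> is the adjoint of \<open>W\<close>, their determinants
    are conjugate and their product is a squared modulus.\<close>
  then have eq: "Determinant.det P = complex_of_real ((cmod ?z)\<^sup>2)"
    using det_mult[OF carriers(1,2), of 0 0] WV[of 0] by (simp only: complex_norm_square)
  have "Determinant.det P * Determinant.det Q = 1"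
    using det_mult[OF P Q] PQ by simp
  then have "(cmod ?z)\<^sup>2 > 0" using eq by auto
  then show ?thesis using eq by blast
qed

lemma det_pencil_Msol:
  "Determinant.det P * Determinant.det (pencil_at Msol (rpt t s)) = (\<Prod>i<d. complex_of_real (t - lroot s i))"
proof -
  have D: "Determinant.det (Dm t s) = (\<Prod>i<d. complex_of_real (t - lroot s i))"
  proof -
    have "upper_triangular (Dm t s)" by (auto simp: upper_triangular_def Dm_def)
    then have "Determinant.det (Dm t s) = prod_list (diag_mat (Dm t s))"
      by (rule det_upper_triangular[OF _ carriers(4)])
    also have "\<dots> = (\<Prod>i<d. complex_of_real (t - lroot s i))"
      unfolding prod_list_diag_prod by (simp add: Dm_def lessThan_atLeast0)
    finally show ?thesis .
  qed
  have "Determinant.det P * Determinant.det (pencil_at Msol (rpt t s))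
      = Determinant.det P * (Determinant.det (Xm s) * (Determinant.det (Dm t s) * Determinant.det (Ym s)))"
    unfolding pencil_Msol_factor
    by (simp add: det_mult[of _ d] mult_carrier_mat[of _ d d])
  also have "\<dots> = (Determinant.det P * (Determinant.det (Xm s) * Determinant.det (Ym s))) * Determinant.det (Dm t s)"
    by (simp only: mult_ac)
  also have "Determinant.det (Xm s) * Determinant.det (Ym s) = Determinant.det Q"
    using det_mult[OF XY_carriers, of s s] by (simp add: XY)
  also have "Determinant.det P * Determinant.det Q = 1" using det_mult[OF P Q] PQ by simp
  finally show ?thesis by (simp add: D)
qed

lemma f_eq_det: "\<exists>c>0. cpoly f = Const (complex_of_real c) * Determinant.det (pencil Msol)"
proof -
  obtain r where r: "r > 0" "Determinant.det P = complex_of_real r" using det_P by blast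
  \<comment> \<open>On a line \<open>f\<close> is \<open>f(e)\<close> times the product of the
    \<open>t - t_i\<close>, and that product is \<open>det P\<close> times the determinant of the
    pencil; hence the constant.\<close>
  have "cpoly f = Const (complex_of_real (peval f e * r)) * Determinant.det (pencil Msol)"
  proof (rule poly3_eqI_off_plane[OF nu_q])
    fix w assume "\<nu> \<bullet> w \<noteq> 0"
    then obtain z t s where w: "w = z *\<^sub>R rpt t s" using rpt_scale by blast
    have "peval (Const (complex_of_real (peval f e * r)) * Determinant.det (pencil Msol)) (cvec w)
        = complex_of_real (peval f e * r) * (complex_of_real z ^ d * Determinant.det (pencil_at Msol (rpt t s)))"
      using pencil_at_carrier[of Msol d "rpt t s", OF Msol_carrier]
      by (simp add: peval_mult peval_det_pencil[of Msol d, OF Msol_carrier] w pencil_at_scaleR[of Msol d, OF Msol_carrier])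
    also have "\<dots> = complex_of_real z ^ d * (complex_of_real (peval f e) *
        (Determinant.det P * Determinant.det (pencil_at Msol (rpt t s))))"
      by (simp add: r(2))
    also have "\<dots> = complex_of_real (peval f w)"
      unfolding det_pencil_Msol by (simp add: w f_scaleR f_at)
    finally show "peval (cpoly f) (cvec w)
        = peval (Const (complex_of_real (peval f e * r)) * Determinant.det (pencil Msol)) (cvec w)"
      by (simp add: peval_cpoly)
  qed
  then show ?thesis using fe r(1) by (intro exI[of _ "peval f e * r"]) simp
qed

text \<open>At \<open>e\<close> the functionals \<kappa>, \<mu>, \<nu> take the values 1, 0, 0, so
  the pencil is the inverse of the Gram matrix. With \<open>u = Q v\<close> its form at
  \<open>v\<close> is the squared norm of \<open>V u\<close>, which is nonzero since
  \<open>V\<close> and \<open>P\<close> are invertible.\<close>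

lemma pos_def_Msol: "pos_def (pencil_at Msol e)"
proof -
  have eq: "pencil_at Msol e = Q"
    using pencil_at_carrier[of Msol d e, OF Msol_carrier] Q dual
    by (intro eq_matI) (auto simp: pencil_Msol_index dual_bases_def simp del: index_mult_mat(1))
  show ?thesis
    unfolding eq pos_def_def
  proof (intro conjI ballI impI hermitian_Q)
    fix v :: "complex Matrix.vec"
    assume v: "v \<in> carrier_vec (dim_row Q)" "v \<noteq> 0\<^sub>v (dim_row Q)"
    define u where "u = Q *\<^sub>v v"
    have dv: "v \<in> carrier_vec d" using v(1) Q by simp
    have u: "u \<in> carrier_vec d" using Q dv by (simp add: u_def mult_mat_vec_carrier[of _ d d])
    have Pu: "P *\<^sub>v u = v"
      using assoc_mult_mat_vec[OF P Q dv] PQ dv by (simp add: u_def)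
    have "u \<noteq> 0\<^sub>v d"
    proof
      assume "u = 0\<^sub>v d"
      moreover have "P *\<^sub>v 0\<^sub>v d = 0\<^sub>v d" using P by (intro eq_vecI) (auto simp: scalar_prod_def)
      ultimately have "v = 0\<^sub>v d" using Pu by simp
      then show False using v(2) Q by simp
    qed
    have "Vm 0 *\<^sub>v u \<noteq> 0\<^sub>v d"
    proof
      assume z: "Vm 0 *\<^sub>v u = 0\<^sub>v d"
      have "u = Xm 0 *\<^sub>v (Vm 0 *\<^sub>v u)"
        using assoc_mult_mat_vec[OF XY_carriers(1) carriers(2) u, of 0 0] XV u by simp
      also have "\<dots> = 0\<^sub>v d" unfolding z using carrier_matD[OF XY_carriers(1)] by (intro eq_vecI) (auto simp: scalar_prod_def)
      finally show False using \<open>u \<noteq> 0\<^sub>v d\<close> by contradiction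
    qed
    then obtain i where i: "i < d" "(Vm 0 *\<^sub>v u) $ i \<noteq> 0"
      using carrier_matD[OF carriers(2), of 0] by (auto simp: Matrix.vec_eq_iff)
    have "(Q *\<^sub>v v) \<bullet>c v = (\<Sum>j<d. u $ j * cnj (v $ j))"
      using dv u by (simp add: u_def scalar_prod_def lessThan_atLeast0)
    also have "\<dots> = complex_of_real (\<Sum>i<d. (cmod ((Vm 0 *\<^sub>v u) $ i))\<^sup>2)"
      using gram_quadratic_form[OF u, of 0] by (simp add: WV Pu)
    finally have "Re ((Q *\<^sub>v v) \<bullet>c v) = (\<Sum>i<d. (cmod ((Vm 0 *\<^sub>v u) $ i))\<^sup>2)" by simp
    also have "\<dots> > 0"
      by (rule sum_pos2[of _ i]) (use i in auto)
    finally show "Re ((Q *\<^sub>v v) \<bullet>c v) > 0" .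
  qed
qed

end


section \<open>Uniqueness of the solution\<close>

lemma (in conjugate_splitting) aval_independent_off_roots:
  assumes z: "\<And>t s. t \<notin> lroot s ` {..<d} \<Longrightarrow> (\<Sum>k<d. v k * aval k (rpt t s)) = 0" and k: "k < d"
  shows "v k = 0"
proof (rule aval_independent[OF _ k])
  fix t s
  \<comment> \<open>On each line only \<open>d\<close> values of \<open>t\<close> are excluded, so
    this polynomial has infinitely many zeros and vanishes at the excluded values too.\<close>
  define U where "U = (\<Sum>k<d. smult (v k) (section_at (complex_of_real s) (chart_poly e p q (vec_index a k))))"
  have U: "poly U (complex_of_real x) = (\<Sum>k<d. v k * aval k (rpt x s))" for x
    by (simp add: U_def poly_sum poly_section_at bpoly_chart_poly chart_point_real aval_def)
  have "complex_of_real ` (UNIV - lroot s ` {..<d}) \<subseteq> {x. poly U x = 0}"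
    using z U by auto
  moreover have "infinite (complex_of_real ` (UNIV - lroot s ` {..<d}))"
  proof
    assume "finite (complex_of_real ` (UNIV - lroot s ` {..<d}))"
    then have "finite (UNIV - lroot s ` {..<d})" by (rule finite_imageD) (simp add: inj_on_def)
    then have "finite (UNIV :: real set)" by simp
    with infinite_UNIV_char_0[where 'a = real] show False by contradiction
  qed
  ultimately have inf: "infinite {x. poly U x = 0}" by (rule infinite_super)
  have "U = 0"
  proof (rule ccontr)
    assume "U \<noteq> 0"
    from poly_roots_finite[OF this] inf show False by contradiction
  qed
  then show "(\<Sum>k<d. v k * aval k (rpt t s)) = 0" using U[of t] by simp
qed

context gram
begin

text \<open>The row equations at the zeros of \<open>f\<close> force \<open>V N(t, s) = (t - R) V N(e)\<close>. The column equations
  then say that the conjugates of the \<open>a\<^sub>k\<close> satisfy the linear relations given by the rows of \<open>N(e)\<close>.\<close>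

lemma homogeneous_system_trivial:
  assumes N: "\<And>i. N i \<in> carrier_mat d d"
    and row: "\<And>v k. k < d \<Longrightarrow> (\<Sum>j<d. aval j v * pencil_at N v $$ (j, k)) = 0"
    and col: "\<And>v k. k < d \<Longrightarrow> (\<Sum>j<d. pencil_at N v $$ (k, j) * cnj (aval j v)) = 0"
    and jk: "j0 < d" "k0 < d"
  shows "N i $$ (j0, k0) = 0"
proof -
  define E where "E = pencil_at N e"
  note c = pencil_at_carrier[of N d, OF N]
  have E: "E \<in> carrier_mat d d" by (simp add: E_def c)
  have VN: "Vm s * pencil_at N (rpt t s) = Dm t s * (Vm s * E)" for t s
  proof (rule eq_matI)
    fix i k assume "i < dim_row (Dm t s * (Vm s * E))" "k < dim_col (Dm t s * (Vm s * E))"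
    then have ik: "i < d" "k < d" using E carrier_matD[OF carriers(4), of t s] by auto
    \<comment> \<open>The point and the \<open>i\<close>-th zero of \<open>f\<close> lie on one line
      in direction \<open>e\<close>, at parameter distance \<open>t - t_i\<close>; at the zero
      itself the row equations remove the pencil.\<close>
    have lin: "pencil_at N (rpt t s) $$ (j, k)
        = pencil_at N (zero_pt s i) $$ (j, k) + complex_of_real (t - lroot s i) * E $$ (j, k)" if "j < d" for j
      unfolding E_def pencil_at_index[of N d, OF N that ik(2)]
      by (simp add: zero_pt_def rpt_def sum_3 algebra_simps)
    have "(Vm s * pencil_at N (rpt t s)) $$ (i, k) = (\<Sum>j<d. Vm s $$ (i, j) * pencil_at N (rpt t s) $$ (j, k))"
      by (rule index_mult_mat_sum[OF carriers(2) c ik])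
    also have "\<dots> = (\<Sum>j<d. Vm s $$ (i, j) * pencil_at N (zero_pt s i) $$ (j, k))
        + complex_of_real (t - lroot s i) * (\<Sum>j<d. Vm s $$ (i, j) * E $$ (j, k))"
      by (simp add: lin distrib_left sum.distrib sum_distrib_left mult.left_commute del: of_real_diff)
    also have "(\<Sum>j<d. Vm s $$ (i, j) * pencil_at N (zero_pt s i) $$ (j, k))
        = (\<Sum>j<d. aval j (zero_pt s i) * pencil_at N (zero_pt s i) $$ (j, k)) / complex_of_real (gval s i)"
      unfolding sum_divide_distrib by (rule sum.cong) (use ik in \<open>simp_all add: Vm_def\<close>)
    also have "\<dots> = 0" by (simp add: row[OF ik(2)])
    also have "0 + complex_of_real (t - lroot s i) * (\<Sum>j<d. Vm s $$ (i, j) * E $$ (j, k))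
        = complex_of_real (t - lroot s i) * (Vm s * E) $$ (i, k)"
      by (simp only: add_0_left index_mult_mat_sum[OF carriers(2) E ik])
    also have "\<dots> = (\<Sum>m<d. if m = i then complex_of_real (t - lroot s i) * (Vm s * E) $$ (i, k) else 0)"
      using ik by simp
    also have "\<dots> = (\<Sum>m<d. Dm t s $$ (i, m) * (Vm s * E) $$ (m, k))"
      by (rule sum.cong[OF refl]) (use ik in \<open>auto simp: Dm_def simp del: index_mult_mat(1)\<close>)
    also have "\<dots> = (Dm t s * (Vm s * E)) $$ (i, k)"
      by (rule index_mult_mat_sum[OF carriers(4) mult_carrier_mat[OF carriers(2) E] ik, symmetric])
    finally show "(Vm s * pencil_at N (rpt t s)) $$ (i, k) = (Dm t s * (Vm s * E)) $$ (i, k)" .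
  qed (use E c[of "rpt t s"] carrier_matD[OF carriers(4), of t s] carrier_matD[OF carriers(2), of s] in auto)
  have E0: "E $$ (j, k) = 0" if jk: "j < d" "k < d" for j k
  proof -
    \<comment> \<open>For \<open>y\<close> the conjugated values of \<open>a\<close>, the column
      equations give \<open>(t - R) V E y = V N y = 0\<close>. Off the roots \<open>t - R\<close> is
      invertible, and so is \<open>V\<close>, hence \<open>E y = 0\<close>. Conjugating a row of
      this yields a linear relation among the independent \<open>a_k\<close>.\<close>
    have "cnj (E $$ (j, k)) = 0"
    proof (rule aval_independent_off_roots[OF _ jk(2)])
      fix t s assume t: "t \<notin> lroot s ` {..<d}"
      define y where "y = Matrix.vec d (\<lambda>j. cnj (aval j (rpt t s)))"
      have y: "y \<in> carrier_vec d" by (simp add: y_def)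
      have Ny: "pencil_at N (rpt t s) *\<^sub>v y = 0\<^sub>v d"
      proof (rule eq_vecI)
        fix k assume "k < dim_vec (0\<^sub>v d :: complex Matrix.vec)"
        then have k: "k < d" by simp
        show "(pencil_at N (rpt t s) *\<^sub>v y) $ k = 0\<^sub>v d $ k"
          using index_mult_mat_vec_sum[OF c y k, of "rpt t s"] col[OF k] k by (simp add: y_def)
      qed (use carrier_matD[OF c] in auto)
      define w where "w = (Vm s * E) *\<^sub>v y"
      have VE: "Vm s * E \<in> carrier_mat d d" using E by (rule mult_carrier_mat[OF carriers(2)])
      have w: "w \<in> carrier_vec d" unfolding w_def by (rule mult_mat_vec_carrier[OF VE y])
      have "Dm t s *\<^sub>v w = (Dm t s * (Vm s * E)) *\<^sub>v y"
        unfolding w_def by (rule assoc_mult_mat_vec[OF carriers(4) VE y, symmetric])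
      also have "\<dots> = Vm s *\<^sub>v (pencil_at N (rpt t s) *\<^sub>v y)"
        unfolding VN[symmetric] by (rule assoc_mult_mat_vec[OF carriers(2) c y])
      finally have Dw: "Dm t s *\<^sub>v w = Vm s *\<^sub>v 0\<^sub>v d" unfolding Ny .
      have w0: "w $ i = 0" if i: "i < d" for i
      proof -
        have "(Dm t s *\<^sub>v w) $ i = (\<Sum>m<d. Dm t s $$ (i, m) * w $ m)"
          by (rule index_mult_mat_vec_sum[OF carriers(4) w i])
        also have "\<dots> = (\<Sum>m<d. if m = i then complex_of_real (t - lroot s i) * w $ i else 0)"
          by (rule sum.cong[OF refl]) (use i in \<open>auto simp: Dm_def\<close>)
        also have "\<dots> = complex_of_real (t - lroot s i) * w $ i" using i by simp
        finally have "complex_of_real (t - lroot s i) * w $ i = (Vm s *\<^sub>v 0\<^sub>v d) $ i" by (simp only: Dw)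
        also have "\<dots> = 0" using index_mult_mat_vec_sum[OF carriers(2) zero_carrier_vec i, of s] by simp
        finally have "t - lroot s i = 0 \<or> w $ i = 0" by (simp only: mult_eq_0_iff of_real_eq_0_iff)
        then show ?thesis using t i by auto
      qed
      have "E *\<^sub>v y = (Xm s * Vm s) *\<^sub>v (E *\<^sub>v y)"
        using mult_mat_vec_carrier[OF E y] by (simp add: XV)
      also have "\<dots> = Xm s *\<^sub>v (Vm s *\<^sub>v (E *\<^sub>v y))"
        by (rule assoc_mult_mat_vec[OF XY_carriers(1) carriers(2) mult_mat_vec_carrier[OF E y]])
      also have "Vm s *\<^sub>v (E *\<^sub>v y) = w"
        unfolding w_def by (rule assoc_mult_mat_vec[OF carriers(2) E y, symmetric])
      finally have "(E *\<^sub>v y) $ j = 0"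
        using index_mult_mat_vec_sum[OF XY_carriers(1) w jk(1), of s] w0 by simp
      then have "(\<Sum>k<d. E $$ (j, k) * cnj (aval k (rpt t s))) = 0"
        using index_mult_mat_vec_sum[OF E y jk(1)] by (simp add: y_def)
      then have "cnj (\<Sum>k<d. E $$ (j, k) * cnj (aval k (rpt t s))) = 0" by simp
      then show "(\<Sum>k<d. cnj (E $$ (j, k)) * aval k (rpt t s)) = 0"
        by (simp only: cnj_sum complex_cnj_mult complex_cnj_cnj)
    qed
    then show ?thesis by simp
  qed
  have N0: "pencil_at N (rpt t s) $$ (j0, k0) = 0" for t s
  proof -
    have "E = 0\<^sub>m d d" using E E0 by (intro eq_matI) auto
    then have "Vm s * pencil_at N (rpt t s) = 0\<^sub>m d d"
      unfolding VN by (simp add: right_mult_zero_mat[of _ d d])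
    then have "Xm s * (Vm s * pencil_at N (rpt t s)) = 0\<^sub>m d d" by (simp add: right_mult_zero_mat[of _ d d])
    then have "(Xm s * Vm s) * pencil_at N (rpt t s) = 0\<^sub>m d d"
      using assoc[OF XY_carriers(1) carriers(2) c] by simp
    then have "pencil_at N (rpt t s) = 0\<^sub>m d d" using c[of "rpt t s"] by (simp add: XV)
    then show ?thesis using jk by simp
  qed
  define x where "x = (\<lambda>i. N i $$ (j0, k0))"
  \<comment> \<open>A fixed entry of the pencil is a linear functional of the point. It vanishes at
    \<open>e\<close>, at \<open>q\<close> (where \<open>t = s = 0\<close>) and at
    \<open>p + q\<close> (where \<open>t = 0\<close>, \<open>s = 1\<close>), hence on a
    basis.\<close>
  define L where "L = (\<lambda>v::real^3. \<Sum>i\<in>UNIV. complex_of_real (v $h i) * x i)"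
  have Lp: "pencil_at N v $$ (j0, k0) = L v" for v
    unfolding L_def x_def by (rule pencil_at_index[of N d, OF N jk])
  have Le: "L e = 0" using E0[OF jk] by (simp add: E_def Lp)
  have Lq: "L q = 0" using N0[of 0 0] by (simp add: Lp rpt_def)
  have "L (p + q) = 0" using N0[of 0 1] by (simp add: Lp rpt_def)
  then have Lpp: "L p = 0" using Lq by (simp add: L_def distrib_right sum.distrib)
  have "x i = (\<Sum>k\<in>UNIV. complex_of_real (if i = k then 1 else 0) * x k)"
    by (simp add: if_distrib[of complex_of_real] if_distrib[of "\<lambda>c. c * _"] cong: if_cong)
  also have "\<dots> = (\<Sum>k\<in>UNIV. complex_of_real (\<kappa> $h i * e $h k + \<mu> $h i * p $h k + \<nu> $h i * q $h k) * x k)"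
    using dual by (intro sum.cong refl) (simp add: dual_bases_def)
  also have "\<dots> = complex_of_real (\<kappa> $h i) * L e + complex_of_real (\<mu> $h i) * L p + complex_of_real (\<nu> $h i) * L q"
    by (simp add: L_def sum_3 algebra_simps)
  finally show ?thesis by (simp add: Le Lpp Lq x_def)
qed

lemma solution_unique:
  assumes "solves_system (cpoly f) a M" "solves_system (cpoly f) a M'"
  shows "M = M'"
proof
  fix i
  define N where "N = (\<lambda>i. M i - M' i)"
  note M = solves_systemD[OF assms(1)] and M' = solves_systemD[OF assms(2)]
  have N: "N i \<in> carrier_mat d d" for i unfolding N_def by (rule minus_carrier_mat[OF M'(1)])
  have diff: "pencil_at N v $$ (j, k) = pencil_at M v $$ (j, k) - pencil_at M' v $$ (j, k)"
    if "j < d" "k < d" for v j k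
  proof -
    have "N i $$ (j, k) = M i $$ (j, k) - M' i $$ (j, k)" for i
      using that M'(1)[of i] by (simp add: N_def)
    then show ?thesis
      unfolding pencil_at_index[of N d, OF N that] pencil_at_index[of M d, OF M(1) that]
        pencil_at_index[of M' d, OF M'(1) that]
      by (simp add: right_diff_distrib sum_subtractf)
  qed
  have "N i $$ (j, k) = 0" if "j < d" "k < d" for j k
  proof (rule homogeneous_system_trivial[OF N _ _ that])
    fix v k assume k: "k < d"
    show "(\<Sum>j<d. aval j v * pencil_at N v $$ (j, k)) = 0"
      using M(2)[OF k, of v] M'(2)[OF k, of v] k by (simp add: diff right_diff_distrib sum_subtractf)
    show "(\<Sum>j<d. pencil_at N v $$ (k, j) * cnj (aval j v)) = 0"
      using M(3)[OF k, of v] M'(3)[OF k, of v] k by (simp add: diff left_diff_distrib sum_subtractf)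
  qed
  then have "M i $$ (j, k) = M' i $$ (j, k)" if "j < d" "k < d" for j k
    using that M'(1)[of i] by (force simp: N_def)
  then show "M i = M' i" using M(1)[of i] M'(1)[of i] by (intro eq_matI) auto
qed

end

theorem theorem1:
  fixes d :: nat and f g :: "real poly3" and e :: "real^3"
    and S :: "(complex^3) set set" and a :: "complex poly3 Matrix.vec"
  assumes "d \<ge> 1"
    and "homogeneous d f"
    and "hyperbolic f e"
    and "peval f e > 0"
    and "g = Const (e $h 1) * pdiff 1 f + Const (e $h 2) * pdiff 2 f + Const (e $h 3) * pdiff 3 f"
    and "smooth_curve (cpoly f)"
    and "finite (zeros (cpoly f) \<inter> zeros (cpoly g))"
    and "card (zeros (cpoly f) \<inter> zeros (cpoly g)) = d * (d - 1)"
    and "zeros (cpoly f) \<inter> zeros (cpoly g) = S \<union> conj_point ` S"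
    and "S \<inter> conj_point ` S = {}"
    and "dim_vec a = d"
    and "list_basis (list_of_vec a) (forms_vanishing_on (d - 1) S)"
    and "vec_index a 0 = cpoly g"
  shows "(\<exists>!M. solves_system (cpoly f) a M) \<and>
    (\<forall>M. solves_system (cpoly f) a M \<longrightarrow>
      (\<forall>i. hermitian (M i)) \<and>
      (\<exists>c::real. c > 0 \<and>
        cpoly f = Const (complex_of_real c) * Determinant.det (pencil M) \<and>
        pos_def (pencil_at M e)))"
proof -
  have "e \<noteq> 0"
  proof
    assume "e = 0"
    then have "e = 0 *s e" by simp
    then have "peval f e = 0 ^ d * peval f e" using peval_scale[OF assms(2), of 0 e] by simp
    then show False using assms(1,4) by (simp add: power_0_left)
  qed
  then obtain p q \<kappa> \<mu> \<nu> where dual: "dual_bases e p q \<kappa> \<mu> \<nu>" using dual_bases_exist by blast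
  interpret conjugate_splitting d f g e S a p q \<kappa> \<mu> \<nu>
    by unfold_locales (fact assms dual)+
  obtain P H1 H2 Q where "gram d f g e S a p q \<kappa> \<mu> \<nu> P H1 H2 Q" using gram_exists by blast
  then interpret gram d f g e S a p q \<kappa> \<mu> \<nu> P H1 H2 Q .
  have eq: "M = Msol" if "solves_system (cpoly f) a M" for M
    by (rule solution_unique[OF that solves_Msol])
  obtain c where "c > 0" "cpoly f = Const (complex_of_real c) * Determinant.det (pencil Msol)"
    using f_eq_det by blast
  then show ?thesis
    using solves_Msol eq hermitian_Msol pos_def_Msol by blast
qed

end
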